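(* Let $\kappa$ be a field, $G$ a group and $\sigma\in pm(G)$ a factor set. Assume that $\Omega_\sigma$ is discrete. Then $$\kappa_{par}^{\sigma}G\cong\bigoplus_{i\in I}M_{n_i}(\kappa^{\sigma_i}H_i)$$ as $\kappa$-algebras, where $i$ runs over the index set $I$ of the connected components $\Gamma^\sigma_i(G)$ of the groupoid $\Gamma^\sigma(G)$, $n_i$ is the number of objects of $\Gamma^\sigma_i(G)$, $H_i=\{g\in G: gA=A\}$ is the stabilizer of an arbitrary object $A$ of $\Gamma^\sigma_i(G)$, $\sigma_i=\sigma|_{H_i\times H_i}$ (which is a global $2$-cocycle $H_i\times H_i\to\kappa^*$) and $\kappa^{\sigma_i}H_i$ is the corresponding twisted group algebra.
   Context: Algebras are associative and unital. A partial projective $\sigma$-representation of $G$ in a unital $\kappa$-algebra $R$ (with $1_R\neq 0$) is a map $\Gamma:G\to R$ for which there is a function $\sigma:G\times G\to\kappa$ (called the factor set) such that for all $g,h\in G$: (i) if $\sigma(g,h)=0$ then $\Gamma(g^{-1})\Gamma(gh)=0$ and $\Gamma(gh)\Gamma(h^{-1})=0$; (ii) if $\Gamma(g)\Gamma(h)=0$ then $\sigma(g,h)=0$; (iii) $\Gamma(1_G)=1_R$; (iv) $\Gamma(g^{-1})\Gamma(g)\Gamma(h)=\sigma(g,h)\Gamma(g^{-1})\Gamma(gh)$; (v) $\Gamma(g)\Gamma(h)\Gamma(h^{-1})=\sigma(g,h)\Gamma(gh)\Gamma(h^{-1})$. The set of all factor sets of $G$ (over all such $R$ and $\Gamma$)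 is $pm(G)$. For $\sigma\in pm(G)$, the twisted partial group algebra $\kappa_{par}^{\sigma}G$ is the universal $\kappa$-algebra generated by symbols $[g]^\sigma$ ($g\in G$) subject to, for all $g,h\in G$: $\sigma(g,h)=0\Rightarrow [g^{-1}]^\sigma[gh]^\sigma=[gh]^\sigma[h^{-1}]^\sigma=0$; $[g^{-1}]^\sigma[g]^\sigma[h]^\sigma=\sigma(g,h)[g^{-1}]^\sigma[gh]^\sigma$; $[g]^\sigma[h]^\sigma[h^{-1}]^\sigma=\sigma(g,h)[gh]^\sigma[h^{-1}]^\sigma$; $[g]^\sigma[1_G]^\sigma=[1_G]^\sigma[g]^\sigma=[g]^\sigma$. Let $\Omega=\{\xi\subseteq G:1\in\xi\}$, identified with $\prod_{g\in G\setminus\{1\}}\{0,1\}$ and given the product topology. The $\sigma$-prohibitions of type I are the sets $\{h,hg,hgs\}$ with $h,g,s\in G$ and $\sigma(g,s)=0$; those of type II are the sets $\{h,hg,hgs,hgst\}$ with $h,g,s,t\in G$ and $\sigma(g,st)\sigma(s,t)\neq\sigma(g,s)\sigma(gs,t)$. $\mathcal{P}_\sigma$ is the set of all $\sigma$-prohibitions, and $\Omega_\sigma=\{\xi\in\Omega: V\nsubseteq\xi\text{ for all }V\in\mathcal{P}_\sigma\}$ with the subspace topology (a compact space). If $\Omega_\sigma$ is discrete, then it is finite and all its elements are finite sets. The groupoid $\Gamma^\sigma(G)$ has as objects the elements of $\Omega_\sigma$, and as morphisms the elements $r(g,A)$ with $r\in\kappa\setminus\{0\}$, $A\in\Omega_\sigma$,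 $g^{-1}\in A$; the morphism $r(g,A)$ goes from $A$ to $gA$. Two morphisms $r(g,B)$ and $l(h,A)$ are composable iff $B=hA$, and then their product is $rl\,\sigma(g,h)(gh,A)$. *)

theory Defs
  imports
    "HOL-Analysis.Function_Topology"
    "Jordan_Normal_Form.Matrix"
    "HOL-Algebra.QuotRing"
    "HOL-Algebra.Group_Action"
begin

section \<open>Associative unital algebras\<close>

text \<open>Same axioms as \<^locale>\<open>Module.algebra\<close>, but without commutativity of the
  multiplication of \<open>M\<close>, so that compatibility of the scalars is needed on both sides.\<close>

locale unital_algebra = Module.module + Ring.ring M +
  assumes smult_mult_left:
      "\<lbrakk>a \<in> carrier R; x \<in> carrier M; y \<in> carrier M\<rbrakk> \<Longrightarrow>
        (a \<odot>\<^bsub>M\<^esub> x) \<otimes>\<^bsub>M\<^esub> y = a \<odot>\<^bsub>M\<^esub> (x \<otimes>\<^bsub>M\<^esub> y)"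
    and smult_mult_right:
      "\<lbrakk>a \<in> carrier R; x \<in> carrier M; y \<in> carrier M\<rbrakk> \<Longrightarrow>
        x \<otimes>\<^bsub>M\<^esub> (a \<odot>\<^bsub>M\<^esub> y) = a \<odot>\<^bsub>M\<^esub> (x \<otimes>\<^bsub>M\<^esub> y)"

definition algebra_iso ::
    "('k, 'm) ring_scheme \<Rightarrow> ('k, 'a, 'p) module_scheme \<Rightarrow> ('k, 'b, 'q) module_scheme \<Rightarrow> ('a \<Rightarrow> 'b) set"
  where "algebra_iso K A B =
    {\<phi> \<in> ring_iso A B. \<forall>r\<in>carrier K. \<forall>x\<in>carrier A. \<phi> (r \<odot>\<^bsub>A\<^esub> x) = r \<odot>\<^bsub>B\<^esub> \<phi> x}"

definition algebra_isomorphic ::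
    "('k, 'm) ring_scheme \<Rightarrow> ('k, 'a, 'p) module_scheme \<Rightarrow> ('k, 'b, 'q) module_scheme \<Rightarrow> bool"
  where "algebra_isomorphic K A B \<longleftrightarrow> algebra_iso K A B \<noteq> {}"

definition quotient_algebra ::
    "('k, 'a, 'p) module_scheme \<Rightarrow> 'a set \<Rightarrow> ('k, 'a set) module"
  where "quotient_algebra A I =
    \<lparr>carrier = carrier (A Quot I), mult = mult (A Quot I), one = one (A Quot I),
     zero = zero (A Quot I), add = add (A Quot I),
     smult = (\<lambda>r X. \<Union>x\<in>X. I +>\<^bsub>A\<^esub> (r \<odot>\<^bsub>A\<^esub> x))\<rparr>"

definition direct_sum_algebra ::
    "'i set \<Rightarrow> ('i \<Rightarrow> ('k, 'a) module) \<Rightarrow> ('k, 'i \<Rightarrow> 'a) module"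
  where "direct_sum_algebra I A =
    \<lparr>carrier = {f \<in> \<Pi>\<^sub>E i\<in>I. carrier (A i). finite {i \<in> I. f i \<noteq> \<zero>\<^bsub>A i\<^esub>}},
     mult = (\<lambda>f g. \<lambda>i\<in>I. f i \<otimes>\<^bsub>A i\<^esub> g i),
     one = (\<lambda>i\<in>I. \<one>\<^bsub>A i\<^esub>),
     zero = (\<lambda>i\<in>I. \<zero>\<^bsub>A i\<^esub>),
     add = (\<lambda>f g. \<lambda>i\<in>I. f i \<oplus>\<^bsub>A i\<^esub> g i),
     smult = (\<lambda>r f. \<lambda>i\<in>I. r \<odot>\<^bsub>A i\<^esub> f i)\<rparr>"

text \<open>The type of matrices of the matrix library has no sort restriction on the entries, but the
  operations there come from type classes; here they are those of \<open>A\<close>.\<close>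

definition matrix_algebra ::
    "nat \<Rightarrow> ('k, 'a, 'p) module_scheme \<Rightarrow> ('k, 'a mat) module"
  where "matrix_algebra n A =
    \<lparr>carrier = {M \<in> carrier_mat n n. elements_mat M \<subseteq> carrier A},
     mult = (\<lambda>M N. mat n n (\<lambda>(i, j). \<Oplus>\<^bsub>A\<^esub>k\<in>{..<n}. M $$ (i, k) \<otimes>\<^bsub>A\<^esub> N $$ (k, j))),
     one = mat n n (\<lambda>(i, j). if i = j then \<one>\<^bsub>A\<^esub> else \<zero>\<^bsub>A\<^esub>),
     zero = mat n n (\<lambda>_. \<zero>\<^bsub>A\<^esub>),
     add = (\<lambda>M N. mat n n (\<lambda>ij. M $$ ij \<oplus>\<^bsub>A\<^esub> N $$ ij)),
     smult = (\<lambda>r M. mat n n (\<lambda>ij. r \<odot>\<^bsub>A\<^esub> M $$ ij))\<rparr>"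

section \<open>Twisted monoid algebras and free algebras\<close>

text \<open>The function \<open>f\<close> stands for the formal combination \<open>\<Sum>\<^sub>x f(x) u\<^sub>x\<close>, where
  \<open>u\<^sub>x u\<^sub>y = \<tau>(x,y) u\<^sub>x\<^sub>y\<close>. For a 2-cocycle \<open>\<tau>\<close> with invertible values, which need not be normalised,
  the unity is \<open>\<tau>(1,1)\<inverse> u\<^sub>1\<close>. Only the values of \<open>\<tau>\<close> on the carrier of \<open>M\<close> are used, so no
  restriction of \<open>\<tau>\<close> has to be written when \<open>M\<close> is replaced by a subgroup.\<close>

definition twisted_monoid_algebra ::
    "('k, 'm) ring_scheme \<Rightarrow> ('x, 'n) monoid_scheme \<Rightarrow> ('x \<Rightarrow> 'x \<Rightarrow> 'k) \<Rightarrow> ('k, 'x \<Rightarrow> 'k) module"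
  where "twisted_monoid_algebra K M \<tau> =
    \<lparr>carrier = {f. (\<forall>x\<in>carrier M. f x \<in> carrier K) \<and> (\<forall>x. x \<notin> carrier M \<longrightarrow> f x = \<zero>\<^bsub>K\<^esub>) \<and>
                   finite {x. f x \<noteq> \<zero>\<^bsub>K\<^esub>}},
     mult = (\<lambda>f g x. \<Oplus>\<^bsub>K\<^esub>p\<in>{(y, z). y \<in> carrier M \<and> z \<in> carrier M \<and> f y \<noteq> \<zero>\<^bsub>K\<^esub> \<and> g z \<noteq> \<zero>\<^bsub>K\<^esub> \<and>
                                y \<otimes>\<^bsub>M\<^esub> z = x}.
                 f (fst p) \<otimes>\<^bsub>K\<^esub> g (snd p) \<otimes>\<^bsub>K\<^esub> \<tau> (fst p) (snd p)),
     one = (\<lambda>x. if x = \<one>\<^bsub>M\<^esub> then inv\<^bsub>K\<^esub> (\<tau> \<one>\<^bsub>M\<^esub> \<one>\<^bsub>M\<^esub>) else \<zero>\<^bsub>K\<^esub>),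
     zero = (\<lambda>_. \<zero>\<^bsub>K\<^esub>),
     add = (\<lambda>f g x. f x \<oplus>\<^bsub>K\<^esub> g x),
     smult = (\<lambda>r f x. r \<otimes>\<^bsub>K\<^esub> f x)\<rparr>"

abbreviation twisted_group_algebra ::
    "('k, 'm) ring_scheme \<Rightarrow> ('g, 'n) monoid_scheme \<Rightarrow> ('g \<Rightarrow> 'g \<Rightarrow> 'k) \<Rightarrow> ('k, 'g \<Rightarrow> 'k) module"
  where "twisted_group_algebra \<equiv> twisted_monoid_algebra"

definition global_cocycle ::
    "('k, 'm) ring_scheme \<Rightarrow> ('g, 'n) monoid_scheme \<Rightarrow> ('g \<Rightarrow> 'g \<Rightarrow> 'k) \<Rightarrow> bool"
  where "global_cocycle K H \<tau> \<longleftrightarrow>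
    (\<forall>x\<in>carrier H. \<forall>y\<in>carrier H. \<tau> x y \<in> carrier K - {\<zero>\<^bsub>K\<^esub>}) \<and>
    (\<forall>x\<in>carrier H. \<forall>y\<in>carrier H. \<forall>z\<in>carrier H.
        \<tau> x y \<otimes>\<^bsub>K\<^esub> \<tau> (x \<otimes>\<^bsub>H\<^esub> y) z = \<tau> x (y \<otimes>\<^bsub>H\<^esub> z) \<otimes>\<^bsub>K\<^esub> \<tau> y z)"

definition free_monoid :: "'x set \<Rightarrow> 'x list monoid"
  where "free_monoid X = \<lparr>carrier = lists X, mult = (@), one = []\<rparr>"

text \<open>Noncommutative polynomials: the monoid algebra of the free monoid, with trivial twist.\<close>

definition free_algebra :: "('k, 'm) ring_scheme \<Rightarrow> 'x set \<Rightarrow> ('k, 'x list \<Rightarrow> 'k) module"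
  where "free_algebra K X = twisted_monoid_algebra K (free_monoid X) (\<lambda>_ _. \<one>\<^bsub>K\<^esub>)"

definition free_gen :: "('k, 'm) ring_scheme \<Rightarrow> 'x \<Rightarrow> 'x list \<Rightarrow> 'k"
  where "free_gen K x = (\<lambda>w. if w = [x] then \<one>\<^bsub>K\<^esub> else \<zero>\<^bsub>K\<^esub>)"

section \<open>Partial projective representations and their factor sets\<close>

definition partial_projective_rep ::
    "('k, 'm) ring_scheme \<Rightarrow> ('g, 'n) monoid_scheme \<Rightarrow> ('k, 'r, 'p) module_scheme \<Rightarrow>
      ('g \<Rightarrow> 'r) \<Rightarrow> ('g \<Rightarrow> 'g \<Rightarrow> 'k) \<Rightarrow> bool"
  where "partial_projective_rep K G R \<Gamma> \<sigma> \<longleftrightarrow>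
    unital_algebra K R \<and> \<one>\<^bsub>R\<^esub> \<noteq> \<zero>\<^bsub>R\<^esub> \<and>
    \<Gamma> \<in> carrier G \<rightarrow> carrier R \<and>
    \<sigma> \<in> carrier G \<rightarrow> carrier G \<rightarrow> carrier K \<and>
    \<Gamma> \<one>\<^bsub>G\<^esub> = \<one>\<^bsub>R\<^esub> \<and>
    (\<forall>g\<in>carrier G. \<forall>h\<in>carrier G.
      (\<sigma> g h = \<zero>\<^bsub>K\<^esub> \<longrightarrow>
         \<Gamma> (inv\<^bsub>G\<^esub> g) \<otimes>\<^bsub>R\<^esub> \<Gamma> (g \<otimes>\<^bsub>G\<^esub> h) = \<zero>\<^bsub>R\<^esub> \<and>
         \<Gamma> (g \<otimes>\<^bsub>G\<^esub> h) \<otimes>\<^bsub>R\<^esub> \<Gamma> (inv\<^bsub>G\<^esub> h) = \<zero>\<^bsub>R\<^esub>) \<and>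
      (\<Gamma> g \<otimes>\<^bsub>R\<^esub> \<Gamma> h = \<zero>\<^bsub>R\<^esub> \<longrightarrow> \<sigma> g h = \<zero>\<^bsub>K\<^esub>) \<and>
      \<Gamma> (inv\<^bsub>G\<^esub> g) \<otimes>\<^bsub>R\<^esub> \<Gamma> g \<otimes>\<^bsub>R\<^esub> \<Gamma> h
        = \<sigma> g h \<odot>\<^bsub>R\<^esub> (\<Gamma> (inv\<^bsub>G\<^esub> g) \<otimes>\<^bsub>R\<^esub> \<Gamma> (g \<otimes>\<^bsub>G\<^esub> h)) \<and>
      \<Gamma> g \<otimes>\<^bsub>R\<^esub> \<Gamma> h \<otimes>\<^bsub>R\<^esub> \<Gamma> (inv\<^bsub>G\<^esub> h)
        = \<sigma> g h \<odot>\<^bsub>R\<^esub> (\<Gamma> (g \<otimes>\<^bsub>G\<^esub> h) \<otimes>\<^bsub>R\<^esub> \<Gamma> (inv\<^bsub>G\<^esub> h)))"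

text \<open>HOL cannot quantify over the carrier types of all algebras inside a set, so that type is a
  parameter. A theorem that assumes \<open>\<sigma> \<in> pm TYPE('r) K G\<close> for a type variable \<open>'r\<close> holds for
  factor sets of representations in algebras of every carrier type.\<close>

definition pm ::
    "'r itself \<Rightarrow> ('k, 'm) ring_scheme \<Rightarrow> ('g, 'n) monoid_scheme \<Rightarrow> ('g \<Rightarrow> 'g \<Rightarrow> 'k) set"
  where "pm _ K G =
    {\<sigma>. \<exists>(R :: ('k, 'r) module) \<Gamma>. partial_projective_rep K G R \<Gamma> \<sigma>}"

section \<open>The twisted partial group algebra\<close>

text \<open>Differences \<open>a \<ominus> b\<close> encode relations \<open>a = b\<close>. The free algebra has its own unity (the
  empty word), whereas the presented algebra has unity \<open>[1]\<close>: this is what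
  \<open>[g][1] = [1][g] = [g]\<close> expresses for the algebra generated by the symbols alone. In the free
  unital algebra it has to be imposed by the last relation; otherwise the quotient would have an
  additional direct factor, spanned by the class of \<open>1 - [1]\<close>.\<close>

definition par_relations ::
    "('k, 'm) ring_scheme \<Rightarrow> ('g, 'n) monoid_scheme \<Rightarrow> ('g \<Rightarrow> 'g \<Rightarrow> 'k) \<Rightarrow> ('g list \<Rightarrow> 'k) set"
  where "par_relations K G \<sigma> =
    (let F = free_algebra K (carrier G); b = free_gen K in
      {b (inv\<^bsub>G\<^esub> g) \<otimes>\<^bsub>F\<^esub> b (g \<otimes>\<^bsub>G\<^esub> h) |
         g h. g \<in> carrier G \<and> h \<in> carrier G \<and> \<sigma> g h = \<zero>\<^bsub>K\<^esub>} \<union>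
      {b (g \<otimes>\<^bsub>G\<^esub> h) \<otimes>\<^bsub>F\<^esub> b (inv\<^bsub>G\<^esub> h) |
         g h. g \<in> carrier G \<and> h \<in> carrier G \<and> \<sigma> g h = \<zero>\<^bsub>K\<^esub>} \<union>
      {b (inv\<^bsub>G\<^esub> g) \<otimes>\<^bsub>F\<^esub> b g \<otimes>\<^bsub>F\<^esub> b h
         \<ominus>\<^bsub>F\<^esub> \<sigma> g h \<odot>\<^bsub>F\<^esub> (b (inv\<^bsub>G\<^esub> g) \<otimes>\<^bsub>F\<^esub> b (g \<otimes>\<^bsub>G\<^esub> h)) |
         g h. g \<in> carrier G \<and> h \<in> carrier G} \<union>
      {b g \<otimes>\<^bsub>F\<^esub> b h \<otimes>\<^bsub>F\<^esub> b (inv\<^bsub>G\<^esub> h)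
         \<ominus>\<^bsub>F\<^esub> \<sigma> g h \<odot>\<^bsub>F\<^esub> (b (g \<otimes>\<^bsub>G\<^esub> h) \<otimes>\<^bsub>F\<^esub> b (inv\<^bsub>G\<^esub> h)) |
         g h. g \<in> carrier G \<and> h \<in> carrier G} \<union>
      {b g \<otimes>\<^bsub>F\<^esub> b \<one>\<^bsub>G\<^esub> \<ominus>\<^bsub>F\<^esub> b g | g. g \<in> carrier G} \<union>
      {b \<one>\<^bsub>G\<^esub> \<otimes>\<^bsub>F\<^esub> b g \<ominus>\<^bsub>F\<^esub> b g | g. g \<in> carrier G} \<union>
      {b \<one>\<^bsub>G\<^esub> \<ominus>\<^bsub>F\<^esub> \<one>\<^bsub>F\<^esub>})"

definition partial_group_algebra ::
    "('k, 'm) ring_scheme \<Rightarrow> ('g, 'n) monoid_scheme \<Rightarrow> ('g \<Rightarrow> 'g \<Rightarrow> 'k) \<Rightarrow>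
      ('k, ('g list \<Rightarrow> 'k) set) module"
  where "partial_group_algebra K G \<sigma> =
    quotient_algebra (free_algebra K (carrier G))
      (Idl\<^bsub>free_algebra K (carrier G)\<^esub> (par_relations K G \<sigma>))"

section \<open>The spectrum\<close>

definition Omega :: "('g, 'n) monoid_scheme \<Rightarrow> 'g set set"
  where "Omega G = {\<xi>. \<xi> \<subseteq> carrier G \<and> \<one>\<^bsub>G\<^esub> \<in> \<xi>}"

text \<open>The pullback is along the bijection of \<^term>\<open>Omega G\<close> with the product of copies of
  \<open>{False, True}\<close> that sends a set to its characteristic function on \<open>G \<setminus> {1}\<close>.\<close>

definition Omega_topology :: "('g, 'n) monoid_scheme \<Rightarrow> 'g set topology"
  where "Omega_topology G =
    pullback_topology (Omega G) (\<lambda>\<xi>. \<lambda>g\<in>carrier G - {\<one>\<^bsub>G\<^esub>}. g \<in> \<xi>)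
      (product_topology (\<lambda>_. discrete_topology (UNIV :: bool set)) (carrier G - {\<one>\<^bsub>G\<^esub>}))"

definition prohibitions_I ::
    "('k, 'm) ring_scheme \<Rightarrow> ('g, 'n) monoid_scheme \<Rightarrow> ('g \<Rightarrow> 'g \<Rightarrow> 'k) \<Rightarrow> 'g set set"
  where "prohibitions_I K G \<sigma> =
    {{h, h \<otimes>\<^bsub>G\<^esub> g, h \<otimes>\<^bsub>G\<^esub> g \<otimes>\<^bsub>G\<^esub> s} | h g s.
       h \<in> carrier G \<and> g \<in> carrier G \<and> s \<in> carrier G \<and> \<sigma> g s = \<zero>\<^bsub>K\<^esub>}"

definition prohibitions_II ::
    "('k, 'm) ring_scheme \<Rightarrow> ('g, 'n) monoid_scheme \<Rightarrow> ('g \<Rightarrow> 'g \<Rightarrow> 'k) \<Rightarrow> 'g set set"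
  where "prohibitions_II K G \<sigma> =
    {{h, h \<otimes>\<^bsub>G\<^esub> g, h \<otimes>\<^bsub>G\<^esub> g \<otimes>\<^bsub>G\<^esub> s, h \<otimes>\<^bsub>G\<^esub> g \<otimes>\<^bsub>G\<^esub> s \<otimes>\<^bsub>G\<^esub> t} | h g s t.
       h \<in> carrier G \<and> g \<in> carrier G \<and> s \<in> carrier G \<and> t \<in> carrier G \<and>
       \<sigma> g (s \<otimes>\<^bsub>G\<^esub> t) \<otimes>\<^bsub>K\<^esub> \<sigma> s t \<noteq> \<sigma> g s \<otimes>\<^bsub>K\<^esub> \<sigma> (g \<otimes>\<^bsub>G\<^esub> s) t}"

definition prohibitions ::
    "('k, 'm) ring_scheme \<Rightarrow> ('g, 'n) monoid_scheme \<Rightarrow> ('g \<Rightarrow> 'g \<Rightarrow> 'k) \<Rightarrow> 'g set set"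
  where "prohibitions K G \<sigma> = prohibitions_I K G \<sigma> \<union> prohibitions_II K G \<sigma>"

definition Omega_sigma ::
    "('k, 'm) ring_scheme \<Rightarrow> ('g, 'n) monoid_scheme \<Rightarrow> ('g \<Rightarrow> 'g \<Rightarrow> 'k) \<Rightarrow> 'g set set"
  where "Omega_sigma K G \<sigma> = {\<xi> \<in> Omega G. \<forall>V\<in>prohibitions K G \<sigma>. \<not> V \<subseteq> \<xi>}"

definition Omega_sigma_topology ::
    "('k, 'm) ring_scheme \<Rightarrow> ('g, 'n) monoid_scheme \<Rightarrow> ('g \<Rightarrow> 'g \<Rightarrow> 'k) \<Rightarrow> 'g set topology"
  where "Omega_sigma_topology K G \<sigma> = subtopology (Omega_topology G) (Omega_sigma K G \<sigma>)"

section \<open>The groupoid\<close>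

text \<open>\<open>gpd_comp \<C> u v\<close> is the product \<open>u v\<close>, meant for \<open>gpd_dom \<C> u = gpd_cod \<C> v\<close>.\<close>

record ('o, 'a) groupoid_data =
  gpd_objs :: "'o set"
  gpd_arrs :: "'a set"
  gpd_dom :: "'a \<Rightarrow> 'o"
  gpd_cod :: "'a \<Rightarrow> 'o"
  gpd_comp :: "'a \<Rightarrow> 'a \<Rightarrow> 'a"

text \<open>A connected component is represented by its set of objects. In a groupoid, two objects lie
  in the same component iff there is a morphism between them.\<close>

definition gpd_connected :: "('o, 'a, 'z) groupoid_data_scheme \<Rightarrow> ('o \<times> 'o) set"
  where "gpd_connected \<C> =
    {(A, B). A \<in> gpd_objs \<C> \<and> B \<in> gpd_objs \<C> \<and>
       (\<exists>m\<in>gpd_arrs \<C>. gpd_dom \<C> m = A \<and> gpd_cod \<C> m = B)}"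

definition gpd_components :: "('o, 'a, 'z) groupoid_data_scheme \<Rightarrow> 'o set set"
  where "gpd_components \<C> = gpd_objs \<C> // gpd_connected \<C>"

text \<open>The triple \<open>(r, g, A)\<close> is the morphism \<open>r(g, A)\<close>.\<close>

definition sigma_groupoid ::
    "('k, 'm) ring_scheme \<Rightarrow> ('g, 'n) monoid_scheme \<Rightarrow> ('g \<Rightarrow> 'g \<Rightarrow> 'k) \<Rightarrow>
      ('g set, 'k \<times> 'g \<times> 'g set) groupoid_data"
  where "sigma_groupoid K G \<sigma> =
    \<lparr>gpd_objs = Omega_sigma K G \<sigma>,
     gpd_arrs = {(r, g, A). r \<in> carrier K - {\<zero>\<^bsub>K\<^esub>} \<and> g \<in> carrier G \<and>
                            A \<in> Omega_sigma K G \<sigma> \<and> inv\<^bsub>G\<^esub> g \<in> A},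
     gpd_dom = (\<lambda>(r, g, A). A),
     gpd_cod = (\<lambda>(r, g, A). g <#\<^bsub>G\<^esub> A),
     gpd_comp = (\<lambda>(r, g, B) (l, h, A). (r \<otimes>\<^bsub>K\<^esub> l \<otimes>\<^bsub>K\<^esub> \<sigma> g h, g \<otimes>\<^bsub>G\<^esub> h, A))\<rparr>"

definition stabilizer_group :: "('g, 'n) monoid_scheme \<Rightarrow> 'g set \<Rightarrow> ('g, 'n) monoid_scheme"
  where "stabilizer_group G A = G\<lparr>carrier := stabilizer G (l_coset G) A\<rparr>"

end

theory Submission
  imports Defs
begin

text \<open>An object \<open>\<zeta>\<close> and an element \<open>g \<in> \<zeta>\<close> determine an arrow of the groupoid with target \<open>\<zeta>\<close>,
  namely \<open>1 (g, inv g \<zeta>)\<close>. A word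
  \<open>w = g\<^sub>1 \<dots> g\<^sub>m\<close> with product \<open>p\<close> and set of prefix products \<open>P\<close> acts as a scalar \<open>c(w)\<close> times the sum
  of the arrows \<open>(\<zeta>, p)\<close> with \<open>P \<subseteq> \<zeta>\<close>. On the other side, the relations give \<open>w = c(w) e\<^sub>P [p]\<close>
  in the partial group algebra, where \<open>e\<^sub>P\<close> is the product of the commuting idempotents
  \<open>e\<^sub>g = \<sigma>(g, inv g)\<inverse> [g] [inv g]\<close> over \<open>g \<in> P\<close>, and \<open>e\<^sub>P = 0\<close> if \<open>P\<close> contains a prohibition. Since
  \<open>\<Omega>\<^sub>\<sigma>\<close> is closed under subsets that contain \<open>1\<close>, the elements \<open>e\<^sub>P [p]\<close> with \<open>P \<in> \<Omega>\<^sub>\<sigma>\<close> are unitriangular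
  with respect to the arrows, so the partial group algebra is the twisted algebra of the groupoid. A twisted
  groupoid algebra is the direct sum of the matrix algebras over the isotropy groups of its
  components. Discreteness makes everything finite: \<open>{1}\<close> is an isolated point of \<open>\<Omega>\<^sub>\<sigma>\<close>, and
  \<open>{1, x}\<close> belongs to \<open>\<Omega>\<^sub>\<sigma>\<close> for all \<open>x\<close> in an element of \<open>\<Omega>\<^sub>\<sigma>\<close>, so only finitely many \<open>x\<close> occur.\<close>

section \<open>Finitely supported functions and twisted monoid algebras\<close>

text \<open>The obstacle is that \<open>\<sigma>\<close> need not be a cocycle: it may vanish, and
  it may violate the cocycle identity. Inside one member \<open>\<zeta>\<close> of
  \<open>\<Omega>\<^sub>\<sigma>\<close> neither defect occurs, because the two types of prohibition
  encode precisely these defects. Computations that need nonzero values or the cocycle identity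
  therefore follow chains of elements of a single \<open>\<zeta>\<close>. The groupoid algebra is
  not constructed. It is replaced by functionals on the free algebra, each reading off the
  coefficient of one arrow. They obey the convolution formula of a twisted groupoid algebra, so
  their common kernel is an ideal. The crux is that this kernel is no larger than the ideal of
  relations: a minimal word in the support of a kernel element either lies in that ideal or is
  proportional, modulo it, to another word of the support. Matrix entries need a correcting scalar
  for every arrow, since composing with the chosen arrows from \<open>A\<close> to the other objects
  of its component produces further values of \<open>\<sigma>\<close>.\<close>

lemma (in abelian_monoid) finsum_swap:
  assumes "finite A" "finite B" "\<And>a b. a \<in> A \<Longrightarrow> b \<in> B \<Longrightarrow> f a b \<in> carrier G"
  shows "(\<Oplus>a\<in>A. \<Oplus>b\<in>B. f a b) = (\<Oplus>b\<in>B. \<Oplus>a\<in>A. f a b)"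
  using assms(1,3)
proof (induction A rule: finite_induct)
  case empty
  then show ?case by (simp add: finsum_zero)
next
  case (insert x F)
  have "(\<Oplus>a\<in>insert x F. \<Oplus>b\<in>B. f a b) = (\<Oplus>b\<in>B. f x b) \<oplus> (\<Oplus>a\<in>F. \<Oplus>b\<in>B. f a b)"
    using insert by (intro finsum_insert) (auto intro!: finsum_closed)
  also have "\<dots> = (\<Oplus>b\<in>B. f x b) \<oplus> (\<Oplus>b\<in>B. \<Oplus>a\<in>F. f a b)"
    using insert by simp
  also have "\<dots> = (\<Oplus>b\<in>B. f x b \<oplus> (\<Oplus>a\<in>F. f a b))"
    using insert by (intro finsum_addf[symmetric]) (auto intro!: finsum_closed)
  also have "\<dots> = (\<Oplus>b\<in>B. \<Oplus>a\<in>insert x F. f a b)"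
    using insert by (intro finsum_cong' finsum_insert[symmetric]) (auto intro!: finsum_closed)
  finally show ?case .
qed

lemma (in abelian_monoid) finsum_Times:
  assumes "finite A" "finite B" "\<And>a b. a \<in> A \<Longrightarrow> b \<in> B \<Longrightarrow> f a b \<in> carrier G"
  shows "(\<Oplus>p\<in>A \<times> B. f (fst p) (snd p)) = (\<Oplus>a\<in>A. \<Oplus>b\<in>B. f a b)"
  using assms(1,3)
proof (induction A rule: finite_induct)
  case empty
  then show ?case by simp
next
  case (insert x F)
  have "(\<Oplus>p\<in>insert x F \<times> B. f (fst p) (snd p)) = (\<Oplus>p\<in>(Pair x ` B) \<union> F \<times> B. f (fst p) (snd p))"
    by (rule arg_cong[where f = "finsum G _"]) auto
  also have "\<dots> = (\<Oplus>p\<in>Pair x ` B. f (fst p) (snd p)) \<oplus> (\<Oplus>p\<in>F \<times> B. f (fst p) (snd p))"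
    using insert assms(2) by (intro finsum_Un_disjoint) auto
  also have "(\<Oplus>p\<in>Pair x ` B. f (fst p) (snd p)) = (\<Oplus>b\<in>B. f x b)"
    using insert assms(2) by (subst finsum_reindex) (auto simp: inj_on_def)
  also have "(\<Oplus>p\<in>F \<times> B. f (fst p) (snd p)) = (\<Oplus>a\<in>F. \<Oplus>b\<in>B. f a b)"
    using insert by simp
  also have "(\<Oplus>b\<in>B. f x b) \<oplus> (\<Oplus>a\<in>F. \<Oplus>b\<in>B. f a b) = (\<Oplus>a\<in>insert x F. \<Oplus>b\<in>B. f a b)"
    using insert by (intro finsum_insert[symmetric]) (auto intro!: finsum_closed)
  finally show ?case .
qed

lemma (in abelian_monoid) finsum_mono_neutral:
  assumes "finite B" "A \<subseteq> B" "\<And>x. x \<in> B - A \<Longrightarrow> f x = \<zero>" "f \<in> A \<rightarrow> carrier G"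
  shows "finsum G f A = finsum G f B"
  using assms by (intro add.finprod_mono_neutral_cong_left) auto

lemma (in abelian_monoid) finsum_single:
  assumes "finite A" "a \<in> A" "f a \<in> carrier G" "\<And>x. x \<in> A \<Longrightarrow> x \<noteq> a \<Longrightarrow> f x = \<zero>"
  shows "finsum G f A = f a"
proof -
  have "finsum G f {a} = finsum G f A"
    using assms by (intro finsum_mono_neutral) auto
  then show ?thesis using assms by simp
qed

section \<open>Finitely supported functions and linear functionals on them\<close>

definition finsupp :: "('k, 'm) ring_scheme \<Rightarrow> 'x set \<Rightarrow> ('x \<Rightarrow> 'k) set" where
  "finsupp K X = {f. (\<forall>x\<in>X. f x \<in> carrier K) \<and> (\<forall>x. x \<notin> X \<longrightarrow> f x = \<zero>\<^bsub>K\<^esub>) \<and>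
                   finite {x. f x \<noteq> \<zero>\<^bsub>K\<^esub>}}"

text \<open>The value at \<open>f\<close> of the linear functional that sends the basis vector
  \<open>x\<close> to \<open>\<phi> x\<close>. Products in a twisted monoid algebra and arrow
  coefficients both have this form.\<close>

definition pairing :: "('k, 'm) ring_scheme \<Rightarrow> ('x \<Rightarrow> 'k) \<Rightarrow> ('x \<Rightarrow> 'k) \<Rightarrow> 'k" where
  "pairing K f \<phi> = (\<Oplus>\<^bsub>K\<^esub>x\<in>{x. f x \<noteq> \<zero>\<^bsub>K\<^esub>}. f x \<otimes>\<^bsub>K\<^esub> \<phi> x)"

definition single :: "('k, 'm) ring_scheme \<Rightarrow> 'x \<Rightarrow> 'x \<Rightarrow> 'k" where
  "single K w = (\<lambda>x. if x = w then \<one>\<^bsub>K\<^esub> else \<zero>\<^bsub>K\<^esub>)"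

context cring
begin

lemma finsupp_closed: "f \<in> finsupp R X \<Longrightarrow> f x \<in> carrier R"
  by (cases "x \<in> X") (auto simp: finsupp_def)

lemma finsupp_supp: "f \<in> finsupp R X \<Longrightarrow> {x. f x \<noteq> \<zero>} \<subseteq> X"
  by (auto simp: finsupp_def)

lemma finsupp_finite: "f \<in> finsupp R X \<Longrightarrow> finite {x. f x \<noteq> \<zero>}"
  by (auto simp: finsupp_def)

lemma finsupp_add: "f \<in> finsupp R X \<Longrightarrow> g \<in> finsupp R X \<Longrightarrow> (\<lambda>x. f x \<oplus> g x) \<in> finsupp R X"
  by (auto simp: finsupp_def intro: finite_subset[of _ "{x. f x \<noteq> \<zero>} \<union> {x. g x \<noteq> \<zero>}"])

lemma finsupp_smult: "r \<in> carrier R \<Longrightarrow> f \<in> finsupp R X \<Longrightarrow> (\<lambda>x. r \<otimes> f x) \<in> finsupp R X"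
  by (auto simp: finsupp_def intro: finite_subset[of _ "{x. f x \<noteq> \<zero>}"])

lemma finsupp_zero: "(\<lambda>x. \<zero>) \<in> finsupp R X"
  by (auto simp: finsupp_def)

lemma finsupp_single: "w \<in> X \<Longrightarrow> single R w \<in> finsupp R X"
  by (auto simp: finsupp_def single_def intro: finite_subset[of _ "{w}"])

lemma pairing_superset:
  assumes "f \<in> finsupp R X" "finite Y" "{x. f x \<noteq> \<zero>} \<subseteq> Y" "\<And>x. x \<in> Y \<Longrightarrow> \<phi> x \<in> carrier R"
  shows "pairing R f \<phi> = (\<Oplus>x\<in>Y. f x \<otimes> \<phi> x)"
  unfolding pairing_def using assms finsupp_closed[OF assms(1)]
  by (intro finsum_mono_neutral) auto

lemma pairing_closed:
  assumes "f \<in> finsupp R X" "\<And>x. x \<in> X \<Longrightarrow> \<phi> x \<in> carrier R"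
  shows "pairing R f \<phi> \<in> carrier R"
  unfolding pairing_def using assms finsupp_closed[OF assms(1)] finsupp_supp[OF assms(1)]
  by (intro finsum_closed) auto

lemma pairing_cong:
  assumes "f \<in> finsupp R X" "\<And>x. x \<in> X \<Longrightarrow> \<psi> x \<in> carrier R" "\<And>x. x \<in> X \<Longrightarrow> \<phi> x = \<psi> x"
  shows "pairing R f \<phi> = pairing R f \<psi>"
  unfolding pairing_def using assms finsupp_closed[OF assms(1)] finsupp_supp[OF assms(1)]
  by (intro finsum_cong') auto

lemma pairing_zero_right:
  assumes "f \<in> finsupp R X"
  shows "pairing R f (\<lambda>x. \<zero>) = \<zero>"
  unfolding pairing_def using finsupp_closed[OF assms(1)] by (simp add: finsum_zero)

lemma pairing_add_left:
  assumes "f \<in> finsupp R X" "g \<in> finsupp R X" "\<And>x. x \<in> X \<Longrightarrow> \<phi> x \<in> carrier R"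
  shows "pairing R (\<lambda>x. f x \<oplus> g x) \<phi> = pairing R f \<phi> \<oplus> pairing R g \<phi>"
proof -
  let ?Y = "{x. f x \<noteq> \<zero>} \<union> {x. g x \<noteq> \<zero>}"
  note c = finsupp_closed[OF assms(1)] finsupp_closed[OF assms(2)]
  have Y: "finite ?Y" "?Y \<subseteq> X"
    using assms by (auto simp: finsupp_def)
  then have p: "\<And>x. x \<in> ?Y \<Longrightarrow> \<phi> x \<in> carrier R" using assms(3) by auto
  have "pairing R (\<lambda>x. f x \<oplus> g x) \<phi> = (\<Oplus>x\<in>?Y. (f x \<oplus> g x) \<otimes> \<phi> x)"
    using Y p by (intro pairing_superset[OF finsupp_add[OF assms(1,2)]]) auto
  also have "\<dots> = (\<Oplus>x\<in>?Y. f x \<otimes> \<phi> x \<oplus> g x \<otimes> \<phi> x)"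
    using c p by (intro finsum_cong') (auto simp: l_distr)
  also have "\<dots> = (\<Oplus>x\<in>?Y. f x \<otimes> \<phi> x) \<oplus> (\<Oplus>x\<in>?Y. g x \<otimes> \<phi> x)"
    using c p by (intro finsum_addf) auto
  also have "\<dots> = pairing R f \<phi> \<oplus> pairing R g \<phi>"
    using Y(1) p pairing_superset[OF assms(1) Y(1)] pairing_superset[OF assms(2) Y(1)] by simp
  finally show ?thesis .
qed

lemma pairing_smult_left:
  assumes "r \<in> carrier R" "f \<in> finsupp R X" "\<And>x. x \<in> X \<Longrightarrow> \<phi> x \<in> carrier R"
  shows "pairing R (\<lambda>x. r \<otimes> f x) \<phi> = r \<otimes> pairing R f \<phi>"
proof -
  let ?Y = "{x. f x \<noteq> \<zero>}"
  note c = finsupp_closed[OF assms(2)]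
  have Y: "finite ?Y" "?Y \<subseteq> X" and p: "\<And>x. x \<in> ?Y \<Longrightarrow> \<phi> x \<in> carrier R"
    using assms by (auto simp: finsupp_def)
  have "pairing R (\<lambda>x. r \<otimes> f x) \<phi> = (\<Oplus>x\<in>?Y. (r \<otimes> f x) \<otimes> \<phi> x)"
    using Y p assms(1) by (intro pairing_superset[OF finsupp_smult[OF assms(1,2)]]) auto
  also have "\<dots> = (\<Oplus>x\<in>?Y. r \<otimes> (f x \<otimes> \<phi> x))"
    using c p assms(1) by (intro finsum_cong') (auto simp: m_assoc)
  also have "\<dots> = r \<otimes> pairing R f \<phi>"
    unfolding pairing_def using c p Y assms(1) by (intro finsum_rdistr[symmetric]) auto
  finally show ?thesis .
qed

lemma pairing_add_right:
  assumes "f \<in> finsupp R X" "\<And>x. x \<in> X \<Longrightarrow> \<phi> x \<in> carrier R" "\<And>x. x \<in> X \<Longrightarrow> \<psi> x \<in> carrier R"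
  shows "pairing R f (\<lambda>x. \<phi> x \<oplus> \<psi> x) = pairing R f \<phi> \<oplus> pairing R f \<psi>"
proof -
  let ?Y = "{x. f x \<noteq> \<zero>}"
  note c = finsupp_closed[OF assms(1)]
  have p: "\<And>x. x \<in> ?Y \<Longrightarrow> \<phi> x \<in> carrier R" "\<And>x. x \<in> ?Y \<Longrightarrow> \<psi> x \<in> carrier R"
    using assms by (auto simp: finsupp_def)
  have "pairing R f (\<lambda>x. \<phi> x \<oplus> \<psi> x) = (\<Oplus>x\<in>?Y. f x \<otimes> \<phi> x \<oplus> f x \<otimes> \<psi> x)"
    unfolding pairing_def using c p by (intro finsum_cong') (auto simp: r_distr)
  also have "\<dots> = pairing R f \<phi> \<oplus> pairing R f \<psi>"
    unfolding pairing_def using c p by (intro finsum_addf) auto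
  finally show ?thesis .
qed

lemma pairing_smult_right:
  assumes "f \<in> finsupp R X" "r \<in> carrier R" "\<And>x. x \<in> X \<Longrightarrow> \<phi> x \<in> carrier R"
  shows "pairing R f (\<lambda>x. r \<otimes> \<phi> x) = r \<otimes> pairing R f \<phi>"
proof -
  let ?Y = "{x. f x \<noteq> \<zero>}"
  note c = finsupp_closed[OF assms(1)]
  have Y: "finite ?Y" and p: "\<And>x. x \<in> ?Y \<Longrightarrow> \<phi> x \<in> carrier R"
    using assms by (auto simp: finsupp_def)
  have "pairing R f (\<lambda>x. r \<otimes> \<phi> x) = (\<Oplus>x\<in>?Y. r \<otimes> (f x \<otimes> \<phi> x))"
    unfolding pairing_def using c p assms(2) by (intro finsum_cong') (auto simp: m_lcomm)
  also have "\<dots> = r \<otimes> pairing R f \<phi>"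
    unfolding pairing_def using c p Y assms(2) by (intro finsum_rdistr[symmetric]) auto
  finally show ?thesis .
qed

lemma pairing_single:
  assumes "\<phi> w \<in> carrier R" 
  shows "pairing R (single R w) \<phi> = \<phi> w"
\<comment> \<open>In the trivial ring the support of \<open>single R w\<close> is empty instead of
  \<open>{w}\<close>.\<close>
proof (cases "\<one> = \<zero>")
  case True
  then show ?thesis 
    using assms one_zeroD[OF True] by (auto simp: pairing_def single_def)
next
  case False
  then have "{x. single R w x \<noteq> \<zero>} = {w}" by (auto simp: single_def)
  then show ?thesis using assms by (simp add: pairing_def single_def)
qed

lemma pairing_cong_supp:
  assumes "f \<in> finsupp R X" "\<And>x. x \<in> X \<Longrightarrow> f x \<noteq> \<zero> \<Longrightarrow> \<psi> x \<in> carrier R"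
    "\<And>x. x \<in> X \<Longrightarrow> f x \<noteq> \<zero> \<Longrightarrow> \<phi> x = \<psi> x"
  shows "pairing R f \<phi> = pairing R f \<psi>"
  unfolding pairing_def using assms finsupp_closed[OF assms(1)] finsupp_supp[OF assms(1)]
  by (intro finsum_cong') auto

lemma pairing_indicator:
  assumes "f \<in> finsupp R X" "\<And>z. z \<in> X \<Longrightarrow> c z \<in> carrier R" "x \<in> X"
  shows "pairing R f (\<lambda>z. if z = x then c z else \<zero>) = f x \<otimes> c x"
proof -
  \<comment> \<open>Since \<open>f x\<close> may be zero, \<open>x\<close> is added to the support
    before the sum is reduced to one term.\<close>
  have "pairing R f (\<lambda>z. if z = x then c z else \<zero>)
      = (\<Oplus>z\<in>insert x {z. f z \<noteq> \<zero>}. f z \<otimes> (if z = x then c z else \<zero>))"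
    using assms finsupp_finite[OF assms(1)] finsupp_supp[OF assms(1)]
    by (intro pairing_superset[OF assms(1)]) auto
  also have "\<dots> = f x \<otimes> (if x = x then c x else \<zero>)"
    using assms finsupp_finite[OF assms(1)] finsupp_closed[OF assms(1)]
    by (intro finsum_single) auto
  finally show ?thesis by simp
qed

lemma pairing_finsum_right:
  assumes "f \<in> finsupp R X" "finite I" "\<And>i x. i \<in> I \<Longrightarrow> x \<in> X \<Longrightarrow> \<phi> i x \<in> carrier R"
  shows "pairing R f (\<lambda>x. \<Oplus>i\<in>I. \<phi> i x) = (\<Oplus>i\<in>I. pairing R f (\<phi> i))"
  using assms(2,3)
proof (induction I rule: finite_induct)
  case empty
  then show ?case by (simp add: pairing_zero_right[OF assms(1)])
next
  case (insert i I)
  have "pairing R f (\<lambda>x. \<Oplus>i\<in>insert i I. \<phi> i x) = pairing R f (\<lambda>x. \<phi> i x \<oplus> (\<Oplus>i\<in>I. \<phi> i x))"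
    using insert by (intro pairing_cong[OF assms(1)]) (auto intro!: finsum_closed)
  also have "\<dots> = pairing R f (\<phi> i) \<oplus> pairing R f (\<lambda>x. \<Oplus>i\<in>I. \<phi> i x)"
    using insert by (intro pairing_add_right[OF assms(1)]) (auto intro!: finsum_closed)
  also have "\<dots> = (\<Oplus>i\<in>insert i I. pairing R f (\<phi> i))"
    using insert by (subst finsum_insert) (auto intro!: pairing_closed[OF assms(1)])
  finally show ?case .
qed

end

section \<open>Twisted monoid algebras, serving both the free algebra and the stabilizers\<close>

locale twisted_monoid = K?: field K + M?: monoid M
  for K :: "('k, 'm) ring_scheme" (structure) and M :: "('x, 'n) monoid_scheme" +
  fixes \<tau> :: "'x \<Rightarrow> 'x \<Rightarrow> 'k"
  assumes cocycle: "global_cocycle K M \<tau>"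
begin

abbreviation "A \<equiv> twisted_monoid_algebra K M \<tau>"
abbreviation "X \<equiv> carrier M"

lemma tau_closed: "x \<in> X \<Longrightarrow> y \<in> X \<Longrightarrow> \<tau> x y \<in> carrier K"
  and tau_nonzero: "x \<in> X \<Longrightarrow> y \<in> X \<Longrightarrow> \<tau> x y \<noteq> \<zero>"
  and tau_cocycle: "x \<in> X \<Longrightarrow> y \<in> X \<Longrightarrow> z \<in> X \<Longrightarrow>
     \<tau> x y \<otimes> \<tau> (x \<otimes>\<^bsub>M\<^esub> y) z = \<tau> x (y \<otimes>\<^bsub>M\<^esub> z) \<otimes> \<tau> y z"
  using cocycle by (auto simp: global_cocycle_def)

lemma carrier_A: "carrier A = finsupp K X"
  by (simp add: twisted_monoid_algebra_def finsupp_def)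

lemma A_simps [simp]: 
  "zero A = (\<lambda>_. \<zero>)" "add A f g = (\<lambda>x. f x \<oplus> g x)" "r \<odot>\<^bsub>A\<^esub> f = (\<lambda>x. r \<otimes> f x)"
  by (simp_all add: twisted_monoid_algebra_def)

lemma one_A: "\<one>\<^bsub>A\<^esub> = inv (\<tau> \<one>\<^bsub>M\<^esub> \<one>\<^bsub>M\<^esub>) \<odot>\<^bsub>A\<^esub> single K \<one>\<^bsub>M\<^esub>"
  using tau_closed[of "\<one>\<^bsub>M\<^esub>" "\<one>\<^bsub>M\<^esub>"] tau_nonzero[of "\<one>\<^bsub>M\<^esub>" "\<one>\<^bsub>M\<^esub>"]
  by (auto simp: twisted_monoid_algebra_def single_def field_Units)

text \<open>The defining sum runs over a fibre of the multiplication, a set that varies with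
  \<open>x\<close>. Moving the condition \<open>y z = x\<close> into the coefficient makes the index
  set a product of two supports, so the sum becomes an iterated pairing.\<close>

lemma mult_A:
  assumes f: "f \<in> finsupp K X" and g: "g \<in> finsupp K X"
  shows "(f \<otimes>\<^bsub>A\<^esub> g) x =
    pairing K f (\<lambda>y. pairing K g (\<lambda>z. if y \<otimes>\<^bsub>M\<^esub> z = x then \<tau> y z else \<zero>))"
proof -
  let ?Y = "{y. f y \<noteq> \<zero>}" and ?Z = "{z. g z \<noteq> \<zero>}"
  let ?P = "{(y, z). y \<in> X \<and> z \<in> X \<and> f y \<noteq> \<zero> \<and> g z \<noteq> \<zero> \<and> y \<otimes>\<^bsub>M\<^esub> z = x}"
  let ?t = "\<lambda>y z. if y \<otimes>\<^bsub>M\<^esub> z = x then \<tau> y z else \<zero>"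
  note fin = finsupp_finite[OF f] finsupp_finite[OF g]
  note sub = subsetD[OF finsupp_supp[OF f]] subsetD[OF finsupp_supp[OF g]]
  note c = finsupp_closed[OF f] finsupp_closed[OF g]
  have t: "?t y z \<in> carrier K" if "y \<in> X" "z \<in> X" for y z using that by (auto intro: tau_closed)
  have "(f \<otimes>\<^bsub>A\<^esub> g) x = (\<Oplus>p\<in>?P. f (fst p) \<otimes> g (snd p) \<otimes> \<tau> (fst p) (snd p))"
    by (simp add: twisted_monoid_algebra_def)
  also have "\<dots> = (\<Oplus>p\<in>?P. f (fst p) \<otimes> g (snd p) \<otimes> ?t (fst p) (snd p))"
    using c by (intro finsum_cong') (auto intro!: K.m_closed tau_closed)
  also have "\<dots> = (\<Oplus>p\<in>?Y \<times> ?Z. f (fst p) \<otimes> g (snd p) \<otimes> ?t (fst p) (snd p))"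
    using c fin sub by (intro finsum_mono_neutral) (auto intro!: K.m_closed tau_closed)
  also have "\<dots> = (\<Oplus>y\<in>?Y. \<Oplus>z\<in>?Z. f y \<otimes> g z \<otimes> ?t y z)"
    using c fin sub t by (intro finsum_Times) auto
  also have "\<dots> = (\<Oplus>y\<in>?Y. f y \<otimes> (\<Oplus>z\<in>?Z. g z \<otimes> ?t y z))"
  proof (rule finsum_cong', simp)
    show "(\<lambda>y. f y \<otimes> (\<Oplus>z\<in>?Z. g z \<otimes> ?t y z)) \<in> ?Y \<rightarrow> carrier K"
      using c sub t by (auto intro!: K.m_closed finsum_closed)
    fix y assume "y \<in> ?Y"
    with c fin sub t show "(\<Oplus>z\<in>?Z. f y \<otimes> g z \<otimes> ?t y z) = f y \<otimes> (\<Oplus>z\<in>?Z. g z \<otimes> ?t y z)"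
      by (subst finsum_rdistr) (auto intro!: finsum_cong' simp: K.m_assoc)
  qed
  also have "\<dots> = pairing K f (\<lambda>y. pairing K g (?t y))"
    by (simp add: pairing_def)
  finally show ?thesis .
qed

lemma mult_A_closed:
  assumes f: "f \<in> finsupp K X" and g: "g \<in> finsupp K X"
  shows "f \<otimes>\<^bsub>A\<^esub> g \<in> finsupp K X"
    and "{x. (f \<otimes>\<^bsub>A\<^esub> g) x \<noteq> \<zero>} \<subseteq> (\<lambda>(y, z). y \<otimes>\<^bsub>M\<^esub> z) ` ({y. f y \<noteq> \<zero>} \<times> {z. g z \<noteq> \<zero>})"
proof -
  let ?V = "(\<lambda>(y, z). y \<otimes>\<^bsub>M\<^esub> z) ` ({y. f y \<noteq> \<zero>} \<times> {z. g z \<noteq> \<zero>})"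
  have z: "(f \<otimes>\<^bsub>A\<^esub> g) x = \<zero>" if "x \<notin> ?V" for x
  proof -
    have "{(y, z). y \<in> X \<and> z \<in> X \<and> f y \<noteq> \<zero> \<and> g z \<noteq> \<zero> \<and> y \<otimes>\<^bsub>M\<^esub> z = x} = {}"
      using that by auto
    then show ?thesis by (simp add: twisted_monoid_algebra_def del: Collect_empty_eq)
  qed
  then show sub: "{x. (f \<otimes>\<^bsub>A\<^esub> g) x \<noteq> \<zero>} \<subseteq> ?V" by auto
  have "finite ?V" using f g by (auto simp: finsupp_finite)
  moreover have "?V \<subseteq> X" using finsupp_supp[OF f] finsupp_supp[OF g] by auto
  moreover have "(f \<otimes>\<^bsub>A\<^esub> g) x \<in> carrier K" for x
    unfolding mult_A[OF f g] using f g by (auto intro!: pairing_closed tau_closed)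
  ultimately show "f \<otimes>\<^bsub>A\<^esub> g \<in> finsupp K X"
    using sub z unfolding finsupp_def by (blast intro: finite_subset)
qed

text \<open>An interchange of finite sums: over a fixed finite set \<open>?V\<close> that contains
  the support of the product, the sum over \<open>x\<close> can be moved innermost, where only
  \<open>x = y z\<close> survives. Associativity and the convolution formula for arrows both rest on
  this.\<close>

lemma pairing_mult:
  assumes f: "f \<in> finsupp K X" and g: "g \<in> finsupp K X" and p: "\<And>x. x \<in> X \<Longrightarrow> \<phi> x \<in> carrier K"
  shows "pairing K (f \<otimes>\<^bsub>A\<^esub> g) \<phi> =
    pairing K f (\<lambda>y. pairing K g (\<lambda>z. \<phi> (y \<otimes>\<^bsub>M\<^esub> z) \<otimes> \<tau> y z))"
proof -
  let ?Y = "{y. f y \<noteq> \<zero>}" and ?Z = "{z. g z \<noteq> \<zero>}"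
  let ?V = "(\<lambda>(y, z). y \<otimes>\<^bsub>M\<^esub> z) ` (?Y \<times> ?Z)"
  let ?t = "\<lambda>y z x. if y \<otimes>\<^bsub>M\<^esub> z = x then \<tau> y z else \<zero>"
  note fin = finsupp_finite[OF f] finsupp_finite[OF g]
  note sub = subsetD[OF finsupp_supp[OF f]] subsetD[OF finsupp_supp[OF g]]
  note c = finsupp_closed[OF f] finsupp_closed[OF g]
  have V: "finite ?V" "?V \<subseteq> X" using fin sub by auto
  have pV: "\<phi> x \<in> carrier K" if "x \<in> ?V" for x using p V that by blast
  have t: "?t y z x \<in> carrier K" if "y \<in> X" "z \<in> X" for y z x using that by (auto intro: tau_closed)
  have "pairing K (f \<otimes>\<^bsub>A\<^esub> g) \<phi> = (\<Oplus>x\<in>?V. (f \<otimes>\<^bsub>A\<^esub> g) x \<otimes> \<phi> x)"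
    using V p by (intro pairing_superset[OF mult_A_closed(1)[OF f g]] mult_A_closed(2)[OF f g]) auto
  also have "\<dots> = (\<Oplus>x\<in>?V. pairing K f (\<lambda>y. pairing K g (\<lambda>z. \<phi> x \<otimes> ?t y z x)))"
  proof (rule finsum_cong', simp)
    show "(\<lambda>x. pairing K f (\<lambda>y. pairing K g (\<lambda>z. \<phi> x \<otimes> ?t y z x))) \<in> ?V \<rightarrow> carrier K"
      using pV t by (intro Pi_I pairing_closed[OF f] pairing_closed[OF g] K.m_closed) auto
    fix x assume x: "x \<in> ?V"
    have "pairing K f (\<lambda>y. pairing K g (\<lambda>z. \<phi> x \<otimes> ?t y z x))
        = pairing K f (\<lambda>y. \<phi> x \<otimes> pairing K g (\<lambda>z. ?t y z x))"
      using pV[OF x] t by (intro pairing_cong[OF f] pairing_smult_right[OF g] K.m_closed pairing_closed[OF g]) auto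
    also have "\<dots> = \<phi> x \<otimes> pairing K f (\<lambda>y. pairing K g (\<lambda>z. ?t y z x))"
      using pV[OF x] t by (intro pairing_smult_right[OF f] Pi_I pairing_closed[OF g]) auto
    also have "\<dots> = (f \<otimes>\<^bsub>A\<^esub> g) x \<otimes> \<phi> x"
      unfolding mult_A[OF f g] using pV[OF x] t
      by (intro K.m_comm pairing_closed[OF f] Pi_I pairing_closed[OF g]) auto
    finally show "(f \<otimes>\<^bsub>A\<^esub> g) x \<otimes> \<phi> x = pairing K f (\<lambda>y. pairing K g (\<lambda>z. \<phi> x \<otimes> ?t y z x))" ..
  qed
  also have "\<dots> = (\<Oplus>x\<in>?V. \<Oplus>y\<in>?Y. f y \<otimes> (\<Oplus>z\<in>?Z. g z \<otimes> (\<phi> x \<otimes> ?t y z x)))"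
    by (simp only: pairing_def)
  also have "\<dots> = (\<Oplus>y\<in>?Y. \<Oplus>x\<in>?V. f y \<otimes> (\<Oplus>z\<in>?Z. g z \<otimes> (\<phi> x \<otimes> ?t y z x)))"
    using V fin pV t sub c by (intro finsum_swap K.m_closed finsum_closed Pi_I) auto
  also have "\<dots> = (\<Oplus>y\<in>?Y. f y \<otimes> (\<Oplus>z\<in>?Z. g z \<otimes> (\<phi> (y \<otimes>\<^bsub>M\<^esub> z) \<otimes> \<tau> y z)))"
  proof (rule finsum_cong', simp)
    show "(\<lambda>y. f y \<otimes> (\<Oplus>z\<in>?Z. g z \<otimes> (\<phi> (y \<otimes>\<^bsub>M\<^esub> z) \<otimes> \<tau> y z))) \<in> ?Y \<rightarrow> carrier K"
      using c p sub by (intro Pi_I K.m_closed finsum_closed tau_closed) auto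
    fix y assume y: "y \<in> ?Y"
    have "(\<Oplus>x\<in>?V. f y \<otimes> (\<Oplus>z\<in>?Z. g z \<otimes> (\<phi> x \<otimes> ?t y z x)))
      = f y \<otimes> (\<Oplus>x\<in>?V. \<Oplus>z\<in>?Z. g z \<otimes> (\<phi> x \<otimes> ?t y z x))"
      using V fin pV t sub c y by (intro finsum_rdistr[symmetric] Pi_I finsum_closed K.m_closed) auto
    also have "(\<Oplus>x\<in>?V. \<Oplus>z\<in>?Z. g z \<otimes> (\<phi> x \<otimes> ?t y z x))
      = (\<Oplus>z\<in>?Z. \<Oplus>x\<in>?V. g z \<otimes> (\<phi> x \<otimes> ?t y z x))"
      using V fin pV t sub c y by (intro finsum_swap K.m_closed) auto
    also have "\<dots> = (\<Oplus>z\<in>?Z. g z \<otimes> (\<phi> (y \<otimes>\<^bsub>M\<^esub> z) \<otimes> \<tau> y z))"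
    proof (rule finsum_cong', simp)
      show "(\<lambda>z. g z \<otimes> (\<phi> (y \<otimes>\<^bsub>M\<^esub> z) \<otimes> \<tau> y z)) \<in> ?Z \<rightarrow> carrier K"
        using c p sub y by (intro Pi_I K.m_closed tau_closed) auto
      fix z assume z: "z \<in> ?Z"
      have yz: "y \<otimes>\<^bsub>M\<^esub> z \<in> ?V" using y z by auto
      have "(\<Oplus>x\<in>?V. g z \<otimes> (\<phi> x \<otimes> ?t y z x)) = g z \<otimes> (\<phi> (y \<otimes>\<^bsub>M\<^esub> z) \<otimes> ?t y z (y \<otimes>\<^bsub>M\<^esub> z))"
      proof (rule finsum_single[OF V(1) yz])
        show "g z \<otimes> (\<phi> (y \<otimes>\<^bsub>M\<^esub> z) \<otimes> ?t y z (y \<otimes>\<^bsub>M\<^esub> z)) \<in> carrier K"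
          using V c pV[OF yz] t sub y z by (intro K.m_closed) (auto simp: tau_closed)
      next
        fix x assume x: "x \<in> ?V" "x \<noteq> y \<otimes>\<^bsub>M\<^esub> z"
        then have "?t y z x = \<zero>" by auto
        then show "g z \<otimes> (\<phi> x \<otimes> ?t y z x) = \<zero>"
          using c pV[OF x(1)] by simp
      qed
      then show "(\<Oplus>x\<in>?V. g z \<otimes> (\<phi> x \<otimes> ?t y z x)) = g z \<otimes> (\<phi> (y \<otimes>\<^bsub>M\<^esub> z) \<otimes> \<tau> y z)"
        by simp
    qed
    finally show "(\<Oplus>x\<in>?V. f y \<otimes> (\<Oplus>z\<in>?Z. g z \<otimes> (\<phi> x \<otimes> ?t y z x)))
      = f y \<otimes> (\<Oplus>z\<in>?Z. g z \<otimes> (\<phi> (y \<otimes>\<^bsub>M\<^esub> z) \<otimes> \<tau> y z))" .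
  qed
  also have "\<dots> = pairing K f (\<lambda>y. pairing K g (\<lambda>z. \<phi> (y \<otimes>\<^bsub>M\<^esub> z) \<otimes> \<tau> y z))"
    by (simp only: pairing_def)
  finally show ?thesis .
qed


lemma mult_A_assoc:
  assumes f: "f \<in> finsupp K X" and g: "g \<in> finsupp K X" and h: "h \<in> finsupp K X"
  shows "(f \<otimes>\<^bsub>A\<^esub> g) \<otimes>\<^bsub>A\<^esub> h = f \<otimes>\<^bsub>A\<^esub> (g \<otimes>\<^bsub>A\<^esub> h)"
proof
  fix x
  let ?t = "\<lambda>y z. if y \<otimes>\<^bsub>M\<^esub> z = x then \<tau> y z else \<zero>"
  have t: "?t y z \<in> carrier K" if "y \<in> X" "z \<in> X" for y z using that by (auto intro: tau_closed)
  have "((f \<otimes>\<^bsub>A\<^esub> g) \<otimes>\<^bsub>A\<^esub> h) x = pairing K (f \<otimes>\<^bsub>A\<^esub> g) (\<lambda>v. pairing K h (?t v))"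
    using f g h by (intro mult_A mult_A_closed(1))
  also have "\<dots> = pairing K f (\<lambda>y. pairing K g (\<lambda>w. pairing K h (?t (y \<otimes>\<^bsub>M\<^esub> w)) \<otimes> \<tau> y w))"
    using t by (intro pairing_mult f g pairing_closed[OF h]) auto
  \<comment> \<open>Both bracketings become pairings over triples \<open>(y, w, z)\<close>; the
    cocycle identity equates their coefficients.\<close>
  also have "\<dots> = pairing K f (\<lambda>y. pairing K g (\<lambda>w. pairing K h
      (\<lambda>z. ?t y (w \<otimes>\<^bsub>M\<^esub> z) \<otimes> \<tau> w z)))"
  proof (intro pairing_cong[OF f] pairing_cong[OF g] pairing_closed[OF g] pairing_closed[OF h]
      K.m_closed t tau_closed M.m_closed)
    fix y w assume y: "y \<in> X" and w: "w \<in> X"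
    have "pairing K h (?t (y \<otimes>\<^bsub>M\<^esub> w)) \<otimes> \<tau> y w = \<tau> y w \<otimes> pairing K h (?t (y \<otimes>\<^bsub>M\<^esub> w))"
      using y w t by (intro K.m_comm tau_closed pairing_closed[OF h]) auto
    also have "\<dots> = pairing K h (\<lambda>z. \<tau> y w \<otimes> ?t (y \<otimes>\<^bsub>M\<^esub> w) z)"
      using y w t by (intro pairing_smult_right[OF h, symmetric] tau_closed) auto
    also have "\<dots> = pairing K h (\<lambda>z. ?t y (w \<otimes>\<^bsub>M\<^esub> z) \<otimes> \<tau> w z)"
    proof (rule pairing_cong[OF h])
      fix z assume z: "z \<in> X"
      show "?t y (w \<otimes>\<^bsub>M\<^esub> z) \<otimes> \<tau> w z \<in> carrier K"
        using y w z t by (intro K.m_closed tau_closed) auto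
      show "\<tau> y w \<otimes> ?t (y \<otimes>\<^bsub>M\<^esub> w) z = ?t y (w \<otimes>\<^bsub>M\<^esub> z) \<otimes> \<tau> w z"
        using y w z by (simp add: M.m_assoc tau_cocycle tau_closed)
    qed
    finally show "pairing K h (?t (y \<otimes>\<^bsub>M\<^esub> w)) \<otimes> \<tau> y w
      = pairing K h (\<lambda>z. ?t y (w \<otimes>\<^bsub>M\<^esub> z) \<otimes> \<tau> w z)" .
  qed auto
  also have "\<dots> = pairing K f (\<lambda>y. pairing K (g \<otimes>\<^bsub>A\<^esub> h) (?t y))"
    using t by (intro pairing_cong[OF f] pairing_mult[symmetric] g h mult_A_closed(1)
        pairing_closed[OF mult_A_closed(1)[OF g h]]) auto
  also have "\<dots> = (f \<otimes>\<^bsub>A\<^esub> (g \<otimes>\<^bsub>A\<^esub> h)) x"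
    using f g h by (intro mult_A[symmetric] mult_A_closed(1))
  finally show "((f \<otimes>\<^bsub>A\<^esub> g) \<otimes>\<^bsub>A\<^esub> h) x = (f \<otimes>\<^bsub>A\<^esub> (g \<otimes>\<^bsub>A\<^esub> h)) x" .
qed

text \<open>The cocycle identity at \<open>(1, 1, z)\<close>, with \<open>\<tau> 1 z\<close>
  cancelled. Together with the mirrored fact it makes the rescaled basis vector at 1 a two-sided
  unity although \<open>\<tau>\<close> is not normalised.\<close>

lemma tau_one_left: "z \<in> X \<Longrightarrow> \<tau> \<one>\<^bsub>M\<^esub> z = \<tau> \<one>\<^bsub>M\<^esub> \<one>\<^bsub>M\<^esub>"
  using tau_cocycle[of "\<one>\<^bsub>M\<^esub>" "\<one>\<^bsub>M\<^esub>" z] tau_nonzero[of "\<one>\<^bsub>M\<^esub>" z]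
  by (simp add: tau_closed K.m_rcancel)

lemma tau_one_right: "z \<in> X \<Longrightarrow> \<tau> z \<one>\<^bsub>M\<^esub> = \<tau> \<one>\<^bsub>M\<^esub> \<one>\<^bsub>M\<^esub>"
  using tau_cocycle[of z "\<one>\<^bsub>M\<^esub>" "\<one>\<^bsub>M\<^esub>"] tau_nonzero[of z "\<one>\<^bsub>M\<^esub>"]
  by (simp add: tau_closed K.m_lcancel)

lemma inv_tau_closed: "inv (\<tau> \<one>\<^bsub>M\<^esub> \<one>\<^bsub>M\<^esub>) \<in> carrier K"
  and inv_tau: "inv (\<tau> \<one>\<^bsub>M\<^esub> \<one>\<^bsub>M\<^esub>) \<otimes> \<tau> \<one>\<^bsub>M\<^esub> \<one>\<^bsub>M\<^esub> = \<one>"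
  using tau_closed[of "\<one>\<^bsub>M\<^esub>" "\<one>\<^bsub>M\<^esub>"] tau_nonzero[of "\<one>\<^bsub>M\<^esub>" "\<one>\<^bsub>M\<^esub>"]
  by (auto simp: K.field_Units intro: K.Units_l_inv)

lemma one_A_closed: "\<one>\<^bsub>A\<^esub> \<in> finsupp K X"
  unfolding one_A A_simps by (intro K.finsupp_smult K.finsupp_single inv_tau_closed) simp

lemma mult_single_left:
  assumes "f \<in> finsupp K X" "w \<in> X"
  shows "(single K w \<otimes>\<^bsub>A\<^esub> f) x = pairing K f (\<lambda>z. if w \<otimes>\<^bsub>M\<^esub> z = x then \<tau> w z else \<zero>)"
  using assms by (subst mult_A) (auto intro!: pairing_single finsupp_single pairing_closed tau_closed)

lemma mult_single_right:
  assumes "f \<in> finsupp K X" "w \<in> X"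
  shows "(f \<otimes>\<^bsub>A\<^esub> single K w) x = pairing K f (\<lambda>y. if y \<otimes>\<^bsub>M\<^esub> w = x then \<tau> y w else \<zero>)"
  using assms by (subst mult_A) (auto intro!: pairing_cong pairing_single finsupp_single pairing_closed tau_closed)

lemma mult_A_smult_left:
  assumes "f \<in> finsupp K X" "g \<in> finsupp K X" "r \<in> carrier K"
  shows "(r \<odot>\<^bsub>A\<^esub> f) \<otimes>\<^bsub>A\<^esub> g = r \<odot>\<^bsub>A\<^esub> (f \<otimes>\<^bsub>A\<^esub> g)"
proof
  fix x
  show "((r \<odot>\<^bsub>A\<^esub> f) \<otimes>\<^bsub>A\<^esub> g) x = (r \<odot>\<^bsub>A\<^esub> (f \<otimes>\<^bsub>A\<^esub> g)) x"
    unfolding A_simps mult_A[OF finsupp_smult[OF assms(3,1)] assms(2)] mult_A[OF assms(1,2)]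
    by (intro pairing_smult_left[OF assms(3,1)] pairing_closed[OF assms(2)]) (auto intro: tau_closed)
qed

lemma mult_A_smult_right:
  assumes "f \<in> finsupp K X" "g \<in> finsupp K X" "r \<in> carrier K"
  shows "f \<otimes>\<^bsub>A\<^esub> (r \<odot>\<^bsub>A\<^esub> g) = r \<odot>\<^bsub>A\<^esub> (f \<otimes>\<^bsub>A\<^esub> g)"
proof
  fix x
  let ?t = "\<lambda>y z. if y \<otimes>\<^bsub>M\<^esub> z = x then \<tau> y z else \<zero>"
  have t: "?t y z \<in> carrier K" if "y \<in> X" "z \<in> X" for y z using that by (auto intro: tau_closed)
  have "pairing K f (\<lambda>y. pairing K (\<lambda>x. r \<otimes> g x) (?t y)) = pairing K f (\<lambda>y. r \<otimes> pairing K g (?t y))"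
    by (intro pairing_cong[OF assms(1)] pairing_smult_left[OF assms(3,2)] K.m_closed
        pairing_closed[OF assms(2)] t assms(3))
  also have "\<dots> = r \<otimes> pairing K f (\<lambda>y. pairing K g (?t y))"
    by (intro pairing_smult_right[OF assms(1,3)] pairing_closed[OF assms(2)] t)
  finally show "(f \<otimes>\<^bsub>A\<^esub> (r \<odot>\<^bsub>A\<^esub> g)) x = (r \<odot>\<^bsub>A\<^esub> (f \<otimes>\<^bsub>A\<^esub> g)) x"
    unfolding A_simps mult_A[OF assms(1) finsupp_smult[OF assms(3,2)]] mult_A[OF assms(1,2)] .
qed

lemma mult_A_add_left:
  assumes "f \<in> finsupp K X" "g \<in> finsupp K X" "h \<in> finsupp K X"
  shows "(f \<oplus>\<^bsub>A\<^esub> g) \<otimes>\<^bsub>A\<^esub> h = f \<otimes>\<^bsub>A\<^esub> h \<oplus>\<^bsub>A\<^esub> g \<otimes>\<^bsub>A\<^esub> h"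
proof
  fix x
  show "((f \<oplus>\<^bsub>A\<^esub> g) \<otimes>\<^bsub>A\<^esub> h) x = (f \<otimes>\<^bsub>A\<^esub> h \<oplus>\<^bsub>A\<^esub> g \<otimes>\<^bsub>A\<^esub> h) x"
    unfolding A_simps mult_A[OF finsupp_add[OF assms(1,2)] assms(3)] mult_A[OF assms(1,3)] mult_A[OF assms(2,3)]
    by (intro pairing_add_left[OF assms(1,2)] pairing_closed[OF assms(3)]) (auto intro: tau_closed)
qed

lemma mult_A_add_right:
  assumes "f \<in> finsupp K X" "g \<in> finsupp K X" "h \<in> finsupp K X"
  shows "h \<otimes>\<^bsub>A\<^esub> (f \<oplus>\<^bsub>A\<^esub> g) = h \<otimes>\<^bsub>A\<^esub> f \<oplus>\<^bsub>A\<^esub> h \<otimes>\<^bsub>A\<^esub> g"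
proof
  fix x
  let ?t = "\<lambda>y z. if y \<otimes>\<^bsub>M\<^esub> z = x then \<tau> y z else \<zero>"
  have t: "?t y z \<in> carrier K" if "y \<in> X" "z \<in> X" for y z using that by (auto intro: tau_closed)
  have "pairing K h (\<lambda>y. pairing K (\<lambda>x. f x \<oplus> g x) (?t y))
      = pairing K h (\<lambda>y. pairing K f (?t y) \<oplus> pairing K g (?t y))"
    by (intro pairing_cong[OF assms(3)] pairing_add_left[OF assms(1,2)] K.a_closed
        pairing_closed[OF assms(1)] pairing_closed[OF assms(2)] t)
  also have "\<dots> = pairing K h (\<lambda>y. pairing K f (?t y)) \<oplus> pairing K h (\<lambda>y. pairing K g (?t y))"
    by (intro pairing_add_right[OF assms(3)] pairing_closed[OF assms(1)] pairing_closed[OF assms(2)] t)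
  finally show "(h \<otimes>\<^bsub>A\<^esub> (f \<oplus>\<^bsub>A\<^esub> g)) x = (h \<otimes>\<^bsub>A\<^esub> f \<oplus>\<^bsub>A\<^esub> h \<otimes>\<^bsub>A\<^esub> g) x"
    unfolding A_simps mult_A[OF assms(3) finsupp_add[OF assms(1,2)]] mult_A[OF assms(3,1)] mult_A[OF assms(3,2)] .
qed

lemma single_mult_single:
  assumes "v \<in> X" "w \<in> X"
  shows "single K v \<otimes>\<^bsub>A\<^esub> single K w = \<tau> v w \<odot>\<^bsub>A\<^esub> single K (v \<otimes>\<^bsub>M\<^esub> w)"
  using assms mult_single_left[OF finsupp_single[OF assms(2)] assms(1)]
  by (auto simp: fun_eq_iff pairing_single tau_closed) (auto simp: single_def tau_closed)

lemma one_A_mult: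
  assumes f: "f \<in> finsupp K X"
  shows "\<one>\<^bsub>A\<^esub> \<otimes>\<^bsub>A\<^esub> f = f" and "f \<otimes>\<^bsub>A\<^esub> \<one>\<^bsub>A\<^esub> = f"
proof -
  let ?c = "\<tau> \<one>\<^bsub>M\<^esub> \<one>\<^bsub>M\<^esub>"
  have s: "single K \<one>\<^bsub>M\<^esub> \<in> finsupp K X" by (simp add: finsupp_single)
  have *: "f x = \<zero>" "(f \<otimes>\<^bsub>A\<^esub> \<one>\<^bsub>A\<^esub>) x = \<zero>" "(\<one>\<^bsub>A\<^esub> \<otimes>\<^bsub>A\<^esub> f) x = \<zero>" if "x \<notin> X" for x
    using f mult_A_closed(1)[OF f one_A_closed] mult_A_closed(1)[OF one_A_closed f] that
    by (auto simp: finsupp_def)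
  have c: "?c \<in> carrier K" by (simp add: tau_closed)
  have fin: "inv ?c \<otimes> (f x \<otimes> ?c) = f x" for x
    using finsupp_closed[OF f, of x] c inv_tau_closed inv_tau
    by (simp add: K.m_lcomm)
  have "(single K \<one>\<^bsub>M\<^esub> \<otimes>\<^bsub>A\<^esub> f) x = f x \<otimes> ?c" if "x \<in> X" for x
  proof -
    have "(single K \<one>\<^bsub>M\<^esub> \<otimes>\<^bsub>A\<^esub> f) x = pairing K f (\<lambda>z. if z = x then ?c else \<zero>)"
      using c f by (subst mult_single_left) (auto intro!: pairing_cong[OF f] tau_one_left)
    then show ?thesis using pairing_indicator[OF f _ that, of "\<lambda>_. ?c"] c by simp
  qed
  then have "(\<one>\<^bsub>A\<^esub> \<otimes>\<^bsub>A\<^esub> f) x = f x" if "x \<in> X" for x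
    unfolding one_A mult_A_smult_left[OF s f inv_tau_closed] using fin that by simp
  with * show "\<one>\<^bsub>A\<^esub> \<otimes>\<^bsub>A\<^esub> f = f" by (metis ext)
  have "(f \<otimes>\<^bsub>A\<^esub> single K \<one>\<^bsub>M\<^esub>) x = f x \<otimes> ?c" if "x \<in> X" for x
  proof -
    have "(f \<otimes>\<^bsub>A\<^esub> single K \<one>\<^bsub>M\<^esub>) x = pairing K f (\<lambda>z. if z = x then ?c else \<zero>)"
      using c f by (subst mult_single_right) (auto intro!: pairing_cong[OF f] tau_one_right)
    then show ?thesis using pairing_indicator[OF f _ that, of "\<lambda>_. ?c"] c by simp
  qed
  then have "(f \<otimes>\<^bsub>A\<^esub> \<one>\<^bsub>A\<^esub>) x = f x" if "x \<in> X" for x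
    unfolding one_A mult_A_smult_right[OF f s inv_tau_closed] using fin that by simp
  with * show "f \<otimes>\<^bsub>A\<^esub> \<one>\<^bsub>A\<^esub> = f" by (metis ext)
qed

lemma abelian_group_A: "abelian_group A"
proof (rule abelian_groupI; unfold carrier_A)
  fix f assume f: "f \<in> finsupp K X"
  have "(\<lambda>x. \<ominus> \<one> \<otimes> f x) \<in> finsupp K X" by (intro finsupp_smult f) simp
  then show "\<exists>g\<in>finsupp K X. g \<oplus>\<^bsub>A\<^esub> f = \<zero>\<^bsub>A\<^esub>"
    using finsupp_closed[OF f] by (intro bexI) (auto simp: K.l_minus K.l_neg)
qed (auto simp: finsupp_add finsupp_zero finsupp_closed K.a_ac)

lemma ring_A: "ring A"
proof (rule ringI)
  show "monoid A"
    by (rule monoidI; unfold carrier_A) (simp_all only: mult_A_closed one_A_closed mult_A_assoc one_A_mult)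
qed (simp_all only: abelian_group_A carrier_A mult_A_add_left mult_A_add_right)

lemma unital_algebra_A: "unital_algebra K A"
proof -
  have "module K A"
    by (rule moduleI; (unfold carrier_A)?)
       (auto simp: K.cring_axioms abelian_group_A finsupp_smult finsupp_closed K.l_distr K.r_distr K.m_assoc)
  moreover have "unital_algebra_axioms K A"
    by unfold_locales (simp_all only: carrier_A mult_A_smult_left mult_A_smult_right)
  ultimately show ?thesis using ring_A by (simp add: unital_algebra_def)
qed

end

section \<open>Quotient algebras and the relations of the partial group algebra\<close>

lemma quotient_algebra_simps:
  "carrier (quotient_algebra A I) = carrier (A Quot I)"
  "mult (quotient_algebra A I) = mult (A Quot I)"
  "one (quotient_algebra A I) = one (A Quot I)"
  "zero (quotient_algebra A I) = zero (A Quot I)"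
  "add (quotient_algebra A I) = add (A Quot I)"
  by (simp_all add: quotient_algebra_def)

locale algebra_ideal = F: unital_algebra K F + I: ideal I F
  for K :: "('k, 'm) ring_scheme" and F :: "('k, 'a, 'p) module_scheme" and I
begin

abbreviation "Q \<equiv> quotient_algebra F I"

lemma carrier_Q: "carrier Q = (\<lambda>x. I +>\<^bsub>F\<^esub> x) ` carrier F"
  by (auto simp: quotient_algebra_simps FactRing_def A_RCOSETS_def')

lemma rcos_mult: "x \<in> carrier F \<Longrightarrow> y \<in> carrier F \<Longrightarrow>
    (I +>\<^bsub>F\<^esub> x) \<otimes>\<^bsub>Q\<^esub> (I +>\<^bsub>F\<^esub> y) = I +>\<^bsub>F\<^esub> (x \<otimes>\<^bsub>F\<^esub> y)"
  by (simp add: quotient_algebra_simps FactRing_def I.rcoset_mult_add)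

lemma rcos_add: "x \<in> carrier F \<Longrightarrow> y \<in> carrier F \<Longrightarrow>
    (I +>\<^bsub>F\<^esub> x) \<oplus>\<^bsub>Q\<^esub> (I +>\<^bsub>F\<^esub> y) = I +>\<^bsub>F\<^esub> (x \<oplus>\<^bsub>F\<^esub> y)"
  by (simp add: quotient_algebra_simps FactRing_def I.a_rcos_sum)

lemma rcos_one: "\<one>\<^bsub>Q\<^esub> = I +>\<^bsub>F\<^esub> \<one>\<^bsub>F\<^esub>"
  by (simp add: quotient_algebra_simps FactRing_def)

lemma rcos_zero: "\<zero>\<^bsub>Q\<^esub> = I"
  by (simp add: quotient_algebra_simps FactRing_def)

lemma rcos_eq_zero: "x \<in> carrier F \<Longrightarrow> I +>\<^bsub>F\<^esub> x = \<zero>\<^bsub>Q\<^esub> \<longleftrightarrow> x \<in> I"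
  using I.a_rcos_const I.a_rcos_self[of x] by (auto simp: rcos_zero)

text \<open>A ring ideal is closed under scalars because \<open>r i = (r 1) i\<close>.\<close>

lemma ideal_smult: "r \<in> carrier K \<Longrightarrow> i \<in> I \<Longrightarrow> r \<odot>\<^bsub>F\<^esub> i \<in> I"
  using I.I_l_closed[of i "r \<odot>\<^bsub>F\<^esub> \<one>\<^bsub>F\<^esub>"] F.smult_mult_left[of r "\<one>\<^bsub>F\<^esub>" i] I.Icarr[of i]
  by auto

text \<open>The scalar action on a coset is a union over all representatives. By
  \<open>ideal_smult\<close> each of them yields the same coset, so the union is that coset.\<close>

lemma rcos_smult:
  assumes "r \<in> carrier K" "x \<in> carrier F"
  shows "r \<odot>\<^bsub>Q\<^esub> (I +>\<^bsub>F\<^esub> x) = I +>\<^bsub>F\<^esub> (r \<odot>\<^bsub>F\<^esub> x)"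
proof -
  have "I +>\<^bsub>F\<^esub> (r \<odot>\<^bsub>F\<^esub> y) = I +>\<^bsub>F\<^esub> (r \<odot>\<^bsub>F\<^esub> x)" if "y \<in> I +>\<^bsub>F\<^esub> x" for y
  proof -
    from that obtain i where i: "i \<in> I" "y = i \<oplus>\<^bsub>F\<^esub> x"
      by (auto simp: a_r_coset_def')
    then have "r \<odot>\<^bsub>F\<^esub> y = r \<odot>\<^bsub>F\<^esub> i \<oplus>\<^bsub>F\<^esub> r \<odot>\<^bsub>F\<^esub> x"
      using assms I.Icarr by (simp add: F.smult_r_distr)
    moreover have "r \<odot>\<^bsub>F\<^esub> i \<in> I" using assms i ideal_smult by simp
    ultimately have "r \<odot>\<^bsub>F\<^esub> y \<in> I +>\<^bsub>F\<^esub> (r \<odot>\<^bsub>F\<^esub> x)" by (auto simp: a_r_coset_def')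
    then show ?thesis
      using assms by (intro F.a_repr_independence[symmetric]) (auto intro: I.a_subgroup)
  qed
  moreover have "x \<in> I +>\<^bsub>F\<^esub> x" using assms I.a_rcos_self by simp
  ultimately have "(\<Union>y\<in>I +>\<^bsub>F\<^esub> x. I +>\<^bsub>F\<^esub> (r \<odot>\<^bsub>F\<^esub> y)) = I +>\<^bsub>F\<^esub> (r \<odot>\<^bsub>F\<^esub> x)"
    by blast
  then show ?thesis by (simp add: quotient_algebra_def)
qed

lemma unital_algebra_Q: "unital_algebra K Q"
proof -
  interpret q: ring "F Quot I" by (rule I.quotient_is_ring)
  have ag: "abelian_group Q"
  proof (rule abelian_groupI; unfold quotient_algebra_simps)
    fix x y assume xy: "x \<in> carrier (F Quot I)" "y \<in> carrier (F Quot I)"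
    show "x \<oplus>\<^bsub>F Quot I\<^esub> y = y \<oplus>\<^bsub>F Quot I\<^esub> x" by (rule q.a_comm[OF xy])
    show "\<exists>y\<in>carrier (F Quot I). y \<oplus>\<^bsub>F Quot I\<^esub> x = \<zero>\<^bsub>F Quot I\<^esub>"
      using q.a_inv_closed[OF xy(1)] q.l_neg[OF xy(1)] by blast
  qed (simp_all add: q.a_assoc)
  have "ring Q"
  proof (rule ringI[OF ag])
    show "monoid Q" by (rule monoidI; unfold quotient_algebra_simps) (auto simp: q.m_assoc)
  qed (auto simp: quotient_algebra_simps q.l_distr q.r_distr)
  moreover have "module K Q"
  proof (rule moduleI[OF F.R.is_cring ag])
    show "a \<odot>\<^bsub>Q\<^esub> x \<in> carrier Q" if "a \<in> carrier K" "x \<in> carrier Q" for a x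
      using that by (auto simp: carrier_Q rcos_smult)
  next
    fix a b x assume "a \<in> carrier K" "b \<in> carrier K" "x \<in> carrier Q"
    then show "(a \<oplus>\<^bsub>K\<^esub> b) \<odot>\<^bsub>Q\<^esub> x = a \<odot>\<^bsub>Q\<^esub> x \<oplus>\<^bsub>Q\<^esub> b \<odot>\<^bsub>Q\<^esub> x"
       "(a \<otimes>\<^bsub>K\<^esub> b) \<odot>\<^bsub>Q\<^esub> x = a \<odot>\<^bsub>Q\<^esub> (b \<odot>\<^bsub>Q\<^esub> x)"
      by (auto simp: carrier_Q rcos_smult rcos_add F.smult_l_distr F.smult_assoc1)
  next
    fix a x y assume "a \<in> carrier K" "x \<in> carrier Q" "y \<in> carrier Q"
    then show "a \<odot>\<^bsub>Q\<^esub> (x \<oplus>\<^bsub>Q\<^esub> y) = a \<odot>\<^bsub>Q\<^esub> x \<oplus>\<^bsub>Q\<^esub> a \<odot>\<^bsub>Q\<^esub> y"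
      by (auto simp: carrier_Q rcos_smult rcos_add F.smult_r_distr)
  next
    fix x assume "x \<in> carrier Q"
    then show "\<one>\<^bsub>K\<^esub> \<odot>\<^bsub>Q\<^esub> x = x" by (auto simp: carrier_Q rcos_smult)
  qed
  moreover have "unital_algebra_axioms K Q"
    by unfold_locales (auto simp: carrier_Q rcos_smult rcos_mult F.smult_mult_left F.smult_mult_right)
  ultimately show ?thesis by (simp add: unital_algebra_def)
qed

end

section \<open>Consequences of the defining relations in an arbitrary algebra\<close>

lemma prohibitions_cases [consumes 1]:
  assumes "V \<in> prohibitions K G \<sigma>"
  obtains (I) h g s where "h \<in> carrier G" "g \<in> carrier G" "s \<in> carrier G" "\<sigma> g s = \<zero>\<^bsub>K\<^esub>"
      "V = {h, h \<otimes>\<^bsub>G\<^esub> g, h \<otimes>\<^bsub>G\<^esub> g \<otimes>\<^bsub>G\<^esub> s}"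
    | (II) h g s t where "h \<in> carrier G" "g \<in> carrier G" "s \<in> carrier G" "t \<in> carrier G"
      "\<sigma> g (s \<otimes>\<^bsub>G\<^esub> t) \<otimes>\<^bsub>K\<^esub> \<sigma> s t \<noteq> \<sigma> g s \<otimes>\<^bsub>K\<^esub> \<sigma> (g \<otimes>\<^bsub>G\<^esub> s) t"
      "V = {h, h \<otimes>\<^bsub>G\<^esub> g, h \<otimes>\<^bsub>G\<^esub> g \<otimes>\<^bsub>G\<^esub> s, h \<otimes>\<^bsub>G\<^esub> g \<otimes>\<^bsub>G\<^esub> s \<otimes>\<^bsub>G\<^esub> t}"
  using assms unfolding prohibitions_def prohibitions_I_def prohibitions_II_def by blast

text \<open>The relations, detached from the free algebra. The locale is interpreted for the
  generators of the quotient and for a representation that witnesses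
  \<open>\<sigma> \<in> pm\<close>.\<close>

locale par_relations_algebra = Q: ring Q + K: field K + G: group G + A: unital_algebra K Q
  for Q :: "('k, 'a, 'p) module_scheme" (structure)
    and K :: "('k, 'm) ring_scheme" and G :: "('g, 'n) monoid_scheme" +
  fixes \<sigma> :: "'g \<Rightarrow> 'g \<Rightarrow> 'k" and u :: "'g \<Rightarrow> 'a"
  assumes sigma_closed [simp]: "g \<in> carrier G \<Longrightarrow> h \<in> carrier G \<Longrightarrow> \<sigma> g h \<in> carrier K"
    and u_closed [simp]: "g \<in> carrier G \<Longrightarrow> u g \<in> carrier Q"
    and u_one: "u \<one>\<^bsub>G\<^esub> = \<one>"
    and sigma_zero_left: "g \<in> carrier G \<Longrightarrow> h \<in> carrier G \<Longrightarrow> \<sigma> g h = \<zero>\<^bsub>K\<^esub> \<Longrightarrow>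
          u (inv\<^bsub>G\<^esub> g) \<otimes> u (g \<otimes>\<^bsub>G\<^esub> h) = \<zero>"
    and sigma_zero_right: "g \<in> carrier G \<Longrightarrow> h \<in> carrier G \<Longrightarrow> \<sigma> g h = \<zero>\<^bsub>K\<^esub> \<Longrightarrow>
          u (g \<otimes>\<^bsub>G\<^esub> h) \<otimes> u (inv\<^bsub>G\<^esub> h) = \<zero>"
    and u_mult_left: "g \<in> carrier G \<Longrightarrow> h \<in> carrier G \<Longrightarrow>
          u (inv\<^bsub>G\<^esub> g) \<otimes> u g \<otimes> u h = \<sigma> g h \<odot> (u (inv\<^bsub>G\<^esub> g) \<otimes> u (g \<otimes>\<^bsub>G\<^esub> h))"
    and u_mult_right: "g \<in> carrier G \<Longrightarrow> h \<in> carrier G \<Longrightarrow>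
          u g \<otimes> u h \<otimes> u (inv\<^bsub>G\<^esub> h) = \<sigma> g h \<odot> (u (g \<otimes>\<^bsub>G\<^esub> h) \<otimes> u (inv\<^bsub>G\<^esub> h))"
begin

text \<open>The default 0 is harmless: if \<open>\<sigma> g (inv g)\<close> is zero, then
  \<open>u g\<close> and \<open>u (inv g)\<close> vanish (\<open>sigma_inv_zero\<close>), so
  \<open>e g = 0\<close> still satisfies \<open>e g u g = u g\<close>.\<close>

definition sinv :: "'g \<Rightarrow> 'k" where
  "sinv g = (if \<sigma> g (inv\<^bsub>G\<^esub> g) = \<zero>\<^bsub>K\<^esub> then \<zero>\<^bsub>K\<^esub> else inv\<^bsub>K\<^esub> (\<sigma> g (inv\<^bsub>G\<^esub> g)))"

definition e :: "'g \<Rightarrow> 'a" where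
  "e g = sinv g \<odot> (u g \<otimes> u (inv\<^bsub>G\<^esub> g))"

lemma sinv_closed [simp]: "g \<in> carrier G \<Longrightarrow> sinv g \<in> carrier K"
  by (auto simp: sinv_def K.field_Units)

lemma sinv_mult: "g \<in> carrier G \<Longrightarrow> \<sigma> g (inv\<^bsub>G\<^esub> g) \<noteq> \<zero>\<^bsub>K\<^esub> \<Longrightarrow> sinv g \<otimes>\<^bsub>K\<^esub> \<sigma> g (inv\<^bsub>G\<^esub> g) = \<one>\<^bsub>K\<^esub>"
  by (simp add: sinv_def K.field_Units K.Units_l_inv)

lemma e_closed [simp]: "g \<in> carrier G \<Longrightarrow> e g \<in> carrier Q"
  by (simp add: e_def)

text \<open>In the zero relations at \<open>h = inv g\<close> one of the two factors is
  \<open>u 1\<close>, the unity.\<close>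

lemma sigma_inv_zero:
  assumes "g \<in> carrier G" "\<sigma> g (inv\<^bsub>G\<^esub> g) = \<zero>\<^bsub>K\<^esub>"
  shows "u g = \<zero>" "u (inv\<^bsub>G\<^esub> g) = \<zero>" "e g = \<zero>"
  using assms sigma_zero_left[of g "inv\<^bsub>G\<^esub> g"] sigma_zero_right[of g "inv\<^bsub>G\<^esub> g"]
  by (simp_all add: u_one e_def)

lemma e_u: 
  assumes "g \<in> carrier G"
  shows "e g \<otimes> u g = u g"
proof (cases "\<sigma> g (inv\<^bsub>G\<^esub> g) = \<zero>\<^bsub>K\<^esub>")
  case True
  then show ?thesis using assms sigma_inv_zero by simp
next
  case False
  have "u g \<otimes> u (inv\<^bsub>G\<^esub> g) \<otimes> u g = \<sigma> g (inv\<^bsub>G\<^esub> g) \<odot> u g"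
    using assms u_mult_right[of g "inv\<^bsub>G\<^esub> g"] by (simp add: u_one)
  then show ?thesis
    using assms False by (simp add: e_def A.smult_mult_left A.smult_assoc1[symmetric] sinv_mult)
qed

lemma u_inv_e:
  assumes "g \<in> carrier G"
  shows "u (inv\<^bsub>G\<^esub> g) \<otimes> e g = u (inv\<^bsub>G\<^esub> g)"
proof (cases "\<sigma> g (inv\<^bsub>G\<^esub> g) = \<zero>\<^bsub>K\<^esub>")
  case True
  then show ?thesis using assms sigma_inv_zero by simp
next
  case False
  have "u (inv\<^bsub>G\<^esub> g) \<otimes> (u g \<otimes> u (inv\<^bsub>G\<^esub> g)) = \<sigma> g (inv\<^bsub>G\<^esub> g) \<odot> u (inv\<^bsub>G\<^esub> g)"
    using assms u_mult_left[of g "inv\<^bsub>G\<^esub> g"] by (simp add: u_one Q.m_assoc)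
  then show ?thesis
    using assms False by (simp add: e_def A.smult_mult_right A.smult_assoc1[symmetric] sinv_mult)
qed

lemma e_one: "e \<one>\<^bsub>G\<^esub> = \<one>"
  using e_u[of "\<one>\<^bsub>G\<^esub>"] by (simp add: u_one)

text \<open>The relation for \<open>u (inv g) u g u h\<close> carries an extra factor on the left.
  Multiplying by \<open>sinv g\<close> and \<open>u g\<close> turns this factor into
  \<open>e g\<close>, and \<open>e g\<close> fixes \<open>u g\<close>.\<close>

lemma u_mult:
  assumes "g \<in> carrier G" "h \<in> carrier G"
  shows "u g \<otimes> u h = \<sigma> g h \<odot> (e g \<otimes> u (g \<otimes>\<^bsub>G\<^esub> h))"
proof -
  have "u g \<otimes> u h = e g \<otimes> u g \<otimes> u h"
    using assms by (simp add: e_u)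
  also have "\<dots> = sinv g \<odot> (u g \<otimes> (u (inv\<^bsub>G\<^esub> g) \<otimes> u g \<otimes> u h))"
    using assms by (simp add: e_def A.smult_mult_left Q.m_assoc)
  also have "\<dots> = sinv g \<odot> (\<sigma> g h \<odot> (u g \<otimes> (u (inv\<^bsub>G\<^esub> g) \<otimes> u (g \<otimes>\<^bsub>G\<^esub> h))))"
    using assms by (simp add: u_mult_left A.smult_mult_right)
  also have "\<dots> = \<sigma> g h \<odot> (sinv g \<odot> (u g \<otimes> (u (inv\<^bsub>G\<^esub> g) \<otimes> u (g \<otimes>\<^bsub>G\<^esub> h))))"
    using assms by (simp add: A.smult_assoc1[symmetric] K.m_comm)
  also have "\<dots> = \<sigma> g h \<odot> (e g \<otimes> u (g \<otimes>\<^bsub>G\<^esub> h))"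
    using assms by (simp add: e_def A.smult_mult_left Q.m_assoc)
  finally show ?thesis .
qed

text \<open>Both sides are scalar multiples of \<open>m = u (g h) u (inv h)\<close>, and \<open>e (g h) m = m = m e h\<close>.\<close>

lemma u_e:
  assumes g: "g \<in> carrier G" and h: "h \<in> carrier G"
  shows "u g \<otimes> e h = e (g \<otimes>\<^bsub>G\<^esub> h) \<otimes> u g"
proof -
  let ?gh = "g \<otimes>\<^bsub>G\<^esub> h"
  let ?m = "u ?gh \<otimes> u (inv\<^bsub>G\<^esub> h)"
  let ?a = "sinv h \<otimes>\<^bsub>K\<^esub> \<sigma> g h"
  let ?b = "sinv ?gh \<otimes>\<^bsub>K\<^esub> \<sigma> (inv\<^bsub>G\<^esub> ?gh) g"
  have a: "u g \<otimes> e h = ?a \<odot> ?m"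
    using g h u_mult_right[OF g h]
    by (simp add: e_def A.smult_mult_right Q.m_assoc A.smult_assoc1)
  have "inv\<^bsub>G\<^esub> ?gh \<otimes>\<^bsub>G\<^esub> g = inv\<^bsub>G\<^esub> h"
    using g h by (simp add: G.inv_mult_group G.m_assoc)
  then have b: "e ?gh \<otimes> u g = ?b \<odot> ?m"
    using g h u_mult_left[of "inv\<^bsub>G\<^esub> ?gh" g]
    by (simp add: e_def A.smult_mult_left A.smult_assoc1)
  have "?a \<odot> ?m = e ?gh \<otimes> (?a \<odot> ?m)"
    using g h by (simp add: A.smult_mult_right Q.m_assoc[symmetric] e_u)
  also have "\<dots> = (e ?gh \<otimes> u g) \<otimes> e h"
    using g h a by (simp add: Q.m_assoc)
  also have "\<dots> = ?b \<odot> ?m"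
    unfolding b using g h by (simp add: A.smult_mult_left Q.m_assoc u_inv_e)
  finally show ?thesis using a b by simp
qed

text \<open>Moving \<open>e h\<close> through \<open>u (inv g)\<close> and \<open>u g\<close>
  translates its index to \<open>inv g h\<close> and back to \<open>h\<close>, so \<open>e h\<close>
  commutes with \<open>u g u (inv g)\<close>.\<close>

lemma e_comm:
  assumes g: "g \<in> carrier G" and h: "h \<in> carrier G"
  shows "e g \<otimes> e h = e h \<otimes> e g"
proof -
  have "u (inv\<^bsub>G\<^esub> g) \<otimes> e h = e (inv\<^bsub>G\<^esub> g \<otimes>\<^bsub>G\<^esub> h) \<otimes> u (inv\<^bsub>G\<^esub> g)"
    using g h by (intro u_e) auto
  moreover have "u g \<otimes> e (inv\<^bsub>G\<^esub> g \<otimes>\<^bsub>G\<^esub> h) = e h \<otimes> u g"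
    using g h u_e[of g "inv\<^bsub>G\<^esub> g \<otimes>\<^bsub>G\<^esub> h"] by (simp add: G.m_assoc[symmetric])
  ultimately have "u g \<otimes> u (inv\<^bsub>G\<^esub> g) \<otimes> e h = e h \<otimes> (u g \<otimes> u (inv\<^bsub>G\<^esub> g))"
    using g h by (metis G.inv_closed G.m_closed Q.m_assoc e_closed u_closed)
  then show ?thesis
    using g h by (simp add: e_def[of g] A.smult_mult_left A.smult_mult_right)
qed

lemma e_idem: "g \<in> carrier G \<Longrightarrow> e g \<otimes> e g = e g"
  by (subst (2 3) e_def) (simp add: A.smult_mult_right Q.m_assoc[symmetric] e_u)

text \<open>A product over a list, because the ambient multiplication is not commutative; by
  \<open>eprod_cong\<close> only the set of entries matters.\<close>

primrec eprod :: "'g list \<Rightarrow> 'a" where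
  "eprod [] = \<one>"
| "eprod (x # xs) = e x \<otimes> eprod xs"

lemma eprod_closed [simp]: "set xs \<subseteq> carrier G \<Longrightarrow> eprod xs \<in> carrier Q"
  by (induction xs) auto

lemma e_eprod_comm: "g \<in> carrier G \<Longrightarrow> set xs \<subseteq> carrier G \<Longrightarrow> e g \<otimes> eprod xs = eprod xs \<otimes> e g"
proof (induction xs)
  case (Cons x xs)
  then have "e g \<otimes> (e x \<otimes> eprod xs) = e x \<otimes> (e g \<otimes> eprod xs)"
    using e_comm[of g x] Q.m_assoc[of "e g" "e x" "eprod xs"] Q.m_assoc[of "e x" "e g" "eprod xs"] by simp
  with Cons show ?case by (simp add: Q.m_assoc)
qed simp

lemma e_eprod_absorb: "set xs \<subseteq> carrier G \<Longrightarrow> x \<in> set xs \<Longrightarrow> e x \<otimes> eprod xs = eprod xs"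
proof (induction xs)
  case (Cons y xs)
  show ?case
  proof (cases "x = y")
    case True
    with Cons.prems show ?thesis by (simp add: Q.m_assoc[symmetric] e_idem)
  next
    case False
    with Cons.prems have x: "x \<in> set xs" by simp
    from Cons.prems x have c: "x \<in> carrier G" "y \<in> carrier G" "set xs \<subseteq> carrier G" by auto
    then have "e x \<otimes> (e y \<otimes> eprod xs) = e y \<otimes> (e x \<otimes> eprod xs)"
      using e_comm[of x y] Q.m_assoc[of "e x" "e y" "eprod xs"] Q.m_assoc[of "e y" "e x" "eprod xs"] by simp
    then show ?thesis using Cons.IH c x by simp
  qed
qed simp

lemma eprod_absorb:
  "set ys \<subseteq> set xs \<Longrightarrow> set xs \<subseteq> carrier G \<Longrightarrow> eprod ys \<otimes> eprod xs = eprod xs"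
  by (induction ys) (auto simp: Q.m_assoc e_eprod_absorb subset_iff)

lemma eprod_comm:
  "set ys \<subseteq> carrier G \<Longrightarrow> set xs \<subseteq> carrier G \<Longrightarrow> eprod ys \<otimes> eprod xs = eprod xs \<otimes> eprod ys"
proof (induction ys)
  case (Cons y ys)
  then have "e y \<otimes> eprod ys \<otimes> eprod xs = (e y \<otimes> eprod xs) \<otimes> eprod ys"
    by (simp add: Q.m_assoc)
  with Cons show ?case by (simp add: Q.m_assoc e_eprod_comm)
qed simp

text \<open>Each of the two products absorbs the other, and they commute.\<close>

lemma eprod_cong:
  assumes "set xs = set ys" "set ys \<subseteq> carrier G"
  shows "eprod xs = eprod ys"
  using eprod_absorb[of ys xs] eprod_absorb[of xs ys] eprod_comm[of xs ys] assms by simp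

lemma u_eprod:
  assumes "g \<in> carrier G" "set xs \<subseteq> carrier G"
  shows "u g \<otimes> eprod xs = eprod (map (\<lambda>x. g \<otimes>\<^bsub>G\<^esub> x) xs) \<otimes> u g"
  using assms(2)
proof (induction xs)
  case (Cons x xs)
  have c: "set (map (\<lambda>x. g \<otimes>\<^bsub>G\<^esub> x) xs) \<subseteq> carrier G" using assms Cons.prems by auto
  have "u g \<otimes> (e x \<otimes> eprod xs) = e (g \<otimes>\<^bsub>G\<^esub> x) \<otimes> (u g \<otimes> eprod xs)"
    using assms Cons.prems by (simp add: Q.m_assoc[symmetric] u_e)
  with Cons assms c show ?case by (simp add: Q.m_assoc)
qed (use assms in simp)

text \<open>Moving \<open>u g\<close> past the vanishing product gives
  \<open>eprod ys u g = 0\<close> for the translated list. As \<open>u g\<close> need not be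
  invertible, multiplying by \<open>u (inv g)\<close> recovers only the factor \<open>e g\<close>;
  hence \<open>g\<close> joins the list. The starting point \<open>h\<close> of a prohibition arises
  in this way.\<close>

lemma eprod_translate_zero:
  assumes "g \<in> carrier G" "set xs \<subseteq> carrier G" "eprod xs = \<zero>"
  shows "eprod (g # map (\<lambda>x. g \<otimes>\<^bsub>G\<^esub> x) xs) = \<zero>"
proof -
  let ?ys = "map (\<lambda>x. g \<otimes>\<^bsub>G\<^esub> x) xs"
  have c: "set ?ys \<subseteq> carrier G" using assms by auto
  have "eprod ?ys \<otimes> u g = \<zero>"
    using u_eprod[OF assms(1,2)] assms by simp
  then have "eprod ?ys \<otimes> (u g \<otimes> u (inv\<^bsub>G\<^esub> g)) = \<zero>"
    using assms c Q.m_assoc[of "eprod ?ys" "u g" "u (inv\<^bsub>G\<^esub> g)"] by (simp del: set_map)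
  then have "eprod ?ys \<otimes> e g = \<zero>"
    using assms c by (simp add: e_def A.smult_mult_right)
  then show ?thesis using e_eprod_comm[OF assms(1) c] by simp
qed

text \<open>In \<open>e g e (g s)\<close> the two inner factors are
  \<open>u (inv g) u (g s)\<close>, which is zero by a relation. Translation by \<open>h\<close>
  does the rest.\<close>

lemma eprod_prohibition_I:
  assumes "h \<in> carrier G" "g \<in> carrier G" "s \<in> carrier G" "\<sigma> g s = \<zero>\<^bsub>K\<^esub>"
  shows "eprod [h, h \<otimes>\<^bsub>G\<^esub> g, h \<otimes>\<^bsub>G\<^esub> g \<otimes>\<^bsub>G\<^esub> s] = \<zero>"
proof -
  have "u g \<otimes> u (inv\<^bsub>G\<^esub> g) \<otimes> (u (g \<otimes>\<^bsub>G\<^esub> s) \<otimes> u (inv\<^bsub>G\<^esub> (g \<otimes>\<^bsub>G\<^esub> s)))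
    = u g \<otimes> (u (inv\<^bsub>G\<^esub> g) \<otimes> u (g \<otimes>\<^bsub>G\<^esub> s)) \<otimes> u (inv\<^bsub>G\<^esub> (g \<otimes>\<^bsub>G\<^esub> s))"
    using assms by (simp add: Q.m_assoc)
  also have "\<dots> = \<zero>" using assms by (simp add: sigma_zero_left)
  finally have "eprod [g, g \<otimes>\<^bsub>G\<^esub> s] = \<zero>"
    using assms by (simp add: e_def A.smult_mult_left A.smult_mult_right)
  from eprod_translate_zero[OF assms(1) _ this] show ?thesis
    using assms by (simp add: G.m_assoc)
qed

lemma smult_neq_imp_zero:
  assumes "a \<in> carrier K" "b \<in> carrier K" "a \<noteq> b" "x \<in> carrier Q" "a \<odot> x = b \<odot> x"
  shows "x = \<zero>"
proof -
  let ?d = "a \<ominus>\<^bsub>K\<^esub> b"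
  have d: "?d \<in> carrier K" "?d \<noteq> \<zero>\<^bsub>K\<^esub>"
    using assms K.add.inv_solve_right'[of "\<zero>\<^bsub>K\<^esub>" a b] by (auto simp: K.minus_eq)
  have "?d \<odot> x = a \<odot> x \<oplus> (\<ominus>\<^bsub>K\<^esub> b) \<odot> x"
    using assms by (simp add: a_minus_def A.smult_l_distr)
  also have "\<dots> = \<zero>" using assms by (simp add: A.smult_l_minus Q.r_neg)
  finally have z: "?d \<odot> x = \<zero>" .
  have "inv\<^bsub>K\<^esub> ?d \<in> carrier K" "inv\<^bsub>K\<^esub> ?d \<otimes>\<^bsub>K\<^esub> ?d = \<one>\<^bsub>K\<^esub>"
    using d by (auto simp: K.field_Units intro!: K.Units_l_inv)
  then have "x = inv\<^bsub>K\<^esub> ?d \<odot> (?d \<odot> x)"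
    using d assms by (simp add: A.smult_assoc1[symmetric])
  then show ?thesis using z d by (simp add: K.field_Units)
qed

text \<open>The two bracketings of \<open>u g u s u t\<close> are scalar multiples of the same
  element \<open>e g e (g s) u (g s t)\<close>. If the scalars differ, that element is zero, and
  multiplying by \<open>u (inv (g s t))\<close> completes the product of idempotents.\<close>

lemma eprod_prohibition_II:
  assumes c: "h \<in> carrier G" "g \<in> carrier G" "s \<in> carrier G" "t \<in> carrier G"
    and ne: "\<sigma> g (s \<otimes>\<^bsub>G\<^esub> t) \<otimes>\<^bsub>K\<^esub> \<sigma> s t \<noteq> \<sigma> g s \<otimes>\<^bsub>K\<^esub> \<sigma> (g \<otimes>\<^bsub>G\<^esub> s) t"
  shows "eprod [h, h \<otimes>\<^bsub>G\<^esub> g, h \<otimes>\<^bsub>G\<^esub> g \<otimes>\<^bsub>G\<^esub> s, h \<otimes>\<^bsub>G\<^esub> g \<otimes>\<^bsub>G\<^esub> s \<otimes>\<^bsub>G\<^esub> t] = \<zero>"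
proof -
  let ?gs = "g \<otimes>\<^bsub>G\<^esub> s" and ?gst = "g \<otimes>\<^bsub>G\<^esub> s \<otimes>\<^bsub>G\<^esub> t"
  let ?x = "e g \<otimes> e ?gs \<otimes> u ?gst"
  have "u g \<otimes> u s \<otimes> u t = (\<sigma> g s \<otimes>\<^bsub>K\<^esub> \<sigma> ?gs t) \<odot> ?x"
    using c by (simp add: u_mult A.smult_mult_left A.smult_mult_right Q.m_assoc A.smult_assoc1)
  moreover have "u g \<otimes> (u s \<otimes> u t) = (\<sigma> g (s \<otimes>\<^bsub>G\<^esub> t) \<otimes>\<^bsub>K\<^esub> \<sigma> s t) \<odot> ?x"
  proof -
    have "u g \<otimes> (u s \<otimes> u t) = \<sigma> s t \<odot> (u g \<otimes> e s \<otimes> u (s \<otimes>\<^bsub>G\<^esub> t))"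
      using c by (simp add: u_mult[of s t] A.smult_mult_right Q.m_assoc)
    also have "u g \<otimes> e s \<otimes> u (s \<otimes>\<^bsub>G\<^esub> t) = e ?gs \<otimes> (u g \<otimes> u (s \<otimes>\<^bsub>G\<^esub> t))"
      using c by (simp add: u_e Q.m_assoc)
    also have "\<dots> = \<sigma> g (s \<otimes>\<^bsub>G\<^esub> t) \<odot> (e ?gs \<otimes> e g \<otimes> u ?gst)"
      using c by (simp add: u_mult A.smult_mult_right Q.m_assoc G.m_assoc)
    also have "e ?gs \<otimes> e g = e g \<otimes> e ?gs" using c by (simp add: e_comm)
    finally show ?thesis using c by (simp add: A.smult_assoc1[symmetric] K.m_comm)
  qed
  ultimately have "(\<sigma> g (s \<otimes>\<^bsub>G\<^esub> t) \<otimes>\<^bsub>K\<^esub> \<sigma> s t) \<odot> ?x = (\<sigma> g s \<otimes>\<^bsub>K\<^esub> \<sigma> ?gs t) \<odot> ?x"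
    using c by (simp add: Q.m_assoc)
  then have "?x = \<zero>" using c ne by (intro smult_neq_imp_zero[OF _ _ ne]) auto
  then have "e g \<otimes> e ?gs \<otimes> (u ?gst \<otimes> u (inv\<^bsub>G\<^esub> ?gst)) = \<zero>"
    using c by (simp add: Q.m_assoc[symmetric])
  then have "eprod [g, ?gs, ?gst] = \<zero>"
    using c by (simp add: e_def[of ?gst] A.smult_mult_right Q.m_assoc)
  then have "eprod (h # map (\<lambda>x. h \<otimes>\<^bsub>G\<^esub> x) [g, ?gs, ?gst]) = \<zero>"
    using c by (intro eprod_translate_zero) auto
  also have "map (\<lambda>x. h \<otimes>\<^bsub>G\<^esub> x) [g, ?gs, ?gst] = [h \<otimes>\<^bsub>G\<^esub> g, h \<otimes>\<^bsub>G\<^esub> g \<otimes>\<^bsub>G\<^esub> s, h \<otimes>\<^bsub>G\<^esub> g \<otimes>\<^bsub>G\<^esub> s \<otimes>\<^bsub>G\<^esub> t]"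
    using c by (simp add: G.m_assoc)
  finally show ?thesis .
qed

lemma eprod_prohibition:
  assumes "V \<in> prohibitions K G \<sigma>" "V \<subseteq> set xs" "set xs \<subseteq> carrier G"
  shows "eprod xs = \<zero>"
proof -
  from assms(1) obtain ys where ys: "eprod ys = \<zero>" "set ys = V"
  proof (cases rule: prohibitions_cases)
    case (I h g s)
    show thesis by (rule that[OF eprod_prohibition_I[OF I(1-4)]]) (simp add: I(5))
  next
    case (II h g s t)
    show thesis by (rule that[OF eprod_prohibition_II[OF II(1-5)]]) (simp add: II(6))
  qed
  \<comment> \<open>The idempotents at the points of the prohibition already occur in
    \<open>eprod xs\<close>, so the vanishing product is absorbed by it.\<close>
  then have "eprod ys \<otimes> eprod xs = eprod xs" using assms ys(2) by (intro eprod_absorb) auto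
  then show ?thesis using ys(1) eprod_closed[OF assms(3)] by simp
qed

end

section \<open>Words, their prefixes and their weights\<close>

definition word_prod :: "('g, 'n) monoid_scheme \<Rightarrow> 'g list \<Rightarrow> 'g" where
  "word_prod G w = foldr (\<lambda>g h. g \<otimes>\<^bsub>G\<^esub> h) w \<one>\<^bsub>G\<^esub>"

primrec prefixes :: "('g, 'n) monoid_scheme \<Rightarrow> 'g list \<Rightarrow> 'g list" where
  "prefixes G [] = [\<one>\<^bsub>G\<^esub>]"
| "prefixes G (g # w) = \<one>\<^bsub>G\<^esub> # map (\<lambda>x. g \<otimes>\<^bsub>G\<^esub> x) (prefixes G w)"

text \<open>The scalar \<open>c(w)\<close> of the overview: when a word is multiplied out from the
  right, each letter contributes the value of \<open>\<sigma>\<close> from \<open>u_mult\<close>. A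
  one-letter word has weight \<open>\<sigma> g 1\<close>, which is 1 only where normalisation is
  available.\<close>

primrec weight :: "('k, 'm) ring_scheme \<Rightarrow> ('g, 'n) monoid_scheme \<Rightarrow> ('g \<Rightarrow> 'g \<Rightarrow> 'k) \<Rightarrow> 'g list \<Rightarrow> 'k" where
  "weight K G \<sigma> [] = \<one>\<^bsub>K\<^esub>"
| "weight K G \<sigma> (g # w) = \<sigma> g (word_prod G w) \<otimes>\<^bsub>K\<^esub> weight K G \<sigma> w"

lemma word_prod_simps [simp]:
  "word_prod G [] = \<one>\<^bsub>G\<^esub>" "word_prod G (g # w) = g \<otimes>\<^bsub>G\<^esub> word_prod G w"
  by (simp_all add: word_prod_def)

context group
begin

lemma word_prod_closed [simp]: "set w \<subseteq> carrier G \<Longrightarrow> word_prod G w \<in> carrier G"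
  by (induction w) auto

lemma word_prod_append:
  "set v \<subseteq> carrier G \<Longrightarrow> set w \<subseteq> carrier G \<Longrightarrow> word_prod G (v @ w) = word_prod G v \<otimes> word_prod G w"
  by (induction v) (auto simp: m_assoc)

lemma prefixes_closed: "set w \<subseteq> carrier G \<Longrightarrow> set (prefixes G w) \<subseteq> carrier G"
  by (induction w) auto

lemma one_in_prefixes [simp]: "\<one> \<in> set (prefixes G w)"
  by (cases w) auto

lemma word_prod_in_prefixes: "word_prod G w \<in> set (prefixes G w)"
  by (induction w) auto

lemma prefixes_append:
  "set v \<subseteq> carrier G \<Longrightarrow> set w \<subseteq> carrier G \<Longrightarrow>
   set (prefixes G (v @ w)) = set (prefixes G v) \<union> (\<lambda>x. word_prod G v \<otimes> x) ` set (prefixes G w)"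
proof (induction v)
  case Nil
  have "(\<lambda>x. \<one> \<otimes> x) ` set (prefixes G w) = set (prefixes G w)"
    using prefixes_closed[OF Nil(2)] by (force simp: subset_iff)
  then show ?case using one_in_prefixes[of w] by auto
next
  case (Cons g v)
  have "(\<lambda>x. g \<otimes> word_prod G v \<otimes> x) ` set (prefixes G w)
     = (\<lambda>x. g \<otimes> x) ` (\<lambda>x. word_prod G v \<otimes> x) ` set (prefixes G w)"
    unfolding image_image using Cons prefixes_closed[OF Cons(3)]
    by (intro image_cong) (auto simp: m_assoc subset_iff)
  with Cons show ?case by (auto simp: image_Un)
qed

text \<open>A detour adds \<open>x\<close> to the visited points: \<open>x # inv x # w\<close> goes
  to \<open>x\<close>, returns to 1 and continues along \<open>w\<close>, with unchanged
  product.\<close>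

lemma exists_word:
  assumes "finite S" "S \<subseteq> carrier G" "g \<in> carrier G"
  shows "\<exists>w. set w \<subseteq> carrier G \<and> word_prod G w = g \<and> set (prefixes G w) = insert \<one> (insert g S)"
  using assms(1,2)
proof (induction S rule: finite_induct)
  case empty
  show ?case using assms(3) by (intro exI[of _ "[g]"]) auto
next
  case (insert x S)
  then obtain w where w: "set w \<subseteq> carrier G" "word_prod G w = g"
    "set (prefixes G w) = insert \<one> (insert g S)" by auto
  have "(\<lambda>y. x \<otimes> y) ` (\<lambda>y. inv x \<otimes> y) ` set (prefixes G w) = set (prefixes G w)"
    unfolding image_image using insert prefixes_closed[OF w(1)]
    by (force simp: m_assoc[symmetric] subset_iff)
  then have "set (prefixes G (x # inv x # w)) = insert \<one> (insert g (insert x S))"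
    using w insert by auto
  then show ?case
    using w insert assms(3)
    by (intro exI[of _ "x # inv x # w"]) (auto simp: m_assoc[symmetric])
qed

end

text \<open>Moving \<open>u g\<close> through the idempotents of \<open>w\<close> translates its
  prefixes by \<open>g\<close>. The idempotent \<open>e g\<close> produced by \<open>u_mult\<close>
  is absorbed, since \<open>g = g 1\<close> is one of the translated prefixes, and the new prefix 1
  costs nothing because \<open>e 1\<close> is the unity.\<close>

lemma (in par_relations_algebra) u_word:
  assumes "set w \<subseteq> carrier G"
  shows "foldr (\<lambda>g x. u g \<otimes> x) w \<one> =
    weight K G \<sigma> w \<odot> (eprod (prefixes G w) \<otimes> u (word_prod G w))"
    and "weight K G \<sigma> w \<in> carrier K"
  using assms
proof (induction w)
  case Nil
  { case 1 show ?case by (simp add: e_one u_one) }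
  { case 2 show ?case by simp }
next
  case (Cons g w)
  { case 2 then show ?case using Cons by simp }
  case 1
  let ?xs = "map (\<lambda>x. g \<otimes>\<^bsub>G\<^esub> x) (prefixes G w)" and ?p = "word_prod G w"
  from 1 have c: "g \<in> carrier G" "set w \<subseteq> carrier G" "?p \<in> carrier G"
      "weight K G \<sigma> w \<in> carrier K" "set (prefixes G w) \<subseteq> carrier G"
    using Cons G.prefixes_closed by auto
  then have c': "set ?xs \<subseteq> carrier G" by auto
  have g: "g \<in> set ?xs" using c by (auto intro!: image_eqI[of _ _ "\<one>\<^bsub>G\<^esub>"])
  have "u g \<otimes> foldr (\<lambda>g x. u g \<otimes> x) w \<one> = u g \<otimes> (weight K G \<sigma> w \<odot> (eprod (prefixes G w) \<otimes> u ?p))"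
    using Cons c by simp
  also have "\<dots> = weight K G \<sigma> w \<odot> (u g \<otimes> eprod (prefixes G w) \<otimes> u ?p)"
    using c by (simp add: A.smult_mult_right Q.m_assoc)
  also have "u g \<otimes> eprod (prefixes G w) \<otimes> u ?p = eprod ?xs \<otimes> (u g \<otimes> u ?p)"
    using c c' by (simp add: u_eprod Q.m_assoc del: set_map)
  also have "\<dots> = \<sigma> g ?p \<odot> (eprod ?xs \<otimes> e g \<otimes> u (g \<otimes>\<^bsub>G\<^esub> ?p))"
    using c c' by (simp add: u_mult A.smult_mult_right Q.m_assoc del: set_map)
  also have "eprod ?xs \<otimes> e g = eprod (prefixes G (g # w))"
    using c c' e_eprod_comm[OF c(1) c'] e_eprod_absorb[OF c' g] by (simp add: e_one del: set_map)
  finally show ?case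
    using c c' eprod_closed[of "prefixes G (g # w)"]
    by (simp add: A.smult_assoc1[symmetric] K.m_comm del: eprod.simps)
qed

lemma prohibition_I:
  assumes "h \<in> carrier G" "g \<in> carrier G" "s \<in> carrier G" "\<sigma> g s = \<zero>\<^bsub>K\<^esub>"
  shows "{h, h \<otimes>\<^bsub>G\<^esub> g, h \<otimes>\<^bsub>G\<^esub> g \<otimes>\<^bsub>G\<^esub> s} \<in> prohibitions K G \<sigma>"
  unfolding prohibitions_def prohibitions_I_def
  by (intro UnI1 CollectI exI[of _ h] exI[of _ g] exI[of _ s] conjI refl assms)

lemma prohibition_II:
  assumes "h \<in> carrier G" "g \<in> carrier G" "s \<in> carrier G" "t \<in> carrier G"
    "\<sigma> g (s \<otimes>\<^bsub>G\<^esub> t) \<otimes>\<^bsub>K\<^esub> \<sigma> s t \<noteq> \<sigma> g s \<otimes>\<^bsub>K\<^esub> \<sigma> (g \<otimes>\<^bsub>G\<^esub> s) t"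
  shows "{h, h \<otimes>\<^bsub>G\<^esub> g, h \<otimes>\<^bsub>G\<^esub> g \<otimes>\<^bsub>G\<^esub> s, h \<otimes>\<^bsub>G\<^esub> g \<otimes>\<^bsub>G\<^esub> s \<otimes>\<^bsub>G\<^esub> t} \<in> prohibitions K G \<sigma>"
  unfolding prohibitions_def prohibitions_II_def
  by (intro UnI2 CollectI exI[of _ h] exI[of _ g] exI[of _ s] exI[of _ t] conjI refl assms)

lemma Omega_sigma_avoids: "\<zeta> \<in> Omega_sigma K G \<sigma> \<Longrightarrow> V \<in> prohibitions K G \<sigma> \<Longrightarrow> \<not> V \<subseteq> \<zeta>"
  by (simp add: Omega_sigma_def)

section \<open>The spectrum as the domain on which the factor set is an invertible cocycle\<close>

locale factor_set_data = K?: field K + G?: group G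
  for K :: "('k, 'm) ring_scheme" (structure) and G :: "('g, 'n) monoid_scheme" +
  fixes \<sigma> :: "'g \<Rightarrow> 'g \<Rightarrow> 'k"
  assumes sigma_closed [simp]: "g \<in> carrier G \<Longrightarrow> h \<in> carrier G \<Longrightarrow> \<sigma> g h \<in> carrier K"
    and sigma_one_one: "\<sigma> \<one>\<^bsub>G\<^esub> \<one>\<^bsub>G\<^esub> = \<one>\<^bsub>K\<^esub>"
begin

abbreviation "\<Omega> \<equiv> Omega_sigma K G \<sigma>"
abbreviation gmult (infixl \<open>\<cdot>\<close> 70) where "g \<cdot> h \<equiv> g \<otimes>\<^bsub>G\<^esub> h"
abbreviation gcoset (infixl \<open>\<star>\<close> 60) where "g \<star> S \<equiv> g <#\<^bsub>G\<^esub> S"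
abbreviation gone (\<open>\<epsilon>\<close>) where "\<epsilon> \<equiv> \<one>\<^bsub>G\<^esub>"
abbreviation "ginv g \<equiv> inv\<^bsub>G\<^esub> g"
abbreviation "wt \<equiv> weight K G \<sigma>"
abbreviation "wprod \<equiv> word_prod G"
abbreviation "pre \<equiv> prefixes G"

lemma Omega_subset: "\<zeta> \<in> \<Omega> \<Longrightarrow> \<zeta> \<subseteq> carrier G"
  and Omega_one: "\<zeta> \<in> \<Omega> \<Longrightarrow> \<epsilon> \<in> \<zeta>"
  by (auto simp: Omega_sigma_def Omega_def)

lemma Omega_mono: "\<zeta> \<in> \<Omega> \<Longrightarrow> \<xi> \<subseteq> \<zeta> \<Longrightarrow> \<epsilon> \<in> \<xi> \<Longrightarrow> \<xi> \<in> \<Omega>"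
  unfolding Omega_sigma_def Omega_def by blast

text \<open>Avoiding prohibitions of type I makes \<open>\<sigma>\<close> nonzero along every chain
  of points of one \<open>\<zeta>\<close>. Type II does the same for the cocycle identity.\<close>

lemma sigma_nonzero_at:
  assumes "\<zeta> \<in> \<Omega>" "h \<in> carrier G" "g \<in> carrier G" "s \<in> carrier G"
    "h \<in> \<zeta>" "h \<cdot> g \<in> \<zeta>" "h \<cdot> g \<cdot> s \<in> \<zeta>"
  shows "\<sigma> g s \<noteq> \<zero>"
  using Omega_sigma_avoids[OF assms(1) prohibition_I[of h G g s \<sigma> K]] assms by auto

lemma sigma_cocycle_at:
  assumes "\<zeta> \<in> \<Omega>" "h \<in> carrier G" "g \<in> carrier G" "s \<in> carrier G" "t \<in> carrier G"
    "h \<in> \<zeta>" "h \<cdot> g \<in> \<zeta>" "h \<cdot> g \<cdot> s \<in> \<zeta>" "h \<cdot> g \<cdot> s \<cdot> t \<in> \<zeta>"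
  shows "\<sigma> g (s \<cdot> t) \<otimes> \<sigma> s t = \<sigma> g s \<otimes> \<sigma> (g \<cdot> s) t"
  using Omega_sigma_avoids[OF assms(1) prohibition_II[of h G g s t K \<sigma>]] assms by auto

lemma sigma_nonzero:
  "\<zeta> \<in> \<Omega> \<Longrightarrow> g \<in> \<zeta> \<Longrightarrow> s \<in> carrier G \<Longrightarrow> g \<cdot> s \<in> \<zeta> \<Longrightarrow> \<sigma> g s \<noteq> \<zero>"
  using sigma_nonzero_at[of \<zeta> "\<epsilon>" g s] Omega_subset[of \<zeta>] Omega_one[of \<zeta>] by auto

lemma sigma_cocycle:
  "\<zeta> \<in> \<Omega> \<Longrightarrow> g \<in> \<zeta> \<Longrightarrow> s \<in> carrier G \<Longrightarrow> t \<in> carrier G \<Longrightarrow> g \<cdot> s \<in> \<zeta> \<Longrightarrow> g \<cdot> s \<cdot> t \<in> \<zeta> \<Longrightarrow>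
   \<sigma> g (s \<cdot> t) \<otimes> \<sigma> s t = \<sigma> g s \<otimes> \<sigma> (g \<cdot> s) t"
  using sigma_cocycle_at[of \<zeta> "\<epsilon>" g s t] Omega_subset[of \<zeta>] Omega_one[of \<zeta>] by auto

text \<open>The cocycle identity at \<open>(1, 1, g)\<close> makes \<open>\<sigma> 1 g\<close>
  idempotent, and it is nonzero. Both facts use that the chain lies in a member of
  \<open>\<Omega>\<close>.\<close>

lemma sigma_one_left:
  assumes "\<zeta> \<in> \<Omega>" "g \<in> \<zeta>"
  shows "\<sigma> \<epsilon> g = \<one>"
proof -
  have g: "g \<in> carrier G" using assms Omega_subset by auto
  have "\<sigma> \<epsilon> g \<otimes> \<sigma> \<epsilon> g = \<one> \<otimes> \<sigma> \<epsilon> g"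
    using sigma_cocycle[OF assms(1), of "\<epsilon>" "\<epsilon>" g] assms g Omega_one[OF assms(1)]
    by (simp add: sigma_one_one)
  moreover have "\<sigma> \<epsilon> g \<noteq> \<zero>"
    using sigma_nonzero[OF assms(1), of "\<epsilon>" g] assms g Omega_one[OF assms(1)] by simp
  ultimately show ?thesis using g K.m_rcancel[of "\<sigma> \<epsilon> g" "\<sigma> \<epsilon> g" "\<one>"] by simp
qed

lemma sigma_one_right:
  assumes "\<zeta> \<in> \<Omega>" "g \<in> \<zeta>"
  shows "\<sigma> g \<epsilon> = \<one>"
proof -
  have g: "g \<in> carrier G" using assms Omega_subset by auto
  have "\<sigma> g \<epsilon> \<otimes> \<one> = \<sigma> g \<epsilon> \<otimes> \<sigma> g \<epsilon>"
    using sigma_cocycle[OF assms(1), of g "\<epsilon>" "\<epsilon>"] assms g Omega_one[OF assms(1)]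
    by (simp add: sigma_one_one)
  moreover have "\<sigma> g \<epsilon> \<noteq> \<zero>"
    using sigma_nonzero[OF assms(1), of g "\<epsilon>"] assms g Omega_one[OF assms(1)] by simp
  ultimately show ?thesis using g K.m_lcancel[of "\<sigma> g \<epsilon>" "\<one>" "\<sigma> g \<epsilon>"] by simp
qed

lemma mem_l_coset:
  "\<zeta> \<subseteq> carrier G \<Longrightarrow> k \<in> carrier G \<Longrightarrow> x \<in> carrier G \<Longrightarrow> x \<in> k \<star> \<zeta> \<longleftrightarrow> ginv k \<cdot> x \<in> \<zeta>"
  by (force simp: l_coset_def m_assoc[symmetric])

lemma prohibitions_translate:
  assumes "V \<in> prohibitions K G \<sigma>" "k \<in> carrier G"
  shows "k \<star> V \<in> prohibitions K G \<sigma>"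
  using assms(1)
proof (cases rule: prohibitions_cases)
  case (I h g s)
  have "k \<star> V = {k \<cdot> h, k \<cdot> h \<cdot> g, k \<cdot> h \<cdot> g \<cdot> s}"
    unfolding I(5) using assms(2) I(1-3) by (simp add: l_coset_def m_assoc insert_commute)
  then show ?thesis using prohibition_I[of "k \<cdot> h" G g s \<sigma> K] assms(2) I(1-4) by simp
next
  case (II h g s t)
  have "k \<star> V = {k \<cdot> h, k \<cdot> h \<cdot> g, k \<cdot> h \<cdot> g \<cdot> s, k \<cdot> h \<cdot> g \<cdot> s \<cdot> t}"
    unfolding II(6) using assms(2) II(1-4) by (simp add: l_coset_def m_assoc insert_commute)
  then show ?thesis using prohibition_II[of "k \<cdot> h" G g s t K \<sigma>] assms(2) II(1-5) by simp
qed

text \<open>Prohibitions may start at any point, so the family of all of them is stable under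
  translation. Only the condition that 1 belongs to the set limits the translations to
  \<open>inv x\<close> with \<open>x \<in> \<zeta>\<close>; these give the sources of the arrows
  with target \<open>\<zeta>\<close>.\<close>

lemma Omega_translate:
  assumes "\<zeta> \<in> \<Omega>" "x \<in> \<zeta>"
  shows "ginv x \<star> \<zeta> \<in> \<Omega>"
proof -
  have \<zeta>: "\<zeta> \<subseteq> carrier G" "x \<in> carrier G" using assms Omega_subset by auto
  have "ginv x \<star> \<zeta> \<subseteq> carrier G" using \<zeta> by (simp add: l_coset_subset_G)
  moreover have "\<epsilon> \<in> ginv x \<star> \<zeta>" using assms \<zeta> by (simp add: mem_l_coset)
  moreover have "\<not> V \<subseteq> ginv x \<star> \<zeta>" if V: "V \<in> prohibitions K G \<sigma>" for V
  proof
    assume "V \<subseteq> ginv x \<star> \<zeta>"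
    then have "x \<star> V \<subseteq> x \<star> (ginv x \<star> \<zeta>)" by (auto simp: l_coset_def)
    also have "\<dots> = \<zeta>" using \<zeta> by (simp add: lcos_m_assoc lcos_mult_one)
    finally show False
      using Omega_sigma_avoids[OF assms(1) prohibitions_translate[OF V \<zeta>(2)]] by simp
  qed
  ultimately show ?thesis by (simp add: Omega_sigma_def Omega_def)
qed

lemma weight_closed: "set w \<subseteq> carrier G \<Longrightarrow> wt w \<in> carrier K"
  by (induction w) auto

text \<open>Translating the prefixes of \<open>g # w\<close> back by \<open>inv g\<close> gives a
  member of \<open>\<Omega>\<close> that contains those of \<open>w\<close>.\<close>

lemma prefixes_tail_Omega:
  assumes "set (pre (g # w)) \<in> \<Omega>" "g \<in> carrier G" "set w \<subseteq> carrier G"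
  shows "set (pre w) \<in> \<Omega>"
proof (rule Omega_mono)
  have g: "g \<in> set (pre (g # w))" using assms by (auto intro!: image_eqI[of _ _ "\<epsilon>"])
  show "ginv g \<star> set (pre (g # w)) \<in> \<Omega>"
    using assms g by (intro Omega_translate) auto
  show "set (pre w) \<subseteq> ginv g \<star> set (pre (g # w))"
    using assms prefixes_closed[of w] prefixes_closed[of "g # w"] by (force simp: mem_l_coset)
qed simp

lemma weight_nonzero:
  "set w \<subseteq> carrier G \<Longrightarrow> set (pre w) \<in> \<Omega> \<Longrightarrow> wt w \<noteq> \<zero>"
proof (induction w)
  case (Cons g w)
  have "\<sigma> g (wprod w) \<noteq> \<zero>"
    using Cons.prems word_prod_in_prefixes[of w]
    by (intro sigma_nonzero[OF Cons.prems(2)]) (auto intro!: image_eqI[of _ _ "\<epsilon>"])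
  then show ?case using Cons prefixes_tail_Omega[of g w]
    by (simp add: weight_closed K.integral_iff del: prefixes.simps)
qed simp

text \<open>Words multiply like arrows. In the induction over \<open>v\<close> the new letter
  \<open>g\<close> calls for the cocycle identity at \<open>(g, wprod v, wprod w)\<close>; it is
  available because \<open>g\<close> and the next two partial products are prefixes of the whole
  word.\<close>

lemma weight_append:
  "set v \<subseteq> carrier G \<Longrightarrow> set w \<subseteq> carrier G \<Longrightarrow> set (pre (v @ w)) \<in> \<Omega> \<Longrightarrow>
   wt (v @ w) = wt v \<otimes> wt w \<otimes> \<sigma> (wprod v) (wprod w)"
proof (induction v)
  case Nil
  then have "\<sigma> \<epsilon> (wprod w) = \<one>"
    using word_prod_in_prefixes[of w] by (intro sigma_one_left) auto
  then show ?case using Nil by (simp add: weight_closed)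
next
  case (Cons g v)
  let ?\<zeta> = "set (pre (g # v @ w))" and ?p = "wprod v" and ?q = "wprod w"
  have c: "g \<in> carrier G" "set v \<subseteq> carrier G" "?p \<in> carrier G" "?q \<in> carrier G"
      "wt v \<in> carrier K" "wt w \<in> carrier K"
    using Cons.prems by (auto simp: weight_closed)
  have IH: "wt (v @ w) = wt v \<otimes> wt w \<otimes> \<sigma> ?p ?q"
    using Cons.prems prefixes_tail_Omega[of g "v @ w"] by (intro Cons.IH) auto
  have "?p \<in> set (pre (v @ w))" "?p \<cdot> ?q \<in> set (pre (v @ w))"
    using Cons.prems c word_prod_in_prefixes[of w] word_prod_in_prefixes[of v] by (auto simp: prefixes_append)
  then have "g \<in> ?\<zeta>" "g \<cdot> ?p \<in> ?\<zeta>" "g \<cdot> ?p \<cdot> ?q \<in> ?\<zeta>"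
    using c by (auto simp: m_assoc intro!: image_eqI[of _ _ "\<epsilon>"])
  then have "\<sigma> g (?p \<cdot> ?q) \<otimes> \<sigma> ?p ?q = \<sigma> g ?p \<otimes> \<sigma> (g \<cdot> ?p) ?q"
    using Cons.prems c by (intro sigma_cocycle[of ?\<zeta>]) auto
  moreover have "wt ((g # v) @ w)
      = wt v \<otimes> wt w \<otimes> (\<sigma> g (?p \<cdot> ?q) \<otimes> \<sigma> ?p ?q)"
    using Cons.prems c by (simp add: IH word_prod_append K.m_ac)
  ultimately show ?case using c by (simp add: K.m_ac)
qed

end

section \<open>The arrow coefficients\<close>

lemma free_monoid_simps [simp]:
  "carrier (free_monoid X) = lists X" "v \<otimes>\<^bsub>free_monoid X\<^esub> w = v @ w" "\<one>\<^bsub>free_monoid X\<^esub> = []"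
  by (simp_all add: free_monoid_def)

lemma free_gen_eq_single: "free_gen K x = single K [x]"
  by (simp add: free_gen_def single_def)

lemma (in field) twisted_free_monoid: "twisted_monoid R (free_monoid X) (\<lambda>_ _. \<one>)"
  by unfold_locales (auto simp: global_cocycle_def)

context factor_set_data
begin

sublocale Fr: twisted_monoid K "free_monoid (carrier G)" "\<lambda>_ _. \<one>"
  by (rule twisted_free_monoid)

sublocale Fr: unital_algebra K "twisted_monoid_algebra K (free_monoid (carrier G)) (\<lambda>_ _. \<one>)"
  by (rule Fr.unital_algebra_A)

abbreviation "F \<equiv> twisted_monoid_algebra K (free_monoid (carrier G)) (\<lambda>_ _. \<one>)"
abbreviation "words \<equiv> lists (carrier G)"

text \<open>The coefficient of the arrow \<open>(\<zeta>, g)\<close> in the action of the word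
  \<open>w\<close>.\<close>

definition path_coeff :: "'g set \<Rightarrow> 'g \<Rightarrow> 'g list \<Rightarrow> 'k" where
  "path_coeff \<zeta> g w = (if set (pre w) \<subseteq> \<zeta> \<and> wprod w = g then wt w else \<zero>)"

text \<open>Total for convenience; a pair names an arrow only if \<open>g \<in> \<zeta>\<close> and
  \<open>\<zeta> \<in> \<Omega>\<close>.\<close>

definition arrow_coeff :: "('g list \<Rightarrow> 'k) \<Rightarrow> 'g set \<Rightarrow> 'g \<Rightarrow> 'k" where
  "arrow_coeff f \<zeta> g = pairing K f (path_coeff \<zeta> g)"

lemma carrier_F: "carrier F = finsupp K words"
  using Fr.carrier_A by simp

lemma path_coeff_closed: "w \<in> words \<Longrightarrow> path_coeff \<zeta> g w \<in> carrier K"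
  by (auto simp: path_coeff_def weight_closed subset_iff)

lemma arrow_coeff_closed: "f \<in> carrier F \<Longrightarrow> arrow_coeff f \<zeta> g \<in> carrier K"
  unfolding arrow_coeff_def carrier_F by (rule pairing_closed) (auto intro: path_coeff_closed)

lemma arrow_coeff_add:
  "f \<in> carrier F \<Longrightarrow> f' \<in> carrier F \<Longrightarrow>
   arrow_coeff (f \<oplus>\<^bsub>F\<^esub> f') \<zeta> g = arrow_coeff f \<zeta> g \<oplus> arrow_coeff f' \<zeta> g"
  unfolding arrow_coeff_def carrier_F Fr.A_simps by (rule pairing_add_left) (auto intro: path_coeff_closed)

lemma arrow_coeff_smult:
  "f \<in> carrier F \<Longrightarrow> r \<in> carrier K \<Longrightarrow> arrow_coeff (r \<odot>\<^bsub>F\<^esub> f) \<zeta> g = r \<otimes> arrow_coeff f \<zeta> g"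
  unfolding arrow_coeff_def carrier_F Fr.A_simps by (rule pairing_smult_left) (auto intro: path_coeff_closed)

lemma arrow_coeff_zero: "arrow_coeff \<zero>\<^bsub>F\<^esub> \<zeta> g = \<zero>"
  by (simp add: arrow_coeff_def pairing_def)

lemma arrow_coeff_uminus:
  assumes f: "f \<in> carrier F"
  shows "arrow_coeff (\<ominus>\<^bsub>F\<^esub> f) \<zeta> g = \<ominus> arrow_coeff f \<zeta> g"
proof -
  have c: "\<ominus>\<^bsub>F\<^esub> f \<in> carrier F" using f by (rule Fr.M.a_inv_closed)
  have "arrow_coeff (\<ominus>\<^bsub>F\<^esub> f) \<zeta> g \<oplus> arrow_coeff f \<zeta> g = \<zero>"
    using arrow_coeff_add[OF c f, of \<zeta> g] Fr.M.l_neg[OF f] arrow_coeff_zero[of \<zeta> g] by (simp only:)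
  then show ?thesis
    using K.minus_equality arrow_coeff_closed[OF f] arrow_coeff_closed[OF c] by metis
qed

lemma arrow_coeff_minus:
  "f \<in> carrier F \<Longrightarrow> f' \<in> carrier F \<Longrightarrow>
   arrow_coeff (f \<ominus>\<^bsub>F\<^esub> f') \<zeta> g = arrow_coeff f \<zeta> g \<ominus> arrow_coeff f' \<zeta> g"
  by (simp only: a_minus_def arrow_coeff_add arrow_coeff_uminus Fr.M.a_inv_closed)

lemma single_in_F: "w \<in> words \<Longrightarrow> single K w \<in> carrier F"
  unfolding carrier_F by (rule finsupp_single)

lemma arrow_coeff_single: "w \<in> words \<Longrightarrow> arrow_coeff (single K w) \<zeta> g = path_coeff \<zeta> g w"
  unfolding arrow_coeff_def by (rule pairing_single) (rule path_coeff_closed)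

lemma one_F: "\<one>\<^bsub>F\<^esub> = single K []"
  by (simp add: Fr.one_A single_def fun_eq_iff)

lemma single_append: "v \<in> words \<Longrightarrow> w \<in> words \<Longrightarrow> single K v \<otimes>\<^bsub>F\<^esub> single K w = single K (v @ w)"
  using Fr.single_mult_single[of v w] by (simp add: single_def fun_eq_iff)

lemma arrow_coeff_one: "\<zeta> \<in> \<Omega> \<Longrightarrow> arrow_coeff \<one>\<^bsub>F\<^esub> \<zeta> g = (if g = \<epsilon> then \<one> else \<zero>)"
  unfolding one_F by (auto simp: arrow_coeff_single path_coeff_def Omega_one)

text \<open>The path of \<open>v @ w\<close> stays in \<open>\<zeta>\<close> iff that of
  \<open>v\<close> does and that of \<open>w\<close>, restarted at 1, stays in the translate of
  \<open>\<zeta>\<close> by the inverse of \<open>wprod v\<close>. Its prefix set is then in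
  \<open>\<Omega>\<close>, so \<open>weight_append\<close> splits the weight.\<close>

lemma path_coeff_append:
  assumes v: "v \<in> words" and w: "w \<in> words" and \<zeta>: "\<zeta> \<in> \<Omega>" and g: "g \<in> \<zeta>"
  shows "path_coeff \<zeta> g (v @ w) =
    (if set (pre v) \<subseteq> \<zeta> then wt v \<otimes>
       (path_coeff (ginv (wprod v) \<star> \<zeta>) (ginv (wprod v) \<cdot> g) w
        \<otimes> \<sigma> (wprod v) (ginv (wprod v) \<cdot> g)) else \<zero>)"
proof -
  let ?p = "wprod v" and ?q = "wprod w"
  let ?\<zeta>' = "ginv ?p \<star> \<zeta>"
  have vw: "set v \<subseteq> carrier G" "set w \<subseteq> carrier G" using v w by auto
  have c: "?p \<in> carrier G" "?q \<in> carrier G" "g \<in> carrier G" "\<zeta> \<subseteq> carrier G"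
    using vw Omega_subset[OF \<zeta>] g by auto
  have sub: "set (pre (v @ w)) \<subseteq> \<zeta> \<longleftrightarrow> set (pre v) \<subseteq> \<zeta> \<and> set (pre w) \<subseteq> ?\<zeta>'"
  proof -
    have "(\<forall>x\<in>set (pre w). ?p \<cdot> x \<in> \<zeta>) \<longleftrightarrow> (\<forall>x\<in>set (pre w). x \<in> ?\<zeta>')"
      using c prefixes_closed[OF vw(2)] by (intro ball_cong) (auto simp: mem_l_coset)
    then show ?thesis unfolding prefixes_append[OF vw] by auto
  qed
  have eq: "?p \<cdot> ?q = g \<longleftrightarrow> ?q = ginv ?p \<cdot> g"
    using c by (metis inv_solve_left)
  show ?thesis
  proof (cases "set (pre v) \<subseteq> \<zeta> \<and> set (pre w) \<subseteq> ?\<zeta>' \<and> ?q = ginv ?p \<cdot> g")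
    case True
    then have "set (pre (v @ w)) \<in> \<Omega>"
      using sub by (intro Omega_mono[OF \<zeta>]) auto
    then show ?thesis
      using True eq weight_append[OF vw] vw c
      by (simp add: path_coeff_def sub word_prod_append[OF vw] weight_closed K.m_assoc)
  next
    case False
    then show ?thesis
      using eq vw c by (auto simp: path_coeff_def sub word_prod_append[OF vw] weight_closed)
  qed
qed

text \<open>The convolution formula of the twisted groupoid algebra: the factorisations of the arrow
  \<open>(\<zeta>, g)\<close> are \<open>(\<zeta>, y)\<close> composed with
  \<open>(inv y \<zeta>, inv y g)\<close>, one for each \<open>y \<in> \<zeta>\<close>.\<close>

lemma arrow_coeff_mult:
  assumes f: "f \<in> carrier F" and f': "f' \<in> carrier F" and \<zeta>: "\<zeta> \<in> \<Omega>" and g: "g \<in> \<zeta>" and fin: "finite \<zeta>"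
  shows "arrow_coeff (f \<otimes>\<^bsub>F\<^esub> f') \<zeta> g = (\<Oplus>y\<in>\<zeta>. arrow_coeff f \<zeta> y \<otimes>
     (arrow_coeff f' (ginv y \<star> \<zeta>) (ginv y \<cdot> g) \<otimes> \<sigma> y (ginv y \<cdot> g)))"
proof -
  note ff = f[unfolded carrier_F] f'[unfolded carrier_F]
  define B where "B y = arrow_coeff f' (ginv y \<star> \<zeta>) (ginv y \<cdot> g) \<otimes> \<sigma> y (ginv y \<cdot> g)" for y
  have \<zeta>c: "\<zeta> \<subseteq> carrier G" "g \<in> carrier G" using Omega_subset[OF \<zeta>] g by auto
  have B: "B y \<in> carrier K" if "y \<in> carrier G" for y
    unfolding B_def using that \<zeta>c f' by (intro K.m_closed arrow_coeff_closed) auto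
  have "arrow_coeff (f \<otimes>\<^bsub>F\<^esub> f') \<zeta> g
     = pairing K f (\<lambda>v. pairing K f' (\<lambda>w. path_coeff \<zeta> g (v @ w)))"
    unfolding arrow_coeff_def using ff
    by (subst Fr.pairing_mult)
       (auto intro!: pairing_cong pairing_closed path_coeff_closed K.r_one simp del: K.r_one)
  \<comment> \<open>For a fixed word \<open>v\<close> at most one summand is nonzero, that of
    \<open>y = wprod v\<close>. Writing it as a sum over \<open>\<zeta>\<close> gives an index set
    independent of \<open>v\<close>, so the sum can be pulled out of the pairing.\<close>
  also have "\<dots> = pairing K f (\<lambda>v. \<Oplus>y\<in>\<zeta>. B y \<otimes> path_coeff \<zeta> y v)"
  proof (rule pairing_cong[OF ff(1)])
    fix v assume v: "v \<in> words"
    let ?p = "wprod v"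
    have pc: "?p \<in> carrier G" and wv: "wt v \<in> carrier K"
      using v weight_closed[of v] word_prod_closed[of v] by (auto simp: in_lists_conv_set subset_iff)
    have Bp: "B y \<otimes> path_coeff \<zeta> y v \<in> carrier K" if "y \<in> \<zeta>" for y
      using B that \<zeta>c v by (intro K.m_closed path_coeff_closed) auto
    then show "(\<Oplus>y\<in>\<zeta>. B y \<otimes> path_coeff \<zeta> y v) \<in> carrier K" by (intro finsum_closed) auto
    show "pairing K f' (\<lambda>w. path_coeff \<zeta> g (v @ w)) = (\<Oplus>y\<in>\<zeta>. B y \<otimes> path_coeff \<zeta> y v)"
    proof (cases "set (pre v) \<subseteq> \<zeta>")
      case False
      have "pairing K f' (\<lambda>w. path_coeff \<zeta> g (v @ w)) = pairing K f' (\<lambda>w. \<zero>)"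
        using False v by (intro pairing_cong[OF ff(2)]) (auto simp: path_coeff_append[OF v _ \<zeta> g])
      also have "\<dots> = \<zero>" by (rule pairing_zero_right[OF ff(2)])
      also have "\<zero> = (\<Oplus>y\<in>\<zeta>. B y \<otimes> path_coeff \<zeta> y v)"
        using False B \<zeta>c by (intro K.add.finprod_one_eqI[symmetric]) (auto simp: path_coeff_def)
      finally show ?thesis .
    next
      case True
      let ?i = "ginv ?p"
      have pz: "?p \<in> \<zeta>" using True word_prod_in_prefixes[of v] by auto
      let ?s = "\<sigma> ?p (?i \<cdot> g)"
      have s: "?s \<in> carrier K" using pc \<zeta>c by simp
      have pcl: "path_coeff (?i \<star> \<zeta>) (?i \<cdot> g) w \<in> carrier K" if "w \<in> words" for w
        using that by (rule path_coeff_closed)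
      have "pairing K f' (\<lambda>w. path_coeff \<zeta> g (v @ w))
         = pairing K f' (\<lambda>w. (wt v \<otimes> ?s) \<otimes> path_coeff (?i \<star> \<zeta>) (?i \<cdot> g) w)"
        using True wv s pcl
        by (intro pairing_cong[OF ff(2)]) (auto simp: path_coeff_append[OF v _ \<zeta> g] K.m_ac)
      also have "\<dots> = (wt v \<otimes> ?s) \<otimes> arrow_coeff f' (?i \<star> \<zeta>) (?i \<cdot> g)"
        unfolding arrow_coeff_def using wv s pcl by (intro pairing_smult_right[OF ff(2)]) auto
      also have "\<dots> = B ?p \<otimes> path_coeff \<zeta> ?p v"
        using True wv s f' by (simp add: B_def path_coeff_def arrow_coeff_closed K.m_ac)
      also have "\<dots> = (\<Oplus>y\<in>\<zeta>. B y \<otimes> path_coeff \<zeta> y v)"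
        using Bp[OF pz] B \<zeta>c by (intro finsum_single[OF fin pz, symmetric]) (auto simp: path_coeff_def)
      finally show ?thesis .
    qed
  qed
  also have "\<dots> = (\<Oplus>y\<in>\<zeta>. pairing K f (\<lambda>v. B y \<otimes> path_coeff \<zeta> y v))"
    using B \<zeta>c by (intro pairing_finsum_right[OF ff(1) fin] K.m_closed path_coeff_closed) auto
  also have "\<dots> = (\<Oplus>y\<in>\<zeta>. arrow_coeff f \<zeta> y \<otimes> B y)"
  proof (rule finsum_cong', simp)
    show "(\<lambda>y. arrow_coeff f \<zeta> y \<otimes> B y) \<in> \<zeta> \<rightarrow> carrier K"
      using B \<zeta>c f by (auto intro!: K.m_closed arrow_coeff_closed)
    fix y assume y: "y \<in> \<zeta>"
    have "pairing K f (\<lambda>v. B y \<otimes> path_coeff \<zeta> y v) = B y \<otimes> arrow_coeff f \<zeta> y"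
      unfolding arrow_coeff_def using B y \<zeta>c by (intro pairing_smult_right[OF ff(1)] path_coeff_closed) auto
    then show "pairing K f (\<lambda>v. B y \<otimes> path_coeff \<zeta> y v) = arrow_coeff f \<zeta> y \<otimes> B y"
      using B y \<zeta>c f by (simp add: K.m_comm arrow_coeff_closed subset_iff)
  qed
  finally show ?thesis by (simp add: B_def)
qed

end

locale finite_spectrum = factor_set_data K G \<sigma>
  for K :: "('k, 'm) ring_scheme" (structure) and G :: "('g, 'n) monoid_scheme" and \<sigma> +
  assumes finite_Omega: "finite \<Omega>" and finite_Omega_member: "\<zeta> \<in> \<Omega> \<Longrightarrow> finite \<zeta>"
begin

text \<open>The kernel of the map to the twisted groupoid algebra, described by coefficients
  alone.\<close>

definition arrow_kernel :: "('g list \<Rightarrow> 'k) set" where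
  "arrow_kernel = {f \<in> carrier F. \<forall>\<zeta>\<in>\<Omega>. \<forall>g\<in>\<zeta>. arrow_coeff f \<zeta> g = \<zero>}"

text \<open>In the convolution formula every summand has a coefficient of \<open>f\<close> as a
  factor. If \<open>f\<close> is the right factor, this coefficient belongs to a translated arrow,
  and by \<open>Omega_translate\<close> it is again one on which \<open>f\<close> vanishes.\<close>

lemma arrow_kernel_ideal: "ideal arrow_kernel F"
proof (rule idealI[OF Fr.ring_A])
  show "subgroup arrow_kernel (add_monoid F)"
  proof (rule Fr.M.add.subgroupI)
    show "arrow_kernel \<noteq> {}" using arrow_coeff_zero Fr.M.zero_closed unfolding arrow_kernel_def by blast
  next
    fix f assume "f \<in> arrow_kernel"
    then show "\<ominus>\<^bsub>F\<^esub> f \<in> arrow_kernel"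
      by (simp add: arrow_kernel_def arrow_coeff_uminus del: Fr.A_simps)
  qed (auto simp: arrow_kernel_def arrow_coeff_add simp del: Fr.A_simps)
next
  fix f x assume f: "f \<in> arrow_kernel" and x: "x \<in> carrier F"
  have fc: "f \<in> carrier F" and fz: "\<And>\<zeta> g. \<zeta> \<in> \<Omega> \<Longrightarrow> g \<in> \<zeta> \<Longrightarrow> arrow_coeff f \<zeta> g = \<zero>"
    using f by (auto simp: arrow_kernel_def)
  have "arrow_coeff (x \<otimes>\<^bsub>F\<^esub> f) \<zeta> g = \<zero>" if \<zeta>: "\<zeta> \<in> \<Omega>" "g \<in> \<zeta>" for \<zeta> g
  proof -
    have "arrow_coeff f (ginv y \<star> \<zeta>) (ginv y \<cdot> g) = \<zero>" if y: "y \<in> \<zeta>" for y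
      using y \<zeta> Omega_subset[OF \<zeta>(1)] Omega_translate[OF \<zeta>(1) y]
      by (intro fz) (auto simp: l_coset_def)
    then show ?thesis
      using Omega_subset[OF \<zeta>(1)] x \<zeta>(2)
      by (subst arrow_coeff_mult[OF x fc \<zeta> finite_Omega_member[OF \<zeta>(1)]])
        (intro K.add.finprod_one_eqI, auto simp: arrow_coeff_closed subset_iff)
  qed
  then show "x \<otimes>\<^bsub>F\<^esub> f \<in> arrow_kernel" using fc x by (auto simp: arrow_kernel_def)
  have "arrow_coeff (f \<otimes>\<^bsub>F\<^esub> x) \<zeta> g = \<zero>" if \<zeta>: "\<zeta> \<in> \<Omega>" "g \<in> \<zeta>" for \<zeta> g
    using Omega_subset[OF \<zeta>(1)] x \<zeta>(2) fz[OF \<zeta>(1)]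
    by (subst arrow_coeff_mult[OF fc x \<zeta> finite_Omega_member[OF \<zeta>(1)]])
      (intro K.add.finprod_one_eqI, auto simp: arrow_coeff_closed subset_iff)
  then show "f \<otimes>\<^bsub>F\<^esub> x \<in> arrow_kernel" using fc x by (auto simp: arrow_kernel_def)
qed

end

section \<open>The kernel of the arrow coefficients\<close>

context finite_spectrum
begin

section \<open>The defining relations have zero arrow coefficients\<close>

lemma single_in_kernel:
  assumes "w \<in> words" "set (pre w) \<notin> \<Omega>"
  shows "single K w \<in> arrow_kernel"
proof -
  have "\<not> set (pre w) \<subseteq> \<zeta>" if "\<zeta> \<in> \<Omega>" for \<zeta>
    using Omega_mono[OF that] assms by auto
  then show ?thesis
    using assms(1) by (auto simp: arrow_kernel_def single_in_F arrow_coeff_single path_coeff_def)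
qed

text \<open>A word acts through its product, its prefix set and its weight, and the weight counts
  only if the prefix set belongs to \<open>\<Omega>\<close>. Each equational relation is checked by
  comparing these three data.\<close>

lemma single_diff_in_kernel:
  assumes w: "v \<in> words" "w \<in> words" and r: "r \<in> carrier K"
    and eq: "wprod v = wprod w" "set (pre v) = set (pre w)"
    and wt: "set (pre w) \<in> \<Omega> \<Longrightarrow> wt v = r \<otimes> wt w"
  shows "single K v \<ominus>\<^bsub>F\<^esub> r \<odot>\<^bsub>F\<^esub> single K w \<in> arrow_kernel"
proof -
  have c: "single K v \<in> carrier F" "r \<odot>\<^bsub>F\<^esub> single K w \<in> carrier F"
    using w r by (auto simp: single_in_F simp del: Fr.A_simps)
  have "arrow_coeff (single K v) \<zeta> g = arrow_coeff (r \<odot>\<^bsub>F\<^esub> single K w) \<zeta> g" if "\<zeta> \<in> \<Omega>" for \<zeta> g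
  proof -
    have "set (pre w) \<subseteq> \<zeta> \<Longrightarrow> set (pre w) \<in> \<Omega>"
      using Omega_mono[OF that] by auto
    then have "path_coeff \<zeta> g v = r \<otimes> path_coeff \<zeta> g w"
      using eq wt r by (auto simp: path_coeff_def)
    then show ?thesis
      using w r by (simp add: arrow_coeff_smult arrow_coeff_single single_in_F del: Fr.A_simps)
  qed
  then show ?thesis
    using c arrow_coeff_closed
    by (auto simp: arrow_kernel_def arrow_coeff_minus a_minus_def[of K] K.r_neg simp del: Fr.A_simps)
qed

lemma single_diff_in_kernel':
  assumes "v \<in> words" "w \<in> words"
    and "wprod v = wprod w" "set (pre v) = set (pre w)"
    and "set (pre w) \<in> \<Omega> \<Longrightarrow> wt v = wt w"
  shows "single K v \<ominus>\<^bsub>F\<^esub> single K w \<in> arrow_kernel"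
  using single_diff_in_kernel[OF assms(1,2) K.one_closed assms(3,4)] assms(2,5)
  by (simp add: Fr.smult_one[OF single_in_F] weight_closed lists_eq_set del: Fr.A_simps)

text \<open>The prefixes 1, \<open>inv g\<close>, \<open>h\<close> form the translate by
  \<open>inv g\<close> of the prohibition \<open>{1, g, g h}\<close>.\<close>

lemma rel_a_in_kernel:
  assumes "g \<in> carrier G" "h \<in> carrier G" "\<sigma> g h = \<zero>"
  shows "single K [ginv g] \<otimes>\<^bsub>F\<^esub> single K [g \<cdot> h] \<in> arrow_kernel"
proof -
  let ?w = "[ginv g, g \<cdot> h]"
  have "set (pre ?w) \<notin> \<Omega>"
  proof
    assume Z: "set (pre ?w) \<in> \<Omega>"
    have "\<sigma> g h \<noteq> \<zero>"
      using assms(1,2) by (intro sigma_nonzero_at[OF Z, of "ginv g"]) (auto simp: m_assoc[symmetric])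
    with assms show False by simp
  qed
  with assms show ?thesis by (simp add: single_append single_in_kernel del: prefixes.simps)
qed

lemma rel_b_in_kernel:
  assumes "g \<in> carrier G" "h \<in> carrier G" "\<sigma> g h = \<zero>"
  shows "single K [g \<cdot> h] \<otimes>\<^bsub>F\<^esub> single K [ginv h] \<in> arrow_kernel"
proof -
  let ?w = "[g \<cdot> h, ginv h]"
  have "set (pre ?w) \<notin> \<Omega>"
  proof
    assume Z: "set (pre ?w) \<in> \<Omega>"
    have "\<sigma> g h \<noteq> \<zero>"
      using assms(1,2) by (intro sigma_nonzero[OF Z]) (auto simp: m_assoc)
    with assms show False by simp
  qed
  with assms show ?thesis by (simp add: single_append single_in_kernel del: prefixes.simps)
qed

lemma rel_c_in_kernel:
  assumes "g \<in> carrier G" "h \<in> carrier G"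
  shows "single K [ginv g] \<otimes>\<^bsub>F\<^esub> single K [g] \<otimes>\<^bsub>F\<^esub> single K [h]
         \<ominus>\<^bsub>F\<^esub> \<sigma> g h \<odot>\<^bsub>F\<^esub> (single K [ginv g] \<otimes>\<^bsub>F\<^esub> single K [g \<cdot> h]) \<in> arrow_kernel"
proof -
  let ?v = "[ginv g, g, h]" and ?w = "[ginv g, g \<cdot> h]"
  have ig: "ginv g \<cdot> (g \<cdot> h) = h" using assms by (simp add: m_assoc[symmetric])
  have "single K ?v \<ominus>\<^bsub>F\<^esub> \<sigma> g h \<odot>\<^bsub>F\<^esub> single K ?w \<in> arrow_kernel"
  proof (rule single_diff_in_kernel)
    show "set (pre ?v) = set (pre ?w)" using assms ig by auto
    assume Z: "set (pre ?w) \<in> \<Omega>"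
    have "\<sigma> h \<epsilon> = \<one>" using assms ig by (intro sigma_one_right[OF Z]) auto
    \<comment> \<open>\<open>g h\<close> need not be a prefix of the word, but it lies in the
      translate of the prefix set by \<open>g\<close>, again a member of
      \<open>\<Omega>\<close>.\<close>
    moreover have "\<sigma> (g \<cdot> h) \<epsilon> = \<one>"
      using assms by (intro sigma_one_right[OF Omega_translate[OF Z, of "ginv g"]]) (auto simp: l_coset_def ig intro!: exI[of _ h])
    ultimately show "wt ?v = \<sigma> g h \<otimes> wt ?w"
      using assms by (simp add: K.m_comm)
  qed (use assms ig in auto)
  with assms show ?thesis by (simp add: single_append del: Fr.A_simps)
qed

lemma rel_d_in_kernel:
  assumes "g \<in> carrier G" "h \<in> carrier G"
  shows "single K [g] \<otimes>\<^bsub>F\<^esub> single K [h] \<otimes>\<^bsub>F\<^esub> single K [ginv h]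
         \<ominus>\<^bsub>F\<^esub> \<sigma> g h \<odot>\<^bsub>F\<^esub> (single K [g \<cdot> h] \<otimes>\<^bsub>F\<^esub> single K [ginv h]) \<in> arrow_kernel"
proof -
  let ?v = "[g, h, ginv h]" and ?w = "[g \<cdot> h, ginv h]"
  have ih: "g \<cdot> h \<cdot> ginv h = g" using assms by (simp add: m_assoc)
  have "single K ?v \<ominus>\<^bsub>F\<^esub> \<sigma> g h \<odot>\<^bsub>F\<^esub> single K ?w \<in> arrow_kernel"
  proof (rule single_diff_in_kernel)
    show "set (pre ?v) = set (pre ?w)" using assms ih by auto
    assume Z: "set (pre ?w) \<in> \<Omega>"
    \<comment> \<open>The last factor \<open>\<sigma> (inv h) 1\<close> is common to both weights;
      the remaining factors are compared by the cocycle identity at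
      \<open>(g, h, inv h)\<close>.\<close>
    have "\<sigma> g (h \<cdot> ginv h) \<otimes> \<sigma> h (ginv h) = \<sigma> g h \<otimes> \<sigma> (g \<cdot> h) (ginv h)"
      using assms ih by (intro sigma_cocycle[OF Z]) auto
    then have "\<sigma> g \<epsilon> \<otimes> \<sigma> h (ginv h) = \<sigma> g h \<otimes> \<sigma> (g \<cdot> h) (ginv h)"
      using assms by simp
    then show "wt ?v = \<sigma> g h \<otimes> wt ?w"
      using assms by (simp add: K.m_assoc[symmetric])
  qed (use assms ih in auto)
  with assms show ?thesis by (simp add: single_append del: Fr.A_simps)
qed

lemma rel_e_in_kernel:
  assumes "g \<in> carrier G"
  shows "single K [g] \<otimes>\<^bsub>F\<^esub> single K [\<epsilon>] \<ominus>\<^bsub>F\<^esub> single K [g] \<in> arrow_kernel"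
proof -
  have "single K [g, \<epsilon>] \<ominus>\<^bsub>F\<^esub> single K [g] \<in> arrow_kernel"
    using assms by (intro single_diff_in_kernel') (auto simp: sigma_one_one)
  with assms show ?thesis by (simp add: single_append del: Fr.A_simps)
qed

lemma rel_f_in_kernel:
  assumes "g \<in> carrier G"
  shows "single K [\<epsilon>] \<otimes>\<^bsub>F\<^esub> single K [g] \<ominus>\<^bsub>F\<^esub> single K [g] \<in> arrow_kernel"
proof -
  have "single K [\<epsilon>, g] \<ominus>\<^bsub>F\<^esub> single K [g] \<in> arrow_kernel"
  proof (rule single_diff_in_kernel')
    assume Z: "set (pre [g]) \<in> \<Omega>"
    have "\<sigma> \<epsilon> g = \<one>" using assms by (intro sigma_one_left[OF Z]) auto
    then show "wt [\<epsilon>, g] = wt [g]" using assms by simp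
  qed (use assms in auto)
  with assms show ?thesis by (simp add: single_append del: Fr.A_simps)
qed

lemma rel_g_in_kernel:
  shows "single K [\<epsilon>] \<ominus>\<^bsub>F\<^esub> \<one>\<^bsub>F\<^esub> \<in> arrow_kernel"
proof -
  have "single K [\<epsilon>] \<ominus>\<^bsub>F\<^esub> single K [] \<in> arrow_kernel"
    by (intro single_diff_in_kernel') (auto simp: sigma_one_one)
  then show ?thesis by (simp add: one_F del: Fr.A_simps)
qed

abbreviation "rels \<equiv> par_relations K G \<sigma>"

lemma rels_unfold: "rels =
      {single K [ginv g] \<otimes>\<^bsub>F\<^esub> single K [g \<cdot> h] |
         g h. g \<in> carrier G \<and> h \<in> carrier G \<and> \<sigma> g h = \<zero>} \<union>
      {single K [g \<cdot> h] \<otimes>\<^bsub>F\<^esub> single K [ginv h] |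
         g h. g \<in> carrier G \<and> h \<in> carrier G \<and> \<sigma> g h = \<zero>} \<union>
      {single K [ginv g] \<otimes>\<^bsub>F\<^esub> single K [g] \<otimes>\<^bsub>F\<^esub> single K [h]
         \<ominus>\<^bsub>F\<^esub> \<sigma> g h \<odot>\<^bsub>F\<^esub> (single K [ginv g] \<otimes>\<^bsub>F\<^esub> single K [g \<cdot> h]) |
         g h. g \<in> carrier G \<and> h \<in> carrier G} \<union>
      {single K [g] \<otimes>\<^bsub>F\<^esub> single K [h] \<otimes>\<^bsub>F\<^esub> single K [ginv h]
         \<ominus>\<^bsub>F\<^esub> \<sigma> g h \<odot>\<^bsub>F\<^esub> (single K [g \<cdot> h] \<otimes>\<^bsub>F\<^esub> single K [ginv h]) |
         g h. g \<in> carrier G \<and> h \<in> carrier G} \<union>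
      {single K [g] \<otimes>\<^bsub>F\<^esub> single K [\<epsilon>] \<ominus>\<^bsub>F\<^esub> single K [g] | g. g \<in> carrier G} \<union>
      {single K [\<epsilon>] \<otimes>\<^bsub>F\<^esub> single K [g] \<ominus>\<^bsub>F\<^esub> single K [g] | g. g \<in> carrier G} \<union>
      {single K [\<epsilon>] \<ominus>\<^bsub>F\<^esub> \<one>\<^bsub>F\<^esub>}"
  unfolding par_relations_def Let_def free_algebra_def free_gen_eq_single ..

lemma rels_in_kernel: "rels \<subseteq> arrow_kernel"
  unfolding rels_unfold
  apply (intro Un_least subsetI; (elim CollectE exE conjE)?)
  subgoal by (hypsubst, rule rel_a_in_kernel)
  subgoal by (hypsubst, rule rel_b_in_kernel)
  subgoal by (hypsubst, rule rel_c_in_kernel)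
  subgoal by (hypsubst, rule rel_d_in_kernel)
  subgoal by (hypsubst, rule rel_e_in_kernel)
  subgoal by (hypsubst, rule rel_f_in_kernel)
  subgoal by (drule singletonD, hypsubst, rule rel_g_in_kernel)
  done

lemma in_rels:
  "g \<in> carrier G \<Longrightarrow> h \<in> carrier G \<Longrightarrow> \<sigma> g h = \<zero> \<Longrightarrow>
     single K [ginv g] \<otimes>\<^bsub>F\<^esub> single K [g \<cdot> h] \<in> rels"
  "g \<in> carrier G \<Longrightarrow> h \<in> carrier G \<Longrightarrow> \<sigma> g h = \<zero> \<Longrightarrow>
     single K [g \<cdot> h] \<otimes>\<^bsub>F\<^esub> single K [ginv h] \<in> rels"
  "g \<in> carrier G \<Longrightarrow> h \<in> carrier G \<Longrightarrow>
     single K [ginv g] \<otimes>\<^bsub>F\<^esub> single K [g] \<otimes>\<^bsub>F\<^esub> single K [h]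
         \<ominus>\<^bsub>F\<^esub> \<sigma> g h \<odot>\<^bsub>F\<^esub> (single K [ginv g] \<otimes>\<^bsub>F\<^esub> single K [g \<cdot> h]) \<in> rels"
  "g \<in> carrier G \<Longrightarrow> h \<in> carrier G \<Longrightarrow>
     single K [g] \<otimes>\<^bsub>F\<^esub> single K [h] \<otimes>\<^bsub>F\<^esub> single K [ginv h]
         \<ominus>\<^bsub>F\<^esub> \<sigma> g h \<odot>\<^bsub>F\<^esub> (single K [g \<cdot> h] \<otimes>\<^bsub>F\<^esub> single K [ginv h]) \<in> rels"
  "single K [\<epsilon>] \<ominus>\<^bsub>F\<^esub> \<one>\<^bsub>F\<^esub> \<in> rels"
  unfolding rels_unfold
  subgoal by (rule UnI1, rule UnI1, rule UnI1, rule UnI1, rule UnI1, rule UnI1, intro CollectI exI[of _ g] exI[of _ h] conjI refl)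
  subgoal by (rule UnI1, rule UnI1, rule UnI1, rule UnI1, rule UnI1, rule UnI2, intro CollectI exI[of _ g] exI[of _ h] conjI refl)
  subgoal by (rule UnI1, rule UnI1, rule UnI1, rule UnI1, rule UnI2, intro CollectI exI[of _ g] exI[of _ h] conjI refl)
  subgoal by (rule UnI1, rule UnI1, rule UnI1, rule UnI2, intro CollectI exI[of _ g] exI[of _ h] conjI refl)
  subgoal by (rule UnI2, rule singletonI)
  done

section \<open>The quotient by the relations and the classes of words in it\<close>

abbreviation "relI \<equiv> Idl\<^bsub>F\<^esub> rels"

lemma rels_carrier: "rels \<subseteq> carrier F"
  using rels_in_kernel by (auto simp: arrow_kernel_def)

lemma relI_ideal: "ideal relI F"
  by (rule Fr.genideal_ideal[OF rels_carrier])

lemma relI_in_kernel: "relI \<subseteq> arrow_kernel"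
  by (rule Fr.genideal_minimal[OF arrow_kernel_ideal rels_in_kernel])

lemma rels_in_relI: "x \<in> rels \<Longrightarrow> x \<in> relI"
  using Fr.genideal_self[OF rels_carrier] by auto

sublocale Q: algebra_ideal K F relI
  by (intro algebra_ideal.intro Fr.unital_algebra_A relI_ideal)

sublocale Q: unital_algebra K "quotient_algebra F relI"
  by (rule Q.unital_algebra_Q)

abbreviation "gen g \<equiv> relI +>\<^bsub>F\<^esub> single K [g]"

lemma rcos_eqI:
  assumes "a \<ominus>\<^bsub>F\<^esub> b \<in> rels" "a \<in> carrier F" "b \<in> carrier F"
  shows "relI +>\<^bsub>F\<^esub> a = relI +>\<^bsub>F\<^esub> b"
  using Fr.quotient_eq_iff_same_a_r_cos[OF relI_ideal assms(2,3)] rels_in_relI[OF assms(1)] by simp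

lemma gen_relations: "par_relations_algebra Q.Q K G \<sigma> gen"
proof -
  let ?b = "\<lambda>g. single K [g]"
  have b: "?b g \<in> carrier F" if "g \<in> carrier G" for g using that by (simp add: single_in_F)
  have u_closed: "gen g \<in> carrier Q.Q" if "g \<in> carrier G" for g
    using b[OF that] by (auto simp: Q.carrier_Q)
  have u_one: "gen \<epsilon> = \<one>\<^bsub>Q.Q\<^esub>"
    unfolding Q.rcos_one by (rule rcos_eqI[OF in_rels(5)]) (simp_all add: b)
  have zl: "gen (ginv g) \<otimes>\<^bsub>Q.Q\<^esub> gen (g \<cdot> h) = \<zero>\<^bsub>Q.Q\<^esub>"
    if "g \<in> carrier G" "h \<in> carrier G" "\<sigma> g h = \<zero>" for g h
  proof -
    have "?b (ginv g) \<otimes>\<^bsub>F\<^esub> ?b (g \<cdot> h) \<in> rels" using that by (intro in_rels)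
    then show ?thesis using that b rels_in_relI by (simp add: Q.rcos_mult Q.rcos_eq_zero)
  qed
  have zr: "gen (g \<cdot> h) \<otimes>\<^bsub>Q.Q\<^esub> gen (ginv h) = \<zero>\<^bsub>Q.Q\<^esub>"
    if "g \<in> carrier G" "h \<in> carrier G" "\<sigma> g h = \<zero>" for g h
  proof -
    have "?b (g \<cdot> h) \<otimes>\<^bsub>F\<^esub> ?b (ginv h) \<in> rels" using that by (intro in_rels)
    then show ?thesis using that b rels_in_relI by (simp add: Q.rcos_mult Q.rcos_eq_zero)
  qed
  have ml: "gen (ginv g) \<otimes>\<^bsub>Q.Q\<^esub> gen g \<otimes>\<^bsub>Q.Q\<^esub> gen h
     = \<sigma> g h \<odot>\<^bsub>Q.Q\<^esub> (gen (ginv g) \<otimes>\<^bsub>Q.Q\<^esub> gen (g \<cdot> h))"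
    if "g \<in> carrier G" "h \<in> carrier G" for g h
  proof -
    have "?b (ginv g) \<otimes>\<^bsub>F\<^esub> ?b g \<otimes>\<^bsub>F\<^esub> ?b h
         \<ominus>\<^bsub>F\<^esub> \<sigma> g h \<odot>\<^bsub>F\<^esub> (?b (ginv g) \<otimes>\<^bsub>F\<^esub> ?b (g \<cdot> h)) \<in> rels"
      using that by (intro in_rels)
    from rcos_eqI[OF this] show ?thesis
      using that b by (simp add: Q.rcos_mult Q.rcos_smult del: Fr.A_simps)
  qed
  have mr: "gen g \<otimes>\<^bsub>Q.Q\<^esub> gen h \<otimes>\<^bsub>Q.Q\<^esub> gen (ginv h)
     = \<sigma> g h \<odot>\<^bsub>Q.Q\<^esub> (gen (g \<cdot> h) \<otimes>\<^bsub>Q.Q\<^esub> gen (ginv h))"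
    if "g \<in> carrier G" "h \<in> carrier G" for g h
  proof -
    have "?b g \<otimes>\<^bsub>F\<^esub> ?b h \<otimes>\<^bsub>F\<^esub> ?b (ginv h)
         \<ominus>\<^bsub>F\<^esub> \<sigma> g h \<odot>\<^bsub>F\<^esub> (?b (g \<cdot> h) \<otimes>\<^bsub>F\<^esub> ?b (ginv h)) \<in> rels"
      using that by (intro in_rels)
    from rcos_eqI[OF this] show ?thesis
      using that b by (simp add: Q.rcos_mult Q.rcos_smult del: Fr.A_simps)
  qed
  show ?thesis
    by (intro par_relations_algebra.intro par_relations_algebra_axioms.intro Q.ring_axioms
        K.field_axioms G.is_group Q.unital_algebra_axioms sigma_closed u_closed u_one zl zr ml mr)
qed

sublocale U: par_relations_algebra "Q.Q" K G \<sigma> gen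
  by (rule gen_relations)

lemma rcos_word:
  "w \<in> words \<Longrightarrow> relI +>\<^bsub>F\<^esub> single K w =
    foldr (\<lambda>g x. gen g \<otimes>\<^bsub>Q.Q\<^esub> x) w \<one>\<^bsub>Q.Q\<^esub>"
proof (induction w)
  case Nil
  then show ?case by (simp add: Q.rcos_one one_F)
next
  case (Cons g w)
  then have "relI +>\<^bsub>F\<^esub> single K (g # w) = relI +>\<^bsub>F\<^esub> (single K [g] \<otimes>\<^bsub>F\<^esub> single K w)"
    by (simp add: single_append)
  also have "\<dots> = gen g \<otimes>\<^bsub>Q.Q\<^esub> (relI +>\<^bsub>F\<^esub> single K w)"
    using Cons.prems by (intro Q.rcos_mult[symmetric] single_in_F) auto
  finally show ?case using Cons by simp
qed

lemma rcos_word_eq: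
  "w \<in> words \<Longrightarrow> relI +>\<^bsub>F\<^esub> single K w = wt w \<odot>\<^bsub>Q.Q\<^esub>
    (U.eprod (pre w) \<otimes>\<^bsub>Q.Q\<^esub> gen (wprod w))"
  unfolding rcos_word by (rule U.u_word(1)) auto

text \<open>The prefix set contains 1 and lies in the group, so it can only fail to be in
  \<open>\<Omega>\<close> by containing a prohibition, which kills the idempotent factor of the
  word.\<close>

lemma word_in_relI:
  assumes "w \<in> words" "set (pre w) \<notin> \<Omega>"
  shows "single K w \<in> relI"
proof -
  have w: "set (pre w) \<subseteq> carrier G" using assms(1) by (intro prefixes_closed) auto
  then obtain V where "V \<in> prohibitions K G \<sigma>" "V \<subseteq> set (pre w)"
    using assms(2) by (auto simp: Omega_sigma_def Omega_def)
  then have "U.eprod (pre w) = \<zero>\<^bsub>Q.Q\<^esub>" by (rule U.eprod_prohibition[OF _ _ w])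
  moreover have ws: "set w \<subseteq> carrier G" using assms(1) by auto
  note Q.l_null[OF U.u_closed[OF word_prod_closed[OF ws]]] Q.smult_r_null[OF weight_closed[OF ws]]
  ultimately have "relI +>\<^bsub>F\<^esub> single K w = \<zero>\<^bsub>Q.Q\<^esub>"
    by (simp only: rcos_word_eq[OF assms(1)])
  then show ?thesis by (simp only: Q.rcos_eq_zero[OF single_in_F[OF assms(1)]])
qed

text \<open>Modulo the relations a word is its weight times an element determined by its prefix set
  and its product.\<close>

lemma word_diff_in_relI:
  assumes w: "v \<in> words" "w \<in> words" and eq: "set (pre v) = set (pre w)" "wprod v = wprod w"
    and r: "r \<in> carrier K" "wt v = r \<otimes> wt w"
  shows "single K v \<ominus>\<^bsub>F\<^esub> r \<odot>\<^bsub>F\<^esub> single K w \<in> relI"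
proof -
  have ws: "set v \<subseteq> carrier G" "set w \<subseteq> carrier G" using w by auto
  let ?x = "U.eprod (pre w) \<otimes>\<^bsub>Q.Q\<^esub> gen (wprod w)"
  have x: "?x \<in> carrier Q.Q"
    by (intro Q.m_closed U.eprod_closed U.u_closed prefixes_closed word_prod_closed ws)
  have "U.eprod (pre v) = U.eprod (pre w)"
    by (rule U.eprod_cong[OF eq(1) prefixes_closed[OF ws(2)]])
  then have "relI +>\<^bsub>F\<^esub> single K v = (r \<otimes> wt w) \<odot>\<^bsub>Q.Q\<^esub> ?x"
    by (simp only: rcos_word_eq[OF w(1)] eq(2) r(2))
  also have "\<dots> = r \<odot>\<^bsub>Q.Q\<^esub> (relI +>\<^bsub>F\<^esub> single K w)"
    by (simp only: Q.smult_assoc1[OF r(1) weight_closed[OF ws(2)] x] rcos_word_eq[OF w(2)])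
  also have "\<dots> = relI +>\<^bsub>F\<^esub> (r \<odot>\<^bsub>F\<^esub> single K w)"
    by (rule Q.rcos_smult[OF r(1) single_in_F[OF w(2)]])
  finally show ?thesis
    by (simp only: Fr.quotient_eq_iff_same_a_r_cos[OF relI_ideal single_in_F[OF w(1)]
          Fr.smult_closed[OF r(1) single_in_F[OF w(2)]]])
qed


section \<open>Relations exhaust the kernel, and all coefficients are attained\<close>

lemma minus_F_apply:
  assumes "a \<in> carrier F" "b \<in> carrier F"
  shows "(a \<ominus>\<^bsub>F\<^esub> b) x = a x \<ominus> b x"
proof -
  have c: "\<ominus>\<^bsub>F\<^esub> b \<in> carrier F" using assms(2) by (rule Fr.M.a_inv_closed)
  have "(\<ominus>\<^bsub>F\<^esub> b) x \<oplus> b x = \<zero>"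
    using fun_cong[OF Fr.M.l_neg[OF assms(2)], of x] by simp
  then have "(\<ominus>\<^bsub>F\<^esub> b) x = \<ominus> b x"
    using K.minus_equality finsupp_closed assms(2) c unfolding carrier_F by metis
  then show ?thesis by (simp add: a_minus_def)
qed

lemma inverse_scalar:
  assumes "a \<in> carrier K" "a \<noteq> \<zero>"
  shows "inv a \<in> carrier K" "a \<otimes> inv a = \<one>" "inv a \<otimes> a = \<one>"
  using assms by (auto simp: K.field_Units intro: K.Units_r_inv K.Units_l_inv)

text \<open>If the prefix set \<open>Z\<close> of \<open>w\<close> is not in
  \<open>\<Omega>\<close>, the word itself serves as \<open>d\<close>. Otherwise consider the
  coefficient of \<open>f\<close> at the arrow \<open>(Z, wprod w)\<close>: a contributing word has
  its prefixes in \<open>Z\<close>, hence prefix set \<open>Z\<close> by minimality. As the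
  coefficient is zero and \<open>w\<close> contributes a nonzero term, another word \<open>v\<close>
  of the support has the same prefix set and product, and \<open>d\<close> is \<open>w\<close> minus
  a multiple of \<open>v\<close>.\<close>

lemma exists_relation:
  assumes f: "f \<in> arrow_kernel" and w: "f w \<noteq> \<zero>"
    and min: "\<And>v. f v \<noteq> \<zero> \<Longrightarrow> card (set (pre w)) \<le> card (set (pre v))"
  shows "\<exists>d\<in>relI. d w = \<one> \<and> (\<forall>v. f v = \<zero> \<longrightarrow> d v = \<zero>)"
proof (cases "set (pre w) \<in> \<Omega>")
  have fs: "f \<in> finsupp K words" using f by (simp add: arrow_kernel_def carrier_F)
  then have ww: "w \<in> words" using w finsupp_supp[OF fs] by auto
  case False
  then show ?thesis using word_in_relI[OF ww] w by (intro bexI[of _ "single K w"]) (auto simp: single_def)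
next
  have fs: "f \<in> finsupp K words" using f by (simp add: arrow_kernel_def carrier_F)
  then have ww: "w \<in> words" using w finsupp_supp[OF fs] by auto
  case True
  let ?Z = "set (pre w)" and ?g = "wprod w" and ?c = "wt w"
  have c: "?c \<in> carrier K" "?c \<noteq> \<zero>"
    using ww weight_nonzero[OF _ True] weight_closed[of w] by (auto simp: in_lists_conv_set subset_iff)
  have "\<exists>v. f v \<noteq> \<zero> \<and> v \<noteq> w \<and> set (pre v) = ?Z \<and> wprod v = ?g"
  proof (rule ccontr)
    assume no: "\<not> ?thesis"
    have "arrow_coeff f ?Z ?g = pairing K f (\<lambda>v. if v = w then ?c else \<zero>)"
      unfolding arrow_coeff_def
    proof (rule pairing_cong_supp[OF fs])
      fix v assume v: "v \<in> words" "f v \<noteq> \<zero>"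
      have "set (pre v) \<subseteq> ?Z \<Longrightarrow> set (pre v) = ?Z"
        using min[OF v(2)] by (intro card_seteq) auto
      then show "path_coeff ?Z ?g v = (if v = w then ?c else \<zero>)"
        using no v by (auto simp: path_coeff_def)
    qed (use c in auto)
    also have "\<dots> = f w \<otimes> ?c" using c ww by (intro pairing_indicator[OF fs]) auto
    finally have "f w \<otimes> ?c = \<zero>"
      using f True word_prod_in_prefixes[of w] by (simp add: arrow_kernel_def)
    then show False using w c finsupp_closed[OF fs] by (simp add: K.integral_iff)
  qed
  then obtain v where v: "f v \<noteq> \<zero>" "v \<noteq> w" "set (pre v) = ?Z" "wprod v = ?g" by blast
  have vw: "v \<in> words" using v(1) finsupp_supp[OF fs] by auto
  let ?d = "wt v"
  have d: "?d \<in> carrier K" "?d \<noteq> \<zero>"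
    using vw weight_nonzero[of v] weight_closed[of v] True v(3) by (auto simp: in_lists_conv_set subset_iff)
  note i = inverse_scalar[OF d]
  \<comment> \<open>The ratio of the two weights, which makes \<open>w\<close> and \<open>?r\<close>
    times \<open>v\<close> equal modulo the relations.\<close>
  let ?r = "?c \<otimes> inv ?d"
  have r: "?r \<in> carrier K" "?c = ?r \<otimes> ?d" using c d i by (auto simp: K.m_assoc)
  have "single K w \<ominus>\<^bsub>F\<^esub> ?r \<odot>\<^bsub>F\<^esub> single K v \<in> relI"
    using v by (intro word_diff_in_relI ww vw r) auto
  moreover have "(single K w \<ominus>\<^bsub>F\<^esub> ?r \<odot>\<^bsub>F\<^esub> single K v) x = single K w x \<ominus> ?r \<otimes> single K v x" for x
    using r ww vw Fr.smult_closed[OF r(1) single_in_F[OF vw]] by (subst minus_F_apply) (auto simp: single_in_F)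
  ultimately show ?thesis
    using v w r by (intro bexI[of _ "single K w \<ominus>\<^bsub>F\<^esub> ?r \<odot>\<^bsub>F\<^esub> single K v"])
      (auto simp: single_def a_minus_def simp del: Fr.A_simps)
qed

text \<open>Induction on the size of the support: subtracting \<open>f w\<close> times the relation
  from \<open>exists_relation\<close> removes \<open>w\<close> and brings in no new word.\<close>

lemma kernel_in_relI: "f \<in> arrow_kernel \<Longrightarrow> f \<in> relI"
proof (induction "card {w. f w \<noteq> \<zero>}" arbitrary: f rule: less_induct)
  case less
  have fc: "f \<in> carrier F" using less.prems by (simp add: arrow_kernel_def)
  then have fs: "f \<in> finsupp K words" by (simp add: carrier_F)
  note I = ideal.axioms(1)[OF relI_ideal] and J = ideal.axioms(1)[OF arrow_kernel_ideal]
  show ?case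
  proof (cases "\<exists>w. f w \<noteq> \<zero>")
    case False
    then have "f = \<zero>\<^bsub>F\<^esub>" by auto
    then show ?thesis using additive_subgroup.zero_closed[OF I] by (simp only:)
  next
    case True
    then obtain w where w: "f w \<noteq> \<zero>"
        "\<And>v. f v \<noteq> \<zero> \<Longrightarrow> card (set (pre w)) \<le> card (set (pre v))"
      using ex_has_least_nat[of "\<lambda>w. f w \<noteq> \<zero>" _ "\<lambda>w. card (set (pre w))"] by blast
    obtain d where d: "d \<in> relI" "d w = \<one>" "\<And>v. f v = \<zero> \<Longrightarrow> d v = \<zero>"
      using exists_relation[OF less.prems w] by blast
    let ?s = "f w \<odot>\<^bsub>F\<^esub> d"
    let ?f = "f \<ominus>\<^bsub>F\<^esub> ?s"
    have wc: "f w \<in> carrier K" using finsupp_closed[OF fs] .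
    have s: "?s \<in> relI" by (rule Q.ideal_smult[OF wc d(1)])
    then have sc: "?s \<in> carrier F" "?s \<in> arrow_kernel" using relI_in_kernel ideal.Icarr[OF relI_ideal] by auto
    have app: "?f x = f x \<ominus> f w \<otimes> d x" for x
      using minus_F_apply[OF fc sc(1), of x] by simp
    have "?f \<in> arrow_kernel"
      unfolding a_minus_def by (intro additive_subgroup.a_closed[OF J] less.prems additive_subgroup.a_inv_closed[OF J] sc)
    moreover have "{v. ?f v \<noteq> \<zero>} \<subset> {v. f v \<noteq> \<zero>}"
    proof
      show "{v. ?f v \<noteq> \<zero>} \<subseteq> {v. f v \<noteq> \<zero>}"
        unfolding app using d(3) wc by (auto simp: a_minus_def)
      have "?f w = \<zero>" unfolding app using d(2) wc by (simp add: a_minus_def K.r_neg)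
      with w(1) show "{v. ?f v \<noteq> \<zero>} \<noteq> {v. f v \<noteq> \<zero>}" by blast
    qed
    then have "card {v. ?f v \<noteq> \<zero>} < card {v. f v \<noteq> \<zero>}"
      by (intro psubset_card_mono finsupp_finite[OF fs])
    ultimately have "?f \<in> relI" by (intro less.hyps)
    then have "?f \<oplus>\<^bsub>F\<^esub> ?s \<in> relI" using s by (rule additive_subgroup.a_closed[OF I])
    moreover have "?f \<oplus>\<^bsub>F\<^esub> ?s = f"
      using fc sc(1) by (simp only: a_minus_def Fr.M.a_assoc Fr.M.a_inv_closed Fr.M.l_neg Fr.M.r_zero)
    ultimately show ?thesis by (simp only:)
  qed
qed

lemma relI_eq_kernel: "relI = arrow_kernel"
  using relI_in_kernel kernel_in_relI by auto

text \<open>Triangular elimination. A word with prefix set \<open>\<xi>\<close> and product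
  \<open>g\<close> has coefficient \<open>wt w\<close> at \<open>(\<zeta>, g)\<close> for all
  \<open>\<zeta>\<close> that contain \<open>\<xi>\<close>, and zero elsewhere. With
  \<open>\<xi>\<close> of least cardinality, its multiple settles the pair \<open>(\<xi>, g)\<close>
  and disturbs only pairs that up-closedness keeps in \<open>Y\<close>.\<close>

lemma arrow_coeff_surj_upclosed:
  assumes "finite Y" "Y \<subseteq> Sigma \<Omega> id"
    and "\<And>\<xi> \<zeta> g. (\<xi>, g) \<in> Y \<Longrightarrow> \<zeta> \<in> \<Omega> \<Longrightarrow> \<xi> \<subseteq> \<zeta> \<Longrightarrow> (\<zeta>, g) \<in> Y"
    and "\<And>\<zeta> g. \<zeta> \<in> \<Omega> \<Longrightarrow> g \<in> \<zeta> \<Longrightarrow> V \<zeta> g \<in> carrier K"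
    and "\<And>\<zeta> g. \<zeta> \<in> \<Omega> \<Longrightarrow> g \<in> \<zeta> \<Longrightarrow> (\<zeta>, g) \<notin> Y \<Longrightarrow> V \<zeta> g = \<zero>"
  shows "\<exists>f\<in>carrier F. \<forall>\<zeta>\<in>\<Omega>. \<forall>g\<in>\<zeta>. arrow_coeff f \<zeta> g = V \<zeta> g"
  using assms
proof (induction "card Y" arbitrary: Y V rule: less_induct)
  case (less Y V)
  note Y = less.prems(1,2) and up = less.prems(3) and Vc = less.prems(4) and V0 = less.prems(5)
  show ?case
  proof (cases "Y = {}")
    case True
    then show ?thesis
      using V0 arrow_coeff_zero by (intro bexI[of _ "\<zero>\<^bsub>F\<^esub>"]) (auto simp del: Fr.A_simps)
  next
    case False
    then obtain p where "p \<in> Y" "\<And>q. q \<in> Y \<Longrightarrow> card (fst p) \<le> card (fst q)"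
      using ex_has_least_nat[of "\<lambda>p. p \<in> Y" _ "\<lambda>p. card (fst p)"] by blast
    then obtain \<xi> g where p: "(\<xi>, g) \<in> Y" and min: "\<And>\<zeta> h. (\<zeta>, h) \<in> Y \<Longrightarrow> card \<xi> \<le> card \<zeta>"
      by (cases p) fastforce
    have \<xi>: "\<xi> \<in> \<Omega>" "g \<in> \<xi>" using p Y by auto
    obtain w where w: "set w \<subseteq> carrier G" "wprod w = g" "set (pre w) = \<xi>"
      using exists_word[OF finite_Omega_member[OF \<xi>(1)] Omega_subset[OF \<xi>(1)]] Omega_subset[OF \<xi>(1)] \<xi>
        Omega_one[OF \<xi>(1)] by (metis insert_absorb subsetD)
    then have ww: "w \<in> words" by auto
    let ?c = "wt w"
    have c: "?c \<in> carrier K" "?c \<noteq> \<zero>" using weight_closed[OF w(1)] weight_nonzero[OF w(1)] w(3) \<xi> by auto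
    note i = inverse_scalar[OF c]
    let ?v = "V \<xi> g"
    have v: "?v \<in> carrier K" using Vc \<xi> by auto
    \<comment> \<open>What remains to be realised after the word \<open>w\<close>, scaled to have
      coefficient \<open>V \<xi> g\<close>, is taken away.\<close>
    let ?V = "\<lambda>\<zeta> h. V \<zeta> h \<ominus> (if h = g \<and> \<xi> \<subseteq> \<zeta> then ?v else \<zero>)"
    let ?Y = "Y - {(\<xi>, g)}"
    have "\<exists>f\<in>carrier F. \<forall>\<zeta>\<in>\<Omega>. \<forall>g\<in>\<zeta>. arrow_coeff f \<zeta> g = ?V \<zeta> g"
    proof (rule less.hyps)
      show "card ?Y < card Y" using p Y by (meson card_Diff1_less)
      show "finite ?Y" "?Y \<subseteq> Sigma \<Omega> id" using Y by auto
    next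
      fix \<zeta>' \<zeta> h assume a: "(\<zeta>', h) \<in> ?Y" "\<zeta> \<in> \<Omega>" "\<zeta>' \<subseteq> \<zeta>"
      \<comment> \<open>Removing a pair keeps \<open>Y\<close> up-closed only if nothing smaller
        leads to it; this is what the minimal cardinality of \<open>\<xi>\<close> ensures.\<close>
      have "(\<zeta>, h) \<noteq> (\<xi>, g)"
      proof
        assume "(\<zeta>, h) = (\<xi>, g)"
        then have "\<zeta>' = \<xi>"
          using a min[of \<zeta>' h] finite_Omega_member[OF \<xi>(1)] by (intro card_seteq) auto
        with a \<open>(\<zeta>, h) = (\<xi>, g)\<close> show False by auto
      qed
      then show "(\<zeta>, h) \<in> ?Y" using a up by auto
    next
      fix \<zeta> h assume a: "\<zeta> \<in> \<Omega>" "h \<in> \<zeta>"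
      show "?V \<zeta> h \<in> carrier K" using Vc[OF a] v by auto
      assume "(\<zeta>, h) \<notin> ?Y"
      then consider "\<zeta> = \<xi>" "h = g" | "(\<zeta>, h) \<notin> Y" by blast
      then show "?V \<zeta> h = \<zero>"
      proof cases
        case 1
        then show ?thesis using v by (simp add: a_minus_def K.r_neg)
      next
        case 2
        then show ?thesis using V0[OF a 2] up[OF p a(1)] by (auto simp: a_minus_def)
      qed
    qed
    then obtain f where f: "f \<in> carrier F" "\<And>\<zeta> h. \<zeta> \<in> \<Omega> \<Longrightarrow> h \<in> \<zeta> \<Longrightarrow> arrow_coeff f \<zeta> h = ?V \<zeta> h"
      by blast
    let ?r = "?v \<otimes> inv ?c"
    let ?s = "?r \<odot>\<^bsub>F\<^esub> single K w"
    have r: "?r \<in> carrier K" "?r \<otimes> ?c = ?v" using v i c by (auto simp: K.m_assoc)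
    have s: "?s \<in> carrier F" by (rule Fr.smult_closed[OF r(1) single_in_F[OF ww]])
    have "arrow_coeff (f \<oplus>\<^bsub>F\<^esub> ?s) \<zeta> h = V \<zeta> h" if a: "\<zeta> \<in> \<Omega>" "h \<in> \<zeta>" for \<zeta> h
    proof -
      have "arrow_coeff (f \<oplus>\<^bsub>F\<^esub> ?s) \<zeta> h = ?V \<zeta> h \<oplus> ?r \<otimes> path_coeff \<zeta> h w"
        using arrow_coeff_add[OF f(1) s] f(2)[OF a] arrow_coeff_smult[OF single_in_F[OF ww] r(1)]
          arrow_coeff_single[OF ww] by (simp only:)
      also have "?r \<otimes> path_coeff \<zeta> h w = (if h = g \<and> \<xi> \<subseteq> \<zeta> then ?v else \<zero>)"
        using w r by (auto simp: path_coeff_def)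
      finally show ?thesis using Vc[OF a] v by (simp add: a_minus_def K.a_assoc K.l_neg)
    qed
    then show ?thesis using f(1) s by (intro bexI[of _ "f \<oplus>\<^bsub>F\<^esub> ?s"]) (auto simp del: Fr.A_simps)
  qed
qed

lemma arrow_coeff_surj:
  assumes "\<And>\<zeta> g. \<zeta> \<in> \<Omega> \<Longrightarrow> g \<in> \<zeta> \<Longrightarrow> V \<zeta> g \<in> carrier K"
  shows "\<exists>f\<in>carrier F. \<forall>\<zeta>\<in>\<Omega>. \<forall>g\<in>\<zeta>. arrow_coeff f \<zeta> g = V \<zeta> g"
  using finite_Omega finite_Omega_member assms
  by (intro arrow_coeff_surj_upclosed[of "Sigma \<Omega> id"]) auto

end

section \<open>The block of a connected component\<close>

context twisted_monoid
begin

lemma finsum_A_apply: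
  assumes "finite I" "\<And>i. i \<in> I \<Longrightarrow> f i \<in> finsupp K X"
  shows "(\<Oplus>\<^bsub>A\<^esub>i\<in>I. f i) x = (\<Oplus>i\<in>I. f i x)"
  using assms
proof (induction I rule: finite_induct)
  case empty
  interpret A: abelian_group A by (rule abelian_group_A)
  show ?case by simp
next
  case (insert i I)
  interpret A: abelian_group A by (rule abelian_group_A)
  have "(\<Oplus>\<^bsub>A\<^esub>i\<in>insert i I. f i) = f i \<oplus>\<^bsub>A\<^esub> (\<Oplus>\<^bsub>A\<^esub>i\<in>I. f i)"
    using insert by (intro A.finsum_insert) (auto simp: carrier_A)
  moreover have "(\<Oplus>i\<in>insert i I. f i x) = f i x \<oplus> (\<Oplus>i\<in>I. f i x)"
    using insert finsupp_closed[OF insert.prems] by (intro finsum_insert) auto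
  ultimately show ?case using insert by simp
qed

text \<open>In a group \<open>z\<close> is determined by \<open>k z = h\<close>, which collapses the
  inner pairing. Finiteness allows summing over the whole group rather than over a support.\<close>

lemma mult_A_finite_group:
  assumes M: "group M" and fin: "finite X" and f: "f \<in> finsupp K X" and g: "g \<in> finsupp K X" and h: "h \<in> X"
  shows "(f \<otimes>\<^bsub>A\<^esub> g) h = (\<Oplus>k\<in>X. f k \<otimes> (g (inv\<^bsub>M\<^esub> k \<otimes>\<^bsub>M\<^esub> h) \<otimes> \<tau> k (inv\<^bsub>M\<^esub> k \<otimes>\<^bsub>M\<^esub> h)))"
proof -
  interpret M: group M by (rule M)
  have gt: "g (inv\<^bsub>M\<^esub> k \<otimes>\<^bsub>M\<^esub> h) \<otimes> \<tau> k (inv\<^bsub>M\<^esub> k \<otimes>\<^bsub>M\<^esub> h) \<in> carrier K" if "k \<in> X" for k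
    using that h by (intro K.m_closed finsupp_closed[OF g] tau_closed) auto
  have "(f \<otimes>\<^bsub>A\<^esub> g) h = pairing K f (\<lambda>y. g (inv\<^bsub>M\<^esub> y \<otimes>\<^bsub>M\<^esub> h) \<otimes> \<tau> y (inv\<^bsub>M\<^esub> y \<otimes>\<^bsub>M\<^esub> h))"
    unfolding mult_A[OF f g]
  proof (rule pairing_cong[OF f gt])
    fix y assume y: "y \<in> X"
    have "pairing K g (\<lambda>z. if y \<otimes>\<^bsub>M\<^esub> z = h then \<tau> y z else \<zero>)
        = pairing K g (\<lambda>z. if z = inv\<^bsub>M\<^esub> y \<otimes>\<^bsub>M\<^esub> h then \<tau> y z else \<zero>)"
      using y h by (intro pairing_cong[OF g]) (auto simp: tau_closed M.m_assoc[symmetric])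
    also have "\<dots> = g (inv\<^bsub>M\<^esub> y \<otimes>\<^bsub>M\<^esub> h) \<otimes> \<tau> y (inv\<^bsub>M\<^esub> y \<otimes>\<^bsub>M\<^esub> h)"
      using y h by (intro pairing_indicator[OF g] tau_closed) auto
    finally show "pairing K g (\<lambda>z. if y \<otimes>\<^bsub>M\<^esub> z = h then \<tau> y z else \<zero>) = \<dots>" .
  qed
  also have "\<dots> = (\<Oplus>k\<in>X. f k \<otimes> (g (inv\<^bsub>M\<^esub> k \<otimes>\<^bsub>M\<^esub> h) \<otimes> \<tau> k (inv\<^bsub>M\<^esub> k \<otimes>\<^bsub>M\<^esub> h)))"
    using fin gt finsupp_supp[OF f] by (intro pairing_superset[OF f]) auto
  finally show ?thesis .
qed

end

text \<open>The field computation behind \<open>twist_mult\<close>. The three equations are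
  instances of the cocycle identity; eliminating \<open>c\<close> and \<open>p\<close> from them
  gives \<open>a b s e = f d q r\<close>, which is then divided by \<open>q s e\<close>.\<close>

lemma (in field) cocycle_quotient_identity:
  assumes c: "a \<in> carrier R" "b \<in> carrier R" "c \<in> carrier R" "d \<in> carrier R" "e \<in> carrier R"
      "f \<in> carrier R" "p \<in> carrier R" "q \<in> carrier R" "r \<in> carrier R" "s \<in> carrier R"
    and nz: "q \<noteq> \<zero>" "s \<noteq> \<zero>" "e \<noteq> \<zero>"
    and eq: "c \<otimes> d = a \<otimes> b" "c \<otimes> e = f \<otimes> p" "q \<otimes> r = s \<otimes> p"
  shows "b \<otimes> inv q \<otimes> a = (f \<otimes> inv s) \<otimes> ((d \<otimes> inv e) \<otimes> r)"
proof -
  have i: "inv q \<in> carrier R" "inv s \<in> carrier R" "inv e \<in> carrier R"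
    and u: "q \<otimes> inv q = \<one>" "s \<otimes> inv s = \<one>" "e \<otimes> inv e = \<one>"
    using nz c by (auto simp: field_Units intro: Units_r_inv)
  have main: "a \<otimes> b \<otimes> s \<otimes> e = f \<otimes> d \<otimes> q \<otimes> r"
  proof -
    have "a \<otimes> b \<otimes> s \<otimes> e = (c \<otimes> e) \<otimes> (d \<otimes> s)" unfolding eq(1)[symmetric] using c by (simp add: m_ac)
    also have "\<dots> = f \<otimes> d \<otimes> (s \<otimes> p)" unfolding eq(2) using c by (simp add: m_ac)
    also have "\<dots> = f \<otimes> d \<otimes> q \<otimes> r" unfolding eq(3)[symmetric] using c by (simp add: m_ac)
    finally show ?thesis .
  qed
  have "b \<otimes> inv q \<otimes> a = (b \<otimes> inv q \<otimes> a) \<otimes> ((s \<otimes> inv s) \<otimes> (e \<otimes> inv e))" using u c i by simp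
  also have "\<dots> = (a \<otimes> b \<otimes> s \<otimes> e) \<otimes> (inv q \<otimes> inv s \<otimes> inv e)" using c i by (simp add: m_ac)
  also have "\<dots> = (f \<otimes> inv s) \<otimes> ((d \<otimes> inv e) \<otimes> r) \<otimes> (q \<otimes> inv q)" unfolding main using c i by (simp add: m_ac)
  finally show ?thesis using u c i by simp
qed

text \<open>\<open>A\<close> is an object of the component, \<open>inv (x i) A\<close> for \<open>i < n\<close> are its objects, so that
  \<open>A\<close> is the disjoint union of the right cosets \<open>H x\<^sub>i\<close> of the stabilizer \<open>H\<close>.\<close>

locale component = finite_spectrum K G \<sigma>
  for K :: "('k, 'm) ring_scheme" (structure) and G :: "('g, 'n) monoid_scheme" and \<sigma> +
  fixes A :: "'g set" and n :: nat and x :: "nat \<Rightarrow> 'g"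
  assumes A_Omega: "A \<in> \<Omega>"
    and x_mem: "i < n \<Longrightarrow> x i \<in> A"
    and reps: "bij_betw (\<lambda>(i, h). h \<otimes>\<^bsub>G\<^esub> x i) ({..<n} \<times> stabilizer G (l_coset G) A) A"
begin

abbreviation "H \<equiv> stabilizer G (l_coset G) A"
abbreviation "HG \<equiv> stabilizer_group G A"
abbreviation "KH \<equiv> twisted_group_algebra K HG \<sigma>"
definition "obj i = ginv (x i) \<star> A"

lemma A_subset: "A \<subseteq> carrier G" by (rule Omega_subset[OF A_Omega])

lemma H_closed: "h \<in> H \<Longrightarrow> h \<in> carrier G"
  by (simp add: stabilizer_def)

lemma H_mult_A: "h \<in> H \<Longrightarrow> a \<in> A \<Longrightarrow> h \<cdot> a \<in> A"
  by (auto simp: stabilizer_def l_coset_def)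

lemma H_subset_A: "h \<in> H \<Longrightarrow> h \<in> A"
  using H_mult_A[of h "\<epsilon>"] Omega_one[OF A_Omega] by (simp add: H_closed)

lemma finite_A: "finite A" by (rule finite_Omega_member[OF A_Omega])

lemma finite_H: "finite H" using finite_A H_subset_A by (rule_tac finite_subset) auto

lemma H_subgroup: "subgroup H G"
proof (rule subgroupI)
  show "H \<subseteq> carrier G" by (auto simp: stabilizer_def)
  show "H \<noteq> {}" using lcos_mult_one[OF A_subset] by (auto simp: stabilizer_def)
next
  fix h assume h: "h \<in> H"
  then have "ginv h \<star> A = ginv h \<star> (h \<star> A)" by (simp add: stabilizer_def)
  also have "\<dots> = A" using h A_subset by (simp add: lcos_m_assoc lcos_mult_one H_closed)
  finally show "ginv h \<in> H" using h by (simp add: stabilizer_def)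
next
  fix h k assume "h \<in> H" "k \<in> H"
  then show "h \<cdot> k \<in> H" using A_subset by (simp add: stabilizer_def lcos_m_assoc[symmetric])
qed

lemma HG_group: "group HG"
  unfolding stabilizer_group_def by (rule subgroup_imp_group[OF H_subgroup])

lemma HG_simps [simp]:
  "carrier HG = H" "h \<otimes>\<^bsub>HG\<^esub> k = h \<cdot> k" "\<one>\<^bsub>HG\<^esub> = \<epsilon>"
  by (simp_all add: stabilizer_group_def)

lemma inv_HG: "h \<in> H \<Longrightarrow> inv\<^bsub>HG\<^esub> h = ginv h"
  unfolding stabilizer_group_def by (rule m_inv_consistent[OF H_subgroup])

lemma H_one: "\<epsilon> \<in> H" and H_m: "h \<in> H \<Longrightarrow> k \<in> H \<Longrightarrow> h \<cdot> k \<in> H"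
  and H_inv: "h \<in> H \<Longrightarrow> ginv h \<in> H"
  using H_subgroup by (auto simp: subgroup.one_closed subgroup.m_closed subgroup.m_inv_closed)

text \<open>From \<open>1 \<in> A\<close> and \<open>h A = A\<close> it follows that
  \<open>H \<subseteq> A\<close>. Hence all partial products of elements of \<open>H\<close> form
  chains in the single object \<open>A\<close>.\<close>

lemma H_global_cocycle: "global_cocycle K HG \<sigma>"
  unfolding global_cocycle_def HG_simps
proof (intro conjI ballI)
  fix h k assume "h \<in> H" "k \<in> H"
  then show "\<sigma> h k \<in> carrier K - {\<zero>}"
    using sigma_nonzero[OF A_Omega, of h k] by (simp add: H_closed H_subset_A H_m)
  fix l assume "l \<in> H"
  then show "\<sigma> h k \<otimes> \<sigma> (h \<cdot> k) l = \<sigma> h (k \<cdot> l) \<otimes> \<sigma> k l"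
    using sigma_cocycle[OF A_Omega, of h k l] \<open>h \<in> H\<close> \<open>k \<in> H\<close> by (simp add: H_closed H_subset_A H_m)
qed

lemma twisted_H: "twisted_monoid K HG \<sigma>"
  by (intro twisted_monoid.intro twisted_monoid_axioms.intro K.field_axioms H_global_cocycle
      group.is_monoid[OF HG_group])

lemma reps_mem: "i < n \<Longrightarrow> h \<in> H \<Longrightarrow> h \<cdot> x i \<in> A"
  using bij_betwE[OF reps] by auto

lemma x_carrier: "i < n \<Longrightarrow> x i \<in> carrier G"
  using x_mem A_subset by auto

lemma reps_eq:
  assumes "i < n" "j < n" "h \<in> H" "k \<in> H" "h \<cdot> x i = k \<cdot> x j"
  shows "i = j" "h = k"
  using inj_onD[OF bij_betw_imp_inj_on[OF reps], of "(i, h)" "(j, k)"] assms by auto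

lemma obj_Omega: "i < n \<Longrightarrow> obj i \<in> \<Omega>"
  unfolding obj_def by (intro Omega_translate[OF A_Omega] x_mem)

lemma mem_obj: "i < n \<Longrightarrow> a \<in> A \<Longrightarrow> ginv (x i) \<cdot> a \<in> obj i"
  unfolding obj_def by (auto simp: l_coset_def)

text \<open>The group element of the arrow from \<open>obj j\<close> to \<open>obj i\<close> that
  goes back to \<open>A\<close> along the chosen arrow, applies the loop \<open>h\<close>, and
  proceeds to \<open>obj i\<close>.\<close>

definition arr :: "nat \<Rightarrow> nat \<Rightarrow> 'g \<Rightarrow> 'g" where
  "arr i j h = ginv (x i) \<cdot> (h \<cdot> x j)"

lemma arr_mem: "i < n \<Longrightarrow> j < n \<Longrightarrow> h \<in> H \<Longrightarrow> arr i j h \<in> obj i"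
  unfolding arr_def by (intro mem_obj reps_mem)

lemma arr_carrier: "i < n \<Longrightarrow> j < n \<Longrightarrow> h \<in> H \<Longrightarrow> arr i j h \<in> carrier G"
  unfolding arr_def by (simp add: x_carrier H_closed)

text \<open>Left multiplication by \<open>inv (x i)\<close> carries the coset decomposition of
  \<open>A\<close> to one of \<open>obj i\<close>.\<close>

lemma arr_bij:
  assumes "i < n"
  shows "bij_betw (\<lambda>(j, h). arr i j h) ({..<n} \<times> H) (obj i)"
proof -
  have "bij_betw (\<lambda>a. ginv (x i) \<cdot> a) A (obj i)"
    using A_subset x_carrier[OF assms]
    by (auto simp: bij_betw_def inj_on_def obj_def l_coset_def subset_iff)
  from bij_betw_trans[OF reps this] show ?thesis
    by (simp add: arr_def comp_def case_prod_unfold)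
qed

text \<open>Equal objects put \<open>x i inv (x j)\<close> into the stabilizer, so
  \<open>x i\<close> would lie in two cosets.\<close>

lemma obj_inj:
  assumes "i < n" "j < n" "obj i = obj j"
  shows "i = j"
proof -
  note c = x_carrier[OF assms(1)] x_carrier[OF assms(2)]
  have "x i \<cdot> ginv (x j) \<star> A = x i \<star> obj j"
    using c A_subset by (simp add: obj_def lcos_m_assoc)
  also have "\<dots> = x i \<star> obj i" by (simp only: assms(3))
  also have "\<dots> = A" using c A_subset by (simp add: obj_def lcos_m_assoc lcos_mult_one)
  finally have "x i \<cdot> ginv (x j) \<in> H" using c by (simp add: stabilizer_def)
  from reps_eq(1)[OF assms(1,2) H_one this] show ?thesis using c by (simp add: m_assoc)
qed

lemma arr_mult:
  assumes "i < n" "j < n" "l < n" "h \<in> H" "k \<in> H"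
  shows "ginv (arr i l k) \<cdot> arr i j h = arr l j (ginv k \<cdot> h)"
  using assms x_carrier[OF assms(1)] x_carrier[OF assms(2)] x_carrier[OF assms(3)]
    H_closed[OF assms(4)] H_closed[OF assms(5)]
  by (simp add: arr_def inv_mult_group m_assoc) (simp add: m_assoc[symmetric])

lemma arr_obj:
  assumes "i < n" "l < n" "k \<in> H"
  shows "ginv (arr i l k) \<star> obj i = obj l"
proof -
  note c = x_carrier[OF assms(1)] x_carrier[OF assms(2)] H_closed[OF assms(3)]
  have "ginv (arr i l k) \<star> obj i = ginv (x l) \<star> (ginv k \<star> A)"
    using c A_subset by (simp add: arr_def obj_def lcos_m_assoc inv_mult_group m_assoc)
  also have "ginv k \<star> A = A" using H_inv[OF assms(3)] by (simp add: stabilizer_def)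
  finally show ?thesis by (simp add: obj_def)
qed

text \<open>The coefficient comes from \<open>\<tau>\<^sub>i\<inverse> [arr i j h] \<tau>\<^sub>j\<close>, where \<open>\<tau>\<^sub>i\<close> is the morphism
  \<open>1 (inv (x i), A)\<close> from \<open>A\<close> to \<open>obj i\<close>.\<close>

definition twist :: "nat \<Rightarrow> nat \<Rightarrow> 'g \<Rightarrow> 'k" where
  "twist i j h = \<sigma> (arr i j h) (ginv (x j)) \<otimes> inv (\<sigma> (ginv (x i)) h)"

text \<open>As 1 and \<open>h\<close> lie in \<open>A\<close>, both \<open>inv (x i)\<close> and
  \<open>inv (x i) h\<close> lie in \<open>obj i\<close>.\<close>

lemma sigma_x_nonzero:
  assumes "i < n" "h \<in> H"
  shows "\<sigma> (ginv (x i)) h \<noteq> \<zero>"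
  using mem_obj[OF assms(1) Omega_one[OF A_Omega]] mem_obj[OF assms(1) H_subset_A[OF assms(2)]] assms
  by (intro sigma_nonzero[OF obj_Omega[OF assms(1)]]) (auto simp: H_closed x_carrier)

lemma arr_inv_x: "i < n \<Longrightarrow> j < n \<Longrightarrow> h \<in> H \<Longrightarrow> arr i j h \<cdot> ginv (x j) = ginv (x i) \<cdot> h"
  by (simp add: arr_def x_carrier H_closed m_assoc)

lemma twist_closed: "i < n \<Longrightarrow> j < n \<Longrightarrow> h \<in> H \<Longrightarrow> twist i j h \<in> carrier K"
  using sigma_x_nonzero[of i h] inverse_scalar(1)[of "\<sigma> (ginv (x i)) h"]
  by (simp add: twist_def arr_carrier x_carrier H_closed)

lemma twist_nonzero:
  assumes "i < n" "j < n" "h \<in> H"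
  shows "twist i j h \<noteq> \<zero>"
proof -
  note c = x_carrier[OF assms(1)] x_carrier[OF assms(2)] H_closed[OF assms(3)] arr_carrier[OF assms]
  have "\<sigma> (arr i j h) (ginv (x j)) \<noteq> \<zero>"
    using mem_obj[OF assms(1) H_subset_A[OF assms(3)]] c assms
    by (intro sigma_nonzero[OF obj_Omega[OF assms(1)] arr_mem[OF assms]]) (auto simp: arr_inv_x)
  moreover note i = inverse_scalar[OF sigma_closed sigma_x_nonzero[OF assms(1,3)]]
  have "inv (\<sigma> (ginv (x i)) h) \<noteq> \<zero>" using i(2) c by fastforce
  ultimately show ?thesis using c i(1) by (simp add: twist_def K.integral_iff)
qed

lemma twist_one: "i < n \<Longrightarrow> twist i i \<epsilon> = \<one>"
proof -
  assume i: "i < n"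
  have "ginv (x i) \<in> obj i"
    using mem_obj[OF i Omega_one[OF A_Omega]] x_carrier[OF i] by simp
  note s = sigma_one_left[OF obj_Omega[OF i] this] sigma_one_right[OF obj_Omega[OF i] this]
  show ?thesis using s x_carrier[OF i] by (simp add: twist_def arr_def)
qed

text \<open>Rescaling by \<open>twist\<close> turns the product of arrows into the product of their
  loops in the twisted group algebra of \<open>H\<close>. With \<open>m = inv k h\<close>, the
  cocycle identity is used at \<open>(arr i l k, arr l j m, inv (x j))\<close>,
  \<open>(arr i l k, inv (x l), m)\<close> and \<open>(inv (x i), k, m)\<close>.\<close>

lemma twist_mult:
  assumes "i < n" "j < n" "l < n" "h \<in> H" "k \<in> H"
  shows "twist i j h \<otimes> \<sigma> (arr i l k) (arr l j (ginv k \<cdot> h)) =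
    twist i l k \<otimes> (twist l j (ginv k \<cdot> h) \<otimes> \<sigma> k (ginv k \<cdot> h))"
proof -
  let ?m = "ginv k \<cdot> h"
  have m: "?m \<in> H" using assms H_m H_inv by simp
  note xc = x_carrier[OF assms(1)] x_carrier[OF assms(2)] x_carrier[OF assms(3)]
  note hc = H_closed[OF assms(4)] H_closed[OF assms(5)] H_closed[OF m]
  note ac = arr_carrier[OF assms(1,3,5)] arr_carrier[OF assms(3,2) m] arr_carrier[OF assms(1,2,4)]
  note ix = arr_inv_x[OF assms(1,3,5)] arr_inv_x[OF assms(3,2) m] arr_inv_x[OF assms(1,2,4)]
  note Z = obj_Omega[OF assms(1)]
  have km: "k \<cdot> ?m = h" using hc by (simp add: m_assoc[symmetric])
  have gg: "arr i l k \<cdot> arr l j ?m = arr i j h"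
    unfolding arr_mult[OF assms, symmetric] using ac by (simp add: m_assoc[symmetric])
  have xkm: "ginv (x i) \<cdot> k \<cdot> ?m = ginv (x i) \<cdot> h"
    using xc hc by (simp add: m_assoc km)
  have mem: "arr i l k \<in> obj i" "arr i j h \<in> obj i" "ginv (x i) \<cdot> h \<in> obj i"
      "ginv (x i) \<cdot> k \<in> obj i" "ginv (x i) \<in> obj i"
    using arr_mem assms mem_obj H_subset_A mem_obj[OF assms(1) Omega_one[OF A_Omega]] xc by auto
  \<comment> \<open>All three instances run along chains of points of \<open>obj i\<close>,
    collected in \<open>mem\<close>.\<close>
  have 1: "\<sigma> (arr i l k) (arr l j ?m \<cdot> ginv (x j)) \<otimes> \<sigma> (arr l j ?m) (ginv (x j))
      = \<sigma> (arr i l k) (arr l j ?m) \<otimes> \<sigma> (arr i l k \<cdot> arr l j ?m) (ginv (x j))"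
    using mem ac xc by (intro sigma_cocycle[OF Z]) (simp_all add: gg ix)
  have 2: "\<sigma> (arr i l k) (ginv (x l) \<cdot> ?m) \<otimes> \<sigma> (ginv (x l)) ?m
      = \<sigma> (arr i l k) (ginv (x l)) \<otimes> \<sigma> (arr i l k \<cdot> ginv (x l)) ?m"
    using mem ac xc hc by (intro sigma_cocycle[OF Z]) (simp_all only: ix xkm inv_closed)
  have 3: "\<sigma> (ginv (x i)) (k \<cdot> ?m) \<otimes> \<sigma> k ?m
      = \<sigma> (ginv (x i)) k \<otimes> \<sigma> (ginv (x i) \<cdot> k) ?m"
    using mem ac xc hc by (intro sigma_cocycle[OF Z]) (simp_all only: ix xkm inv_closed)
  show ?thesis
    unfolding twist_def
  proof (rule K.cocycle_quotient_identity[OF _ _ _ _ _ _ _ _ _ _ _ _ _ 1[unfolded ix gg] 2[unfolded ix] 3[unfolded km]])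
    show "\<sigma> (ginv (x i)) h \<noteq> \<zero>" "\<sigma> (ginv (x i)) k \<noteq> \<zero>" "\<sigma> (ginv (x l)) ?m \<noteq> \<zero>"
      using sigma_x_nonzero assms m by auto
  qed (use ac xc hc in \<open>simp_all del: inv_mult_group\<close>)
qed


section \<open>From arrow coefficients to matrices over the twisted group algebra\<close>

sublocale KHt: twisted_monoid K HG \<sigma>
  by (rule twisted_H)

definition block_entry :: "('g list \<Rightarrow> 'k) \<Rightarrow> nat \<Rightarrow> nat \<Rightarrow> 'g \<Rightarrow> 'k" where
  "block_entry f i j = (\<lambda>h. if h \<in> H then twist i j h \<otimes> arrow_coeff f (obj i) (arr i j h) else \<zero>)"

definition block :: "('g list \<Rightarrow> 'k) \<Rightarrow> ('g \<Rightarrow> 'k) mat" where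
  "block f = mat n n (\<lambda>(i, j). block_entry f i j)"

abbreviation "MA \<equiv> matrix_algebra n KH"

lemma block_entry_closed:
  assumes "f \<in> carrier F" "i < n" "j < n"
  shows "block_entry f i j \<in> finsupp K H"
  using finite_H assms arrow_coeff_closed[OF assms(1)] twist_closed[OF assms(2,3)]
  by (auto simp: finsupp_def block_entry_def intro: rev_finite_subset)

lemma block_closed:
  assumes "f \<in> carrier F"
  shows "block f \<in> carrier MA"
  using block_entry_closed[OF assms] KHt.carrier_A
  by (auto simp: matrix_algebra_def block_def elements_mat_def)

lemma block_add:
  assumes "f \<in> carrier F" "f' \<in> carrier F"
  shows "block (f \<oplus>\<^bsub>F\<^esub> f') = block f \<oplus>\<^bsub>MA\<^esub> block f'"
proof -
  have "block_entry (f \<oplus>\<^bsub>F\<^esub> f') i j = block_entry f i j \<oplus>\<^bsub>KH\<^esub> block_entry f' i j" if "i < n" "j < n" for i j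
    using arrow_coeff_add[OF assms] arrow_coeff_closed[OF assms(1)] arrow_coeff_closed[OF assms(2)] twist_closed that
    by (simp add: fun_eq_iff block_entry_def K.r_distr del: Fr.A_simps)
  then show ?thesis
    unfolding block_def matrix_algebra_def by (intro eq_matI) (auto simp del: Fr.A_simps KHt.A_simps)
qed

lemma block_smult:
  assumes "f \<in> carrier F" "r \<in> carrier K"
  shows "block (r \<odot>\<^bsub>F\<^esub> f) = r \<odot>\<^bsub>MA\<^esub> block f"
proof -
  have "block_entry (r \<odot>\<^bsub>F\<^esub> f) i j = r \<odot>\<^bsub>KH\<^esub> block_entry f i j" if "i < n" "j < n" for i j
    using arrow_coeff_smult[OF assms] arrow_coeff_closed[OF assms(1)] twist_closed that assms(2)
    by (simp add: fun_eq_iff block_entry_def K.m_lcomm del: Fr.A_simps)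
  then show ?thesis
    unfolding block_def matrix_algebra_def by (intro eq_matI) (auto simp del: Fr.A_simps KHt.A_simps)
qed

lemma block_one: "block \<one>\<^bsub>F\<^esub> = \<one>\<^bsub>MA\<^esub>"
proof -
  have "block_entry \<one>\<^bsub>F\<^esub> i j = (if i = j then \<one>\<^bsub>KH\<^esub> else \<zero>\<^bsub>KH\<^esub>)" if ij: "i < n" "j < n" for i j
  proof
    fix h
    \<comment> \<open>By uniqueness of the coset decomposition, \<open>h x j = x i\<close> forces
      \<open>j = i\<close> and \<open>h = 1\<close>. So the identity arrows of the component are the
      diagonal ones with trivial loop.\<close>
    have arr: "arr i j h = \<epsilon> \<longleftrightarrow> i = j \<and> h = \<epsilon>" if h: "h \<in> H"
    proof
      assume a: "arr i j h = \<epsilon>"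
      note c = x_carrier[OF ij(1)] x_carrier[OF ij(2)] H_closed[OF h]
      have "h \<cdot> x j = x i \<cdot> arr i j h"
        using c by (simp add: arr_def m_assoc[symmetric])
      then have "h \<cdot> x j = \<epsilon> \<cdot> x i" using a c by simp
      then show "i = j \<and> h = \<epsilon>" using reps_eq[OF ij(2,1) h H_one] by auto
    qed (use ij x_carrier in \<open>simp add: arr_def\<close>)
    show "block_entry \<one>\<^bsub>F\<^esub> i j h = (if i = j then \<one>\<^bsub>KH\<^esub> else \<zero>\<^bsub>KH\<^esub>) h"
    proof (cases "h \<in> H")
      case True
      then show ?thesis
        using ij arr[OF True] twist_one[OF ij(1)] twist_closed[OF ij True]
        by (auto simp: block_entry_def arrow_coeff_one[OF obj_Omega] twisted_monoid_algebra_def[of K HG]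
            sigma_one_one)
    next
      case False
      then have "h \<noteq> \<epsilon>" using H_one by auto
      then show ?thesis using False
        by (simp add: block_entry_def twisted_monoid_algebra_def[of K HG])
    qed
  qed
  then show ?thesis
    unfolding block_def matrix_algebra_def by (intro eq_matI) (auto simp del: KHt.A_simps)
qed

text \<open>Each \<open>y \<in> obj i\<close> is \<open>arr i l k\<close> for a unique pair
  \<open>(l, k)\<close>. The convolution sum over \<open>y\<close> thus splits into a sum over the
  intermediate object \<open>l\<close>, the matrix product, and one over the loop \<open>k\<close>,
  the product in the group algebra; \<open>twist_mult\<close> matches the scalars.\<close>

lemma block_entry_mult:
  assumes f: "f \<in> carrier F" and f': "f' \<in> carrier F" and ij: "i < n" "j < n"
  shows "block_entry (f \<otimes>\<^bsub>F\<^esub> f') i j = (\<Oplus>\<^bsub>KH\<^esub>l\<in>{..<n}. block_entry f i l \<otimes>\<^bsub>KH\<^esub> block_entry f' l j)"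
proof
  fix h
  note be = block_entry_closed[OF f] block_entry_closed[OF f']
  note mc = KHt.mult_A_closed(1)[unfolded HG_simps]
  have sum: "(\<Oplus>\<^bsub>KH\<^esub>l\<in>{..<n}. block_entry f i l \<otimes>\<^bsub>KH\<^esub> block_entry f' l j) h
      = (\<Oplus>l\<in>{..<n}. (block_entry f i l \<otimes>\<^bsub>KH\<^esub> block_entry f' l j) h)"
    using ij be by (intro KHt.finsum_A_apply) (auto intro!: mc be)
  show "block_entry (f \<otimes>\<^bsub>F\<^esub> f') i j h = (\<Oplus>\<^bsub>KH\<^esub>l\<in>{..<n}. block_entry f i l \<otimes>\<^bsub>KH\<^esub> block_entry f' l j) h"
  proof (cases "h \<in> H")
    case False
    have "(block_entry f i l \<otimes>\<^bsub>KH\<^esub> block_entry f' l j) h = \<zero>" if "l < n" for l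
      using KHt.mult_A_closed(1)[of "block_entry f i l" "block_entry f' l j"] be ij that False
      by (simp add: finsupp_def)
    then have "(\<Oplus>l\<in>{..<n}. (block_entry f i l \<otimes>\<^bsub>KH\<^esub> block_entry f' l j) h) = \<zero>"
      by (intro K.add.finprod_one_eqI) auto
    then show ?thesis unfolding sum using False by (simp add: block_entry_def)
  next
    case True
    note h = True
    let ?t = "twist i j h"
    \<comment> \<open>\<open>T\<close>, \<open>S\<close> and \<open>R\<close> are one summand in
      three forms: indexed by \<open>y\<close>, indexed by \<open>(l, k)\<close> with
      \<open>y = arr i l k\<close>, and with \<open>twist i j h\<close> distributed over the two
      entries.\<close>
    define T where "T y = arrow_coeff f (obj i) y \<otimes> (arrow_coeff f' (ginv y \<star> obj i) (ginv y \<cdot> arr i j h)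
           \<otimes> \<sigma> y (ginv y \<cdot> arr i j h))" for y
    define S where "S l k = arrow_coeff f (obj i) (arr i l k) \<otimes> (arrow_coeff f' (obj l) (arr l j (ginv k \<cdot> h))
           \<otimes> \<sigma> (arr i l k) (arr l j (ginv k \<cdot> h)))" for l k
    define R where "R l k = block_entry f i l k \<otimes> (block_entry f' l j (inv\<^bsub>HG\<^esub> k \<otimes>\<^bsub>HG\<^esub> h) \<otimes> \<sigma> k (inv\<^bsub>HG\<^esub> k \<otimes>\<^bsub>HG\<^esub> h))" for l k
    note ac = arrow_coeff_closed[OF f] arrow_coeff_closed[OF f']
    note t = twist_closed[OF ij h]
    have m: "ginv k \<cdot> h \<in> H" if "k \<in> H" for k using that h H_m H_inv by simp
    have Sc: "S l k \<in> carrier K" if "l < n" "k \<in> H" for l k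
      unfolding S_def using that ij ac m by (intro K.m_closed sigma_closed arr_carrier) auto
    have TS: "T (arr i l k) = S l k" if "l < n" "k \<in> H" for l k
      using arr_obj[OF ij(1) that] arr_mult[OF ij(1,2) that(1) h that(2)] by (simp only: T_def S_def)
    have SR: "?t \<otimes> S l k = R l k" if l: "l < n" and k: "k \<in> H" for l k
    proof -
      let ?m = "ginv k \<cdot> h"
      let ?a = "arrow_coeff f (obj i) (arr i l k)" and ?b = "arrow_coeff f' (obj l) (arr l j ?m)"
      let ?s = "\<sigma> (arr i l k) (arr l j ?m)" and ?u = "\<sigma> k ?m"
      have c: "?a \<in> carrier K" "?b \<in> carrier K" "?s \<in> carrier K" "?u \<in> carrier K"
          "twist i l k \<in> carrier K" "twist l j ?m \<in> carrier K"
        using ac ij l k m[OF k] by (auto simp: arr_carrier H_closed twist_closed)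
      have "?t \<otimes> S l k = (?t \<otimes> ?s) \<otimes> (?a \<otimes> ?b)"
        unfolding S_def using c t by (simp add: K.m_ac)
      also have "\<dots> = (twist i l k \<otimes> (twist l j ?m \<otimes> ?u)) \<otimes> (?a \<otimes> ?b)"
        by (simp only: twist_mult[OF ij l h k])
      also have "\<dots> = (twist i l k \<otimes> ?a) \<otimes> ((twist l j ?m \<otimes> ?b) \<otimes> ?u)"
        using c by (simp add: K.m_ac)
      also have "\<dots> = R l k" unfolding R_def using k m[OF k] by (simp add: block_entry_def inv_HG)
      finally show ?thesis .
    qed
    have "arrow_coeff (f \<otimes>\<^bsub>F\<^esub> f') (obj i) (arr i j h) = (\<Oplus>y\<in>obj i. T y)"
      unfolding T_def using finite_Omega_member[OF obj_Omega[OF ij(1)]] arr_mem[OF ij h]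
      by (intro arrow_coeff_mult[OF f f' obj_Omega[OF ij(1)]])
    also have "\<dots> = (\<Oplus>p\<in>{..<n} \<times> H. T (case p of (l, k) \<Rightarrow> arr i l k))"
    proof -
      have "(\<Oplus>y\<in>(\<lambda>(l, k). arr i l k) ` ({..<n} \<times> H). T y)
          = (\<Oplus>p\<in>{..<n} \<times> H. T (case p of (l, k) \<Rightarrow> arr i l k))"
      proof (rule K.add.finprod_reindex)
        show "T \<in> (\<lambda>(l, k). arr i l k) ` ({..<n} \<times> H) \<rightarrow> carrier K" using TS Sc by auto
        show "inj_on (\<lambda>(l, k). arr i l k) ({..<n} \<times> H)"
          by (rule bij_betw_imp_inj_on[OF arr_bij[OF ij(1)]])
      qed
      then show ?thesis by (simp only: bij_betw_imp_surj_on[OF arr_bij[OF ij(1)]])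
    qed
    also have "\<dots> = (\<Oplus>p\<in>{..<n} \<times> H. S (fst p) (snd p))"
      using Sc TS by (intro finsum_cong') auto
    also have "\<dots> = (\<Oplus>l\<in>{..<n}. \<Oplus>k\<in>H. S l k)"
      using Sc finite_H by (intro finsum_Times) auto
    finally have "block_entry (f \<otimes>\<^bsub>F\<^esub> f') i j h = ?t \<otimes> (\<Oplus>l\<in>{..<n}. \<Oplus>k\<in>H. S l k)"
      using h by (simp add: block_entry_def)
    also have "\<dots> = (\<Oplus>l\<in>{..<n}. ?t \<otimes> (\<Oplus>k\<in>H. S l k))"
      using Sc t by (intro finsum_rdistr) (auto intro!: finsum_closed)
    also have "\<dots> = (\<Oplus>l\<in>{..<n}. (block_entry f i l \<otimes>\<^bsub>KH\<^esub> block_entry f' l j) h)"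
    proof (rule finsum_cong', simp)
      show "(\<lambda>l. (block_entry f i l \<otimes>\<^bsub>KH\<^esub> block_entry f' l j) h) \<in> {..<n} \<rightarrow> carrier K"
        using ij by (intro Pi_I finsupp_closed[OF mc] be) auto
      fix l assume l: "l \<in> {..<n}"
      have "?t \<otimes> (\<Oplus>k\<in>H. S l k) = (\<Oplus>k\<in>H. ?t \<otimes> S l k)"
        using Sc t l finite_H by (intro finsum_rdistr) auto
      also have "\<dots> = (\<Oplus>k\<in>H. R l k)"
        using Sc t l SR by (intro finsum_cong') (auto simp flip: SR)
      also have "\<dots> = (block_entry f i l \<otimes>\<^bsub>KH\<^esub> block_entry f' l j) h"
        unfolding R_def using be ij l h finite_H
        by (subst KHt.mult_A_finite_group[OF HG_group]) auto
      finally show "?t \<otimes> (\<Oplus>k\<in>H. S l k) = (block_entry f i l \<otimes>\<^bsub>KH\<^esub> block_entry f' l j) h" .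
    qed
    finally show ?thesis unfolding sum .
  qed
qed

lemma block_mult:
  assumes "f \<in> carrier F" "f' \<in> carrier F"
  shows "block (f \<otimes>\<^bsub>F\<^esub> f') = block f \<otimes>\<^bsub>MA\<^esub> block f'"
proof -
  interpret KHg: abelian_group KH by (rule KHt.abelian_group_A)
  have c: "block_entry f i l \<otimes>\<^bsub>KH\<^esub> block_entry f' l j \<in> carrier KH" if "i < n" "l < n" "j < n" for i l j
    using KHt.mult_A_closed(1) block_entry_closed assms that unfolding KHt.carrier_A by simp
  have "(\<Oplus>\<^bsub>KH\<^esub>l\<in>{..<n}. block f $$ (i, l) \<otimes>\<^bsub>KH\<^esub> block f' $$ (l, j))
      = (\<Oplus>\<^bsub>KH\<^esub>l\<in>{..<n}. block_entry f i l \<otimes>\<^bsub>KH\<^esub> block_entry f' l j)" if "i < n" "j < n" for i j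
    using that c by (intro KHg.finsum_cong') (auto simp: block_def)
  then show ?thesis
    using block_entry_mult[OF assms]
    by (intro eq_matI) (auto simp: matrix_algebra_def block_def[of "f \<otimes>\<^bsub>F\<^esub> f'"] block_def[of f, THEN arg_cong, of dim_row]
        simp del: Fr.A_simps KHt.A_simps)
qed

text \<open>No information is lost: the entries run over all arrows into the objects of the
  component, and the factors \<open>twist\<close> are nonzero.\<close>

lemma block_eq_iff:
  assumes "f \<in> carrier F" "f' \<in> carrier F"
  shows "block f = block f' \<longleftrightarrow>
    (\<forall>i<n. \<forall>g\<in>obj i. arrow_coeff f (obj i) g = arrow_coeff f' (obj i) g)"
proof
  assume b: "block f = block f'"
  show "\<forall>i<n. \<forall>g\<in>obj i. arrow_coeff f (obj i) g = arrow_coeff f' (obj i) g"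
  proof (intro allI impI ballI)
    fix i g assume i: "i < n" and g: "g \<in> obj i"
    then obtain j h where jh: "j < n" "h \<in> H" "g = arr i j h"
      using bij_betw_imp_surj_on[OF arr_bij[OF i]] by force
    have "block f $$ (i, j) = block f' $$ (i, j)" using b by simp
    then have "block_entry f i j = block_entry f' i j" using i jh by (simp add: block_def)
    then have "block_entry f i j h = block_entry f' i j h" by simp
    then show "arrow_coeff f (obj i) g = arrow_coeff f' (obj i) g"
      using jh twist_nonzero[OF i jh(1,2)] twist_closed[OF i jh(1,2)]
        arrow_coeff_closed[OF assms(1)] arrow_coeff_closed[OF assms(2)]
      by (simp add: block_entry_def K.m_lcancel)
  qed
next
  assume z: "\<forall>i<n. \<forall>g\<in>obj i. arrow_coeff f (obj i) g = arrow_coeff f' (obj i) g"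
  have "block_entry f i j = block_entry f' i j" if "i < n" "j < n" for i j
    using z arr_mem that by (auto simp: block_entry_def fun_eq_iff)
  then show "block f = block f'"
    unfolding block_def by (intro eq_matI) auto
qed

text \<open>The entries of \<open>M\<close> divided by \<open>twist\<close> are the coefficients
  wanted. Values are returned rather than a preimage, because one element of the free algebra has to
  serve all components at once.\<close>

lemma block_prescribed:
  assumes M: "M \<in> carrier MA"
  shows "\<exists>V. (\<forall>i<n. \<forall>g\<in>obj i. V (obj i) g \<in> carrier K) \<and>
    (\<forall>f\<in>carrier F. (\<forall>i<n. \<forall>g\<in>obj i. arrow_coeff f (obj i) g = V (obj i) g) \<longrightarrow> block f = M)"
proof -
  let ?S = "{..<n} \<times> ({..<n} \<times> H)"
  let ?P = "\<lambda>(i, j, h). (obj i, arr i j h)"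
  let ?W = "\<lambda>(i, j, h). inv (twist i j h) \<otimes> (M $$ (i, j)) h"
  define V where "V \<zeta> g = ?W (the_inv_into ?S ?P (\<zeta>, g))" for \<zeta> g
  \<comment> \<open>Different index triples name different arrows, so the values read off from
    \<open>M\<close> cannot conflict.\<close>
  have inj: "inj_on ?P ?S"
  proof (rule inj_onI)
    fix p q assume p: "p \<in> ?S" and q: "q \<in> ?S" and eq: "?P p = ?P q"
    obtain i j h i' j' h' where pq: "p = (i, j, h)" "q = (i', j', h')" by (cases p, cases q) auto
    have "i = i'" using obj_inj p q eq pq by auto
    moreover have "(j, h) = (j', h')"
      using inj_onD[OF bij_betw_imp_inj_on[OF arr_bij, of i], of "(j, h)" "(j', h')"] p q eq pq \<open>i = i'\<close> by auto
    ultimately show "p = q" using pq by simp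
  qed
  have V: "V (obj i) (arr i j h) = inv (twist i j h) \<otimes> (M $$ (i, j)) h"
    if "i < n" "j < n" "h \<in> H" for i j h
    using the_inv_into_f_f[OF inj, of "(i, j, h)"] that by (simp add: V_def)
  have Mc: "M $$ (i, j) \<in> finsupp K H" if "i < n" "j < n" for i j
  proof -
    have "M \<in> carrier_mat n n" "elements_mat M \<subseteq> finsupp K H"
      using M KHt.carrier_A by (simp_all add: matrix_algebra_def)
    then show ?thesis using elements_matI[OF _ that refl] by auto
  qed
  have dims: "dim_row M = n" "dim_col M = n" using M by (auto simp: matrix_algebra_def)
  show ?thesis
  proof (intro exI[of _ V] conjI allI impI ballI)
    fix i g assume i: "i < n" and g: "g \<in> obj i"
    then obtain j h where jh: "j < n" "h \<in> H" "g = arr i j h"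
      using bij_betw_imp_surj_on[OF arr_bij[OF i]] by force
    show "V (obj i) g \<in> carrier K"
      unfolding jh(3) V[OF i jh(1,2)]
      using inverse_scalar(1)[OF twist_closed twist_nonzero] i jh finsupp_closed[OF Mc] by simp
  next
    fix f assume f: "f \<in> carrier F" and eq: "\<forall>i<n. \<forall>g\<in>obj i. arrow_coeff f (obj i) g = V (obj i) g"
    have "block_entry f i j = M $$ (i, j)" if ij: "i < n" "j < n" for i j
    proof
      fix h
      show "block_entry f i j h = (M $$ (i, j)) h"
      proof (cases "h \<in> H")
        case True
        have "block_entry f i j h = twist i j h \<otimes> (inv (twist i j h) \<otimes> (M $$ (i, j)) h)"
          using eq arr_mem[OF ij True] V[OF ij True] True ij by (simp add: block_entry_def)
        then show ?thesis
          using inverse_scalar[OF twist_closed[OF ij True] twist_nonzero[OF ij True]]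
            twist_closed[OF ij True] finsupp_closed[OF Mc[OF ij]] by (simp add: K.m_assoc[symmetric])
      next
        case False
        then show ?thesis using Mc[OF ij] by (simp add: block_entry_def finsupp_def)
      qed
    qed
    then show "block f = M" using dims by (intro eq_matI) (auto simp: block_def)
  qed
qed

end

section \<open>Connected components and the isomorphism\<close>

text \<open>The first isomorphism theorem. The kernel condition compares values of
  \<open>\<Theta>\<close> instead of subtracting them, as \<open>T\<close> comes with operations but
  without assumed algebra axioms.\<close>

lemma (in algebra_ideal) quotient_algebra_isomorphic:
  assumes closed: "\<And>f. f \<in> carrier F \<Longrightarrow> \<Theta> f \<in> carrier T"
    and mult: "\<And>f g. f \<in> carrier F \<Longrightarrow> g \<in> carrier F \<Longrightarrow> \<Theta> (f \<otimes>\<^bsub>F\<^esub> g) = \<Theta> f \<otimes>\<^bsub>T\<^esub> \<Theta> g"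
    and add: "\<And>f g. f \<in> carrier F \<Longrightarrow> g \<in> carrier F \<Longrightarrow> \<Theta> (f \<oplus>\<^bsub>F\<^esub> g) = \<Theta> f \<oplus>\<^bsub>T\<^esub> \<Theta> g"
    and one: "\<Theta> \<one>\<^bsub>F\<^esub> = \<one>\<^bsub>T\<^esub>"
    and smult: "\<And>r f. r \<in> carrier K \<Longrightarrow> f \<in> carrier F \<Longrightarrow> \<Theta> (r \<odot>\<^bsub>F\<^esub> f) = r \<odot>\<^bsub>T\<^esub> \<Theta> f"
    and surj: "\<And>t. t \<in> carrier T \<Longrightarrow> \<exists>f\<in>carrier F. \<Theta> f = t"
    and ker: "\<And>f g. f \<in> carrier F \<Longrightarrow> g \<in> carrier F \<Longrightarrow> \<Theta> f = \<Theta> g \<longleftrightarrow> f \<ominus>\<^bsub>F\<^esub> g \<in> I"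
  shows "algebra_isomorphic K Q T"
proof -
  define \<phi> where "\<phi> Y = \<Theta> (SOME f. f \<in> carrier F \<and> I +>\<^bsub>F\<^esub> f = Y)" for Y
  have eq: "\<Theta> f = \<Theta> g \<longleftrightarrow> I +>\<^bsub>F\<^esub> f = I +>\<^bsub>F\<^esub> g" if "f \<in> carrier F" "g \<in> carrier F" for f g
    using ker[OF that] F.quotient_eq_iff_same_a_r_cos[OF I.ideal_axioms that] by simp
  have \<phi>: "\<phi> (I +>\<^bsub>F\<^esub> f) = \<Theta> f" if f: "f \<in> carrier F" for f
  proof -
    have "(SOME g. g \<in> carrier F \<and> I +>\<^bsub>F\<^esub> g = I +>\<^bsub>F\<^esub> f) \<in> carrier F \<and>
        I +>\<^bsub>F\<^esub> (SOME g. g \<in> carrier F \<and> I +>\<^bsub>F\<^esub> g = I +>\<^bsub>F\<^esub> f) = I +>\<^bsub>F\<^esub> f"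
      by (rule someI[of _ f]) (use f in simp)
    then show ?thesis unfolding \<phi>_def using eq f by blast
  qed
  have "\<phi> \<in> ring_hom Q T"
  proof (rule ring_hom_memI)
    fix X assume "X \<in> carrier Q"
    then show "\<phi> X \<in> carrier T" by (auto simp: carrier_Q \<phi> closed)
  next
    fix X Y assume "X \<in> carrier Q" "Y \<in> carrier Q"
    then show "\<phi> (X \<otimes>\<^bsub>Q\<^esub> Y) = \<phi> X \<otimes>\<^bsub>T\<^esub> \<phi> Y" "\<phi> (X \<oplus>\<^bsub>Q\<^esub> Y) = \<phi> X \<oplus>\<^bsub>T\<^esub> \<phi> Y"
      by (auto simp: carrier_Q rcos_mult rcos_add \<phi> mult add)
  qed (simp add: rcos_one \<phi> one)
  moreover have "bij_betw \<phi> (carrier Q) (carrier T)"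
  proof (rule bij_betw_imageI)
    show "inj_on \<phi> (carrier Q)" by (auto simp: inj_on_def carrier_Q \<phi> eq)
    show "\<phi> ` carrier Q = carrier T"
      using surj closed by (force simp: carrier_Q image_image \<phi>)
  qed
  moreover have "\<phi> (r \<odot>\<^bsub>Q\<^esub> X) = r \<odot>\<^bsub>T\<^esub> \<phi> X" if "r \<in> carrier K" "X \<in> carrier Q" for r X
    using that by (auto simp: carrier_Q rcos_smult \<phi> smult)
  ultimately show ?thesis
    unfolding algebra_isomorphic_def algebra_iso_def ring_iso_def by blast
qed

section \<open>Components of the groupoid and the consequence of discreteness\<close>

context factor_set_data
begin

abbreviation "arrow_rel \<equiv> gpd_connected (sigma_groupoid K G \<sigma>)"
abbreviation "arrow_classes \<equiv> gpd_components (sigma_groupoid K G \<sigma>)"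

text \<open>Put \<open>y = inv g\<close> for a morphism \<open>r(g, A)\<close>; conversely the
  scalar may be taken to be 1.\<close>

lemma connected_iff:
  "(A, B) \<in> arrow_rel \<longleftrightarrow> A \<in> \<Omega> \<and> (\<exists>y\<in>A. B = ginv y \<star> A)"
proof
  assume "(A, B) \<in> arrow_rel"
  then obtain g where "A \<in> \<Omega>" "g \<in> carrier G" "ginv g \<in> A" "B = g \<star> A"
    by (auto simp: gpd_connected_def sigma_groupoid_def)
  then show "A \<in> \<Omega> \<and> (\<exists>y\<in>A. B = ginv y \<star> A)"
    by (intro conjI bexI[of _ "ginv g"]) auto
next
  assume "A \<in> \<Omega> \<and> (\<exists>y\<in>A. B = ginv y \<star> A)"
  then obtain y where A: "A \<in> \<Omega>" "y \<in> A" and B: "B = ginv y \<star> A" by blast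
  have "y \<in> carrier G" using A Omega_subset by auto
  then have "(\<one>, ginv y, A) \<in> gpd_arrs (sigma_groupoid K G \<sigma>)"
    using A by (simp add: sigma_groupoid_def)
  then show "(A, B) \<in> arrow_rel"
    using A B Omega_translate[OF A]
    by (auto simp: gpd_connected_def sigma_groupoid_def intro!: bexI[of _ "(\<one>, ginv y, A)"])
qed

lemma connected_equiv: "equiv \<Omega> arrow_rel"
proof (rule equivI)
  show "arrow_rel \<subseteq> \<Omega> \<times> \<Omega>" by (auto simp: connected_iff Omega_translate)
  show "refl_on \<Omega> arrow_rel"
  proof (rule refl_onI)
    fix A assume "A \<in> \<Omega>"
    then show "(A, A) \<in> arrow_rel"
      using Omega_one Omega_subset lcos_mult_one by (auto simp: connected_iff intro!: bexI[of _ "\<epsilon>"])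
  qed
  show "sym arrow_rel"
  proof (rule symI)
    fix A B assume "(A, B) \<in> arrow_rel"
    then obtain y where A: "A \<in> \<Omega>" "y \<in> A" and B: "B = ginv y \<star> A" by (auto simp: connected_iff)
    have c: "A \<subseteq> carrier G" "y \<in> carrier G" using A Omega_subset by auto
    have "ginv y \<in> B" using c A Omega_one unfolding B by (simp add: mem_l_coset)
    moreover have "A = ginv (ginv y) \<star> B"
      using c by (simp add: B lcos_m_assoc lcos_mult_one)
    moreover have "B \<in> \<Omega>" unfolding B by (rule Omega_translate[OF A])
    ultimately show "(B, A) \<in> arrow_rel" by (auto simp: connected_iff)
  qed
  show "trans arrow_rel"
  proof (rule transI)
    fix A B C assume "(A, B) \<in> arrow_rel" "(B, C) \<in> arrow_rel"
    then obtain y z where A: "A \<in> \<Omega>" "y \<in> A" and B: "B = ginv y \<star> A" "z \<in> B"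
      and C: "C = ginv z \<star> B" by (auto simp: connected_iff)
    have c: "A \<subseteq> carrier G" "y \<in> carrier G" using A Omega_subset by auto
    then have zc: "z \<in> carrier G" using B l_coset_subset_G[of A "ginv y"] by auto
    have "y \<cdot> z \<in> A" using B c zc by (simp add: mem_l_coset)
    moreover have "C = ginv (y \<cdot> z) \<star> A"
      using c zc by (simp add: C B(1) lcos_m_assoc inv_mult_group)
    ultimately show "(A, C) \<in> arrow_rel" using A by (auto simp: connected_iff)
  qed
qed

lemma components_eq: "arrow_classes = \<Omega> // arrow_rel"
  by (simp add: gpd_components_def sigma_groupoid_def)

lemma component_class:
  assumes "C \<in> arrow_classes" "A \<in> C"
  shows "A \<in> \<Omega>" "C = arrow_rel `` {A}" "C = (\<lambda>y. ginv y \<star> A) ` A"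
proof -
  obtain B where B: "B \<in> \<Omega>" "C = arrow_rel `` {B}"
    using assms(1) unfolding components_eq by (auto elim: quotientE)
  with assms(2) have BA: "(B, A) \<in> arrow_rel" by auto
  then have "(A, B) \<in> arrow_rel" using connected_equiv by (auto simp: equiv_def sym_def)
  then show "A \<in> \<Omega>" by (simp add: connected_iff)
  show "C = arrow_rel `` {A}" using equiv_class_eq[OF connected_equiv BA] B(2) by simp
  then show "C = (\<lambda>y. ginv y \<star> A) ` A" using \<open>A \<in> \<Omega>\<close> by (auto simp: connected_iff)
qed

text \<open>A prohibition inside \<open>{1}\<close> has all its parameters equal to 1. Type I would
  then demand \<open>\<sigma> 1 1 = 0\<close>, and type II that an element of the field differ from
  itself.\<close>

lemma singleton_Omega: "{\<epsilon>} \<in> \<Omega>"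
proof -
  have "\<not> V \<subseteq> {\<epsilon>}" if "V \<in> prohibitions K G \<sigma>" for V
    using that
  proof (cases rule: prohibitions_cases)
    case (I h g s)
    show ?thesis
    proof
      assume "V \<subseteq> {\<epsilon>}"
      then have "g = \<epsilon>" "s = \<epsilon>" using I by auto
      with I(4) show False by (simp add: sigma_one_one)
    qed
  next
    case (II h g s t)
    show ?thesis
    proof
      assume "V \<subseteq> {\<epsilon>}"
      then have "g = \<epsilon>" "s = \<epsilon>" "t = \<epsilon>" using II by auto
      with II(5) show False by simp
    qed
  qed
  then show ?thesis by (simp add: Omega_sigma_def Omega_def)
qed

lemma discrete_imp_finite:
  assumes "Omega_sigma_topology K G \<sigma> = discrete_topology \<Omega>"
  shows "finite \<Omega>" and "\<zeta> \<in> \<Omega> \<Longrightarrow> finite \<zeta>"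
proof -
  let ?I = "carrier G - {\<epsilon>}"
  let ?\<chi> = "\<lambda>\<xi>. \<lambda>g\<in>?I. g \<in> \<xi>"
  let ?P = "product_topology (\<lambda>_. discrete_topology (UNIV :: bool set)) ?I"
  have "openin (Omega_sigma_topology K G \<sigma>) {{\<epsilon>}}"
    using singleton_Omega unfolding assms by simp
  then obtain U where U: "openin ?P U" "{{\<epsilon>}} = ?\<chi> -` U \<inter> Omega G \<inter> \<Omega>"
    unfolding Omega_sigma_topology_def Omega_topology_def openin_subtopology openin_pullback_topology by blast
  then have "?\<chi> {\<epsilon>} \<in> U" by blast
  \<comment> \<open>A basic neighbourhood of the indicator of \<open>{1}\<close>; it restricts only
    the finitely many coordinates named \<open>?N\<close> below.\<close>
  then obtain V where V: "finite {i \<in> ?I. V i \<noteq> (UNIV :: bool set)}" "?\<chi> {\<epsilon>} \<in> Pi\<^sub>E ?I V" "Pi\<^sub>E ?I V \<subseteq> U"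
    using U(1) unfolding openin_product_topology_alt by (auto simp del: PiE_restrict)
  let ?N = "{i \<in> ?I. V i \<noteq> UNIV}"
  \<comment> \<open>For \<open>y\<close> outside \<open>?N\<close> the coordinate is unrestricted,
    so \<open>{1, y}\<close> would lie in the neighbourhood that isolates
    \<open>{1}\<close>.\<close>
  have sub: "\<zeta> \<subseteq> insert \<epsilon> ?N" if \<zeta>: "\<zeta> \<in> \<Omega>" for \<zeta>
  proof (rule ccontr)
    assume "\<not> \<zeta> \<subseteq> insert \<epsilon> ?N"
    then obtain y where y: "y \<in> \<zeta>" "y \<noteq> \<epsilon>" "y \<notin> ?N" by blast
    then have "y \<in> ?I" using Omega_subset[OF \<zeta>] by auto
    with y have Vy: "V y = UNIV" by auto
    have y1: "{\<epsilon>, y} \<in> \<Omega>" using y Omega_one[OF \<zeta>] by (intro Omega_mono[OF \<zeta>]) auto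
    have "?\<chi> {\<epsilon>, y} \<in> Pi\<^sub>E ?I V"
    proof (rule PiE_I)
      fix i assume i: "i \<in> ?I"
      show "?\<chi> {\<epsilon>, y} i \<in> V i"
        using i Vy PiE_mem[OF V(2) i] by (cases "i = y") auto
    qed auto
    then have "?\<chi> {\<epsilon>, y} \<in> U" using V(3) by (rule rev_subsetD)
    moreover have "{\<epsilon>, y} \<in> Omega G" using y1 by (simp add: Omega_sigma_def)
    ultimately have "{\<epsilon>, y} \<in> ?\<chi> -` U \<inter> Omega G \<inter> \<Omega>" using y1 by blast
    then have "{\<epsilon>, y} \<in> {{\<epsilon>}}" unfolding U(2) .
    then show False using y(2) by blast
  qed
  have fin: "finite (insert \<epsilon> ?N)" using V(1) by simp
  show "\<zeta> \<in> \<Omega> \<Longrightarrow> finite \<zeta>" using sub fin by (blast intro: finite_subset)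
  have "\<Omega> \<subseteq> Pow (insert \<epsilon> ?N)" using sub by blast
  then show "finite \<Omega>" using fin by (blast intro: finite_subset)
qed

end

lemma partial_projective_rep_par_relations:
  assumes "field K" "group G" "partial_projective_rep K G R \<Gamma> \<sigma>"
  shows "par_relations_algebra R K G \<sigma> \<Gamma>"
proof -
  interpret field K by fact
  interpret group G by fact
  interpret A: unital_algebra K R using assms(3) by (simp add: partial_projective_rep_def)
  show ?thesis
    using assms(3)
    by (intro par_relations_algebra.intro par_relations_algebra_axioms.intro A.ring_axioms assms
        A.unital_algebra_axioms) (auto simp: partial_projective_rep_def)
qed

text \<open>At \<open>g = h = 1\<close> the product relation reads \<open>\<sigma> 1 1\<close> times
  the unity equals the unity. Since the unity of the representing algebra is nonzero,
  \<open>\<sigma> 1 1 = 1\<close>.\<close>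

lemma pm_factor_set_data:
  assumes "field K" "group G" "\<sigma> \<in> pm TYPE('r) K G"
  shows "factor_set_data K G \<sigma>"
proof -
  obtain R :: "('a, 'r) module" and \<Gamma> where rep: "partial_projective_rep K G R \<Gamma> \<sigma>"
    using assms(3) by (auto simp: pm_def)
  interpret P: par_relations_algebra R K G \<sigma> \<Gamma>
    by (rule partial_projective_rep_par_relations[OF assms(1,2) rep])
  have "\<sigma> \<one>\<^bsub>G\<^esub> \<one>\<^bsub>G\<^esub> \<odot>\<^bsub>R\<^esub> \<one>\<^bsub>R\<^esub> = \<one>\<^bsub>K\<^esub> \<odot>\<^bsub>R\<^esub> \<one>\<^bsub>R\<^esub>"
    using P.u_mult_right[of "\<one>\<^bsub>G\<^esub>" "\<one>\<^bsub>G\<^esub>"] by (simp add: P.u_one)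
  moreover have "\<one>\<^bsub>R\<^esub> \<noteq> \<zero>\<^bsub>R\<^esub>" using rep by (simp add: partial_projective_rep_def)
  ultimately have "\<sigma> \<one>\<^bsub>G\<^esub> \<one>\<^bsub>G\<^esub> = \<one>\<^bsub>K\<^esub>"
    using P.smult_neq_imp_zero[of "\<sigma> \<one>\<^bsub>G\<^esub> \<one>\<^bsub>G\<^esub>" "\<one>\<^bsub>K\<^esub>" "\<one>\<^bsub>R\<^esub>"] by auto
  then show ?thesis
    by (intro factor_set_data.intro factor_set_data_axioms.intro assms P.sigma_closed)
qed

section \<open>Assembling the blocks of all components\<close>

context finite_spectrum
begin

text \<open>The map \<open>a \<mapsto> inv a A\<close> sends \<open>A\<close> onto the component,
  and its fibres are the right cosets of the stabilizer. Choosing one point of each fibre gives the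
  \<open>x i\<close>.\<close>

lemma exists_representatives:
  assumes C: "C \<in> arrow_classes" and A: "A \<in> C"
  shows "\<exists>x. component K G \<sigma> A (card C) x \<and> C = component.obj G A x ` {..<card C}"
proof -
  note cl = component_class[OF C A]
  have Ac: "A \<subseteq> carrier G" by (rule Omega_subset[OF cl(1)])
  have "finite C" unfolding cl(3) by (intro finite_imageI finite_Omega_member[OF cl(1)])
  then obtain b where b: "bij_betw b {..<card C} C"
    using bij_betw_iff_card[of "{..<card C}" C] by auto
  have "\<exists>y. y \<in> A \<and> ginv y \<star> A = D" if "D \<in> C" for D
    using that equalityD1[OF cl(3)] by blast
  then have "\<forall>i\<in>{..<card C}. \<exists>y. y \<in> A \<and> ginv y \<star> A = b i"
    using bij_betwE[OF b] by blast
  from bchoice[OF this] obtain x where "\<forall>i\<in>{..<card C}. x i \<in> A \<and> ginv (x i) \<star> A = b i"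
    by blast
  then have x: "\<And>i. i < card C \<Longrightarrow> x i \<in> A \<and> ginv (x i) \<star> A = b i"
    by blast
  have xc: "x i \<in> carrier G" if "i < card C" for i using x[OF that] Ac by auto
  let ?H = "stabilizer G (l_coset G) A"
  have H: "h \<in> carrier G" "h \<star> A = A" if "h \<in> ?H" for h using that by (auto simp: stabilizer_def)
  have Hinv: "ginv h \<star> A = A" if "h \<in> ?H" for h
  proof -
    have "ginv h \<star> A = ginv h \<star> (h \<star> A)" using H[OF that] by simp
    also have "\<dots> = A" using H(1)[OF that] Ac by (simp add: lcos_m_assoc lcos_mult_one)
    finally show ?thesis .
  qed
  have hx: "ginv (h \<cdot> x i) \<star> A = b i" if "h \<in> ?H" "i < card C" for h i
  proof -
    have "ginv (h \<cdot> x i) \<star> A = ginv (x i) \<star> (ginv h \<star> A)"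
      using H(1)[OF that(1)] xc[OF that(2)] Ac by (simp add: inv_mult_group lcos_m_assoc)
    then show ?thesis using Hinv[OF that(1)] x[OF that(2)] by simp
  qed
  have "bij_betw (\<lambda>(i, h). h \<cdot> x i) ({..<card C} \<times> ?H) A"
  proof (rule bij_betw_imageI)
    show "inj_on (\<lambda>(i, h). h \<cdot> x i) ({..<card C} \<times> ?H)"
    proof (rule inj_onI, clarsimp)
      fix i h j k assume a: "i < card C" "h \<in> ?H" "j < card C" "k \<in> ?H" "h \<cdot> x i = k \<cdot> x j"
      then have "b i = b j" using hx[of h i] hx[of k j] by simp
      then have "i = j" using a inj_onD[OF bij_betw_imp_inj_on[OF b], of i j] by simp
      with a show "i = j \<and> h = k" using H xc by simp
    qed
    show "(\<lambda>(i, h). h \<cdot> x i) ` ({..<card C} \<times> ?H) = A"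
    proof (intro equalityI subsetI)
      fix a assume "a \<in> (\<lambda>(i, h). h \<cdot> x i) ` ({..<card C} \<times> ?H)"
      then obtain i h where ih: "i < card C" "h \<in> ?H" "a = h \<cdot> x i" by auto
      then have "a \<in> h \<star> A" using x by (auto simp: l_coset_def)
      then show "a \<in> A" using H(2)[OF ih(2)] by simp
    next
      fix a assume a: "a \<in> A"
      then have ac: "a \<in> carrier G" using Ac by auto
      have "ginv a \<star> A \<in> C" by (subst cl(3)) (rule imageI[OF a])
      then have "ginv a \<star> A \<in> b ` {..<card C}" by (simp only: bij_betw_imp_surj_on[OF b])
      then obtain i where i: "i < card C" "b i = ginv a \<star> A" by auto
      \<comment> \<open>Since \<open>a\<close> and \<open>x i\<close> give the same object,
        \<open>a inv (x i)\<close> stabilizes \<open>A\<close>; it is the \<open>H\<close>-part of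
        \<open>a\<close>.\<close>
      have "(a \<cdot> ginv (x i)) \<star> A = a \<star> (ginv (x i) \<star> A)"
        using ac xc[OF i(1)] Ac by (simp add: lcos_m_assoc)
      also have "\<dots> = a \<star> (ginv a \<star> A)" using x[OF i(1)] i(2) by simp
      also have "\<dots> = A" using ac Ac by (simp add: lcos_m_assoc lcos_mult_one)
      finally have "a \<cdot> ginv (x i) \<in> ?H" using ac xc[OF i(1)] by (simp add: stabilizer_def)
      moreover have "a = (a \<cdot> ginv (x i)) \<cdot> x i" using ac xc[OF i(1)] by (simp add: m_assoc)
      ultimately show "a \<in> (\<lambda>(i, h). h \<cdot> x i) ` ({..<card C} \<times> ?H)" 
        using i(1) by (intro image_eqI[of _ _ "(i, a \<cdot> ginv (x i))"]) auto
    qed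
  qed
  then have comp: "component K G \<sigma> A (card C) x"
    using x cl(1) by (intro component.intro component_axioms.intro finite_spectrum_axioms) auto
  have "component.obj G A x ` {..<card C} = b ` {..<card C}"
    using x by (intro image_cong refl) (auto simp: component.obj_def[OF comp])
  then have "component.obj G A x ` {..<card C} = C"
    using bij_betw_imp_surj_on[OF b] by (rule trans)
  then show ?thesis by (intro exI[of _ x] conjI comp) (rule sym)
qed

text \<open>Each block sees exactly the coefficients of arrows with target in its component, and the
  components partition \<open>\<Omega>\<close>. So all blocks together see all coefficients, whose
  common kernel is the ideal of relations.\<close>

lemma partial_group_algebra_isomorphic:
  assumes obj: "\<And>C. C \<in> arrow_classes \<Longrightarrow> obj C \<in> C"
  shows "\<forall>C\<in>arrow_classes. global_cocycle K (stabilizer_group G (obj C)) \<sigma>"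
    and "algebra_isomorphic K (partial_group_algebra K G \<sigma>)
      (direct_sum_algebra arrow_classes
        (\<lambda>C. matrix_algebra (card C) (twisted_group_algebra K (stabilizer_group G (obj C)) \<sigma>)))"
proof -
  have "\<forall>C\<in>arrow_classes. \<exists>x. component K G \<sigma> (obj C) (card C) x \<and> C = component.obj G (obj C) x ` {..<card C}"
    by (intro ballI exists_representatives obj)
  from bchoice[OF this] obtain X where X: "\<forall>C\<in>arrow_classes. component K G \<sigma> (obj C) (card C) (X C) \<and>
      C = component.obj G (obj C) (X C) ` {..<card C}"
    by (rule exE)
  have comp: "component K G \<sigma> (obj C) (card C) (X C)" if "C \<in> arrow_classes" for C
    using bspec[OF X that] by (rule conjunct1)
  have C_eq: "component.obj G (obj C) (X C) ` {..<card C} = C" if "C \<in> arrow_classes" for C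
    using bspec[OF X that, THEN conjunct2] by (rule sym)
  show "\<forall>C\<in>arrow_classes. global_cocycle K (stabilizer_group G (obj C)) \<sigma>"
    using component.H_global_cocycle[OF comp] by blast
  let ?M = "\<lambda>C. matrix_algebra (card C) (twisted_group_algebra K (stabilizer_group G (obj C)) \<sigma>)"
  let ?T = "direct_sum_algebra arrow_classes ?M"
  let ?b = "\<lambda>C. component.block K G \<sigma> (obj C) (card C) (X C)"
  define \<Theta> where "\<Theta> f = (\<lambda>C\<in>arrow_classes. ?b C f)" for f
  have fin: "finite arrow_classes"
    unfolding components_eq using finite_Omega by (rule finite_quotient) (auto simp: connected_iff Omega_translate)
  have cover: "arrow_rel `` {\<zeta>} \<in> arrow_classes" "\<zeta> \<in> arrow_rel `` {\<zeta>}" if "\<zeta> \<in> \<Omega>" for \<zeta>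
    unfolding components_eq using quotientI[OF that] equiv_class_self[OF connected_equiv that] by auto
  have ball_C: "(\<forall>\<zeta>\<in>C. P \<zeta>) \<longleftrightarrow> (\<forall>i<card C. P (component.obj G (obj C) (X C) i))"
    if "C \<in> arrow_classes" for C P
  proof -
    have "(\<forall>\<zeta>\<in>C. P \<zeta>) \<longleftrightarrow> (\<forall>\<zeta>\<in>component.obj G (obj C) (X C) ` {..<card C}. P \<zeta>)"
      by (simp only: C_eq[OF that])
    also have "\<dots> \<longleftrightarrow> (\<forall>i<card C. P (component.obj G (obj C) (X C) i))" by auto
    finally show ?thesis .
  qed
  have block_eq: "?b C f = ?b C f' \<longleftrightarrow> (\<forall>\<zeta>\<in>C. \<forall>g\<in>\<zeta>. arrow_coeff f \<zeta> g = arrow_coeff f' \<zeta> g)"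
    if "C \<in> arrow_classes" "f \<in> carrier F" "f' \<in> carrier F" for C f f'
    unfolding component.block_eq_iff[OF comp[OF that(1)] that(2,3)] ball_C[OF that(1)] ..
  have "algebra_isomorphic K Q.Q ?T"
  proof (rule Q.quotient_algebra_isomorphic[of \<Theta>])
    fix f assume f: "f \<in> carrier F"
    show "\<Theta> f \<in> carrier ?T"
      unfolding \<Theta>_def direct_sum_algebra_def using component.block_closed[OF comp f] fin by simp
    fix r assume r: "r \<in> carrier K"
    show "\<Theta> (r \<odot>\<^bsub>F\<^esub> f) = r \<odot>\<^bsub>?T\<^esub> \<Theta> f"
      unfolding \<Theta>_def direct_sum_algebra_def module.simps
      by (intro restrict_ext) (simp only: restrict_apply' component.block_smult[OF comp f r])
  next
    fix f f' assume f: "f \<in> carrier F" "f' \<in> carrier F"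
    show "\<Theta> (f \<otimes>\<^bsub>F\<^esub> f') = \<Theta> f \<otimes>\<^bsub>?T\<^esub> \<Theta> f'"
      unfolding \<Theta>_def direct_sum_algebra_def monoid.simps
      by (intro restrict_ext) (simp only: restrict_apply' component.block_mult[OF comp f])
    show "\<Theta> (f \<oplus>\<^bsub>F\<^esub> f') = \<Theta> f \<oplus>\<^bsub>?T\<^esub> \<Theta> f'"
      unfolding \<Theta>_def direct_sum_algebra_def ring.simps
      by (intro restrict_ext) (simp only: restrict_apply' component.block_add[OF comp f])
    have "\<Theta> f = \<Theta> f' \<longleftrightarrow> (\<forall>C\<in>arrow_classes. ?b C f = ?b C f')"
    proof
      assume eq: "\<Theta> f = \<Theta> f'"
      show "\<forall>C\<in>arrow_classes. ?b C f = ?b C f'"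
      proof
        fix C assume "C \<in> arrow_classes"
        then show "?b C f = ?b C f'" using fun_cong[OF eq, of C] by (simp only: \<Theta>_def restrict_apply')
      qed
    next
      assume "\<forall>C\<in>arrow_classes. ?b C f = ?b C f'"
      then show "\<Theta> f = \<Theta> f'" unfolding \<Theta>_def by (intro restrict_ext) blast
    qed
    also have "\<dots> \<longleftrightarrow> (\<forall>C\<in>arrow_classes. \<forall>\<zeta>\<in>C. \<forall>g\<in>\<zeta>. arrow_coeff f \<zeta> g = arrow_coeff f' \<zeta> g)"
      by (intro ball_cong refl block_eq f)
    also have "\<dots> \<longleftrightarrow> (\<forall>\<zeta>\<in>\<Omega>. \<forall>g\<in>\<zeta>. arrow_coeff f \<zeta> g = arrow_coeff f' \<zeta> g)"
      using cover component_class(1) by blast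
    also have "\<dots> \<longleftrightarrow> f \<ominus>\<^bsub>F\<^esub> f' \<in> arrow_kernel"
    proof -
      have "arrow_coeff f \<zeta> g \<ominus> arrow_coeff f' \<zeta> g = \<zero> \<longleftrightarrow> arrow_coeff f \<zeta> g = arrow_coeff f' \<zeta> g" for \<zeta> g
        using K.add.inv_solve_right'[of "\<zero>" "arrow_coeff f \<zeta> g" "arrow_coeff f' \<zeta> g"]
          arrow_coeff_closed[OF f(1)] arrow_coeff_closed[OF f(2)] by (simp add: K.minus_eq)
      then show ?thesis
        unfolding arrow_kernel_def using Fr.M.minus_closed[OF f] arrow_coeff_minus[OF f] by simp
    qed
    finally show "\<Theta> f = \<Theta> f' \<longleftrightarrow> f \<ominus>\<^bsub>F\<^esub> f' \<in> relI" unfolding relI_eq_kernel .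
  next
    show "\<Theta> \<one>\<^bsub>F\<^esub> = \<one>\<^bsub>?T\<^esub>"
      unfolding \<Theta>_def direct_sum_algebra_def monoid.simps
      by (intro restrict_ext) (simp only: component.block_one[OF comp])
  next
    fix t assume t: "t \<in> carrier ?T"
    have "\<forall>C\<in>arrow_classes. \<exists>V. (\<forall>\<zeta>\<in>C. \<forall>g\<in>\<zeta>. V \<zeta> g \<in> carrier K) \<and>
       (\<forall>f\<in>carrier F. (\<forall>\<zeta>\<in>C. \<forall>g\<in>\<zeta>. arrow_coeff f \<zeta> g = V \<zeta> g) \<longrightarrow> ?b C f = t C)"
    proof
      fix C assume C: "C \<in> arrow_classes"
      have "t \<in> (\<Pi>\<^sub>E C\<in>arrow_classes. carrier (?M C))" using t by (simp add: direct_sum_algebra_def)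
      then have "t C \<in> carrier (?M C)" using C by (rule PiE_mem)
      from component.block_prescribed[OF comp[OF C] this] obtain V where
        V: "\<forall>i<card C. \<forall>g\<in>component.obj G (obj C) (X C) i. V (component.obj G (obj C) (X C) i) g \<in> carrier K"
        "\<forall>f\<in>carrier F. (\<forall>i<card C. \<forall>g\<in>component.obj G (obj C) (X C) i.
            arrow_coeff f (component.obj G (obj C) (X C) i) g = V (component.obj G (obj C) (X C) i) g) \<longrightarrow> ?b C f = t C"
        by (elim exE conjE)
      show "\<exists>V. (\<forall>\<zeta>\<in>C. \<forall>g\<in>\<zeta>. V \<zeta> g \<in> carrier K) \<and>
         (\<forall>f\<in>carrier F. (\<forall>\<zeta>\<in>C. \<forall>g\<in>\<zeta>. arrow_coeff f \<zeta> g = V \<zeta> g) \<longrightarrow> ?b C f = t C)"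
        unfolding ball_C[OF C] by (intro exI[of _ V] conjI V)
    qed
    from bchoice[OF this] obtain V where "\<forall>C\<in>arrow_classes. (\<forall>\<zeta>\<in>C. \<forall>g\<in>\<zeta>. V C \<zeta> g \<in> carrier K) \<and>
       (\<forall>f\<in>carrier F. (\<forall>\<zeta>\<in>C. \<forall>g\<in>\<zeta>. arrow_coeff f \<zeta> g = V C \<zeta> g) \<longrightarrow> ?b C f = t C)"
      by (rule exE)
    then have V: "\<And>C \<zeta> g. C \<in> arrow_classes \<Longrightarrow> \<zeta> \<in> C \<Longrightarrow> g \<in> \<zeta> \<Longrightarrow> V C \<zeta> g \<in> carrier K"
      "\<And>C f. C \<in> arrow_classes \<Longrightarrow> f \<in> carrier F \<Longrightarrow> (\<forall>\<zeta>\<in>C. \<forall>g\<in>\<zeta>. arrow_coeff f \<zeta> g = V C \<zeta> g) \<Longrightarrow> ?b C f = t C"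
      by blast+
    \<comment> \<open>The values chosen for the separate components are glued: at
      \<open>\<zeta>\<close> those of the component of \<open>\<zeta>\<close> are used. One
      application of \<open>arrow_coeff_surj\<close> then serves all blocks simultaneously.\<close>
    have "\<exists>f\<in>carrier F. \<forall>\<zeta>\<in>\<Omega>. \<forall>g\<in>\<zeta>. arrow_coeff f \<zeta> g = V (arrow_rel `` {\<zeta>}) \<zeta> g"
      using V(1) cover by (intro arrow_coeff_surj) blast
    then obtain f where f: "f \<in> carrier F"
      "\<And>\<zeta> g. \<zeta> \<in> \<Omega> \<Longrightarrow> g \<in> \<zeta> \<Longrightarrow> arrow_coeff f \<zeta> g = V (arrow_rel `` {\<zeta>}) \<zeta> g" by blast
    have "?b C f = t C" if C: "C \<in> arrow_classes" for C
    proof (rule V(2)[OF C f(1)], intro ballI)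
      fix \<zeta> g assume "\<zeta> \<in> C" "g \<in> \<zeta>"
      then show "arrow_coeff f \<zeta> g = V C \<zeta> g"
        using f(2)[OF component_class(1)[OF C]] component_class(2)[OF C] by simp
    qed
    moreover have "t \<in> extensional arrow_classes" using t by (simp add: direct_sum_algebra_def PiE_def)
    ultimately have "\<Theta> f = t" unfolding \<Theta>_def by (intro extensionalityI[of _ arrow_classes]) auto
    then show "\<exists>f\<in>carrier F. \<Theta> f = t" using f(1) by blast
  qed
  then show "algebra_isomorphic K (partial_group_algebra K G \<sigma>) ?T"
    by (simp only: partial_group_algebra_def free_algebra_def)
qed

end

theorem theorem6p4:
  fixes K :: "('k, 'm) ring_scheme"
    and G :: "('g, 'n) monoid_scheme"
    and \<sigma> :: "'g \<Rightarrow> 'g \<Rightarrow> 'k"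
    and obj :: "'g set set \<Rightarrow> 'g set"
  assumes "Ring.field K"
    and "Group.group G"
    and "\<sigma> \<in> pm TYPE('r) K G"
    and "Omega_sigma_topology K G \<sigma> = discrete_topology (Omega_sigma K G \<sigma>)"
    and "\<And>C. C \<in> gpd_components (sigma_groupoid K G \<sigma>) \<Longrightarrow> obj C \<in> C"
  shows "(\<forall>C\<in>gpd_components (sigma_groupoid K G \<sigma>).
            global_cocycle K (stabilizer_group G (obj C)) \<sigma>) \<and>
         algebra_isomorphic K
           (partial_group_algebra K G \<sigma>)
           (direct_sum_algebra (gpd_components (sigma_groupoid K G \<sigma>))
              (\<lambda>C. matrix_algebra (card C)
                      (twisted_group_algebra K (stabilizer_group G (obj C)) \<sigma>)))"
proof -
  interpret factor_set_data K G \<sigma>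
    by (rule pm_factor_set_data[OF assms(1-3)])
  interpret finite_spectrum K G \<sigma>
    by unfold_locales (use discrete_imp_finite[OF assms(4)] in auto)
  show ?thesis using partial_group_algebra_isomorphic[OF assms(5)] by blast
qed

end
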